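(* The $\mathcal{H}^\circ_{G_p}$-module $\mathcal{I}(G_p/G_p^\circ)$ is cyclic, generated by the class $[\phi_0\otimes\xi_0]$, where $\phi_0=\mathrm{ch}(\mathbf{Z}_p^2)$ and $\xi_0=\mathrm{ch}(G_p^\circ)$.
   Context: Let $p$ be a prime, $H_p=\mathrm{GL}_2(\mathbf{Q}_p)$, $H_p^\circ=\mathrm{GL}_2(\mathbf{Z}_p)$, $G_p=H_p\times H_p$, $G_p^\circ=H_p^\circ\times H_p^\circ$, with $H_p$ embedded in $G_p$ diagonally. Haar measures on $H_p$, $G_p$ give $H_p^\circ$, $G_p^\circ$ volume $1$. $\mathcal{H}^\circ_{G_p}$ is the algebra of compactly supported $G_p^\circ$-bi-invariant $\mathbf{C}$-valued functions on $G_p$ under convolution. $\mathcal{S}(\mathbf{Q}_p^2)$ is the space of locally constant compactly supported $\mathbf{C}$-valued functions on row vectors $\mathbf{Q}_p^2$. $\mathcal{I}(G_p/G_p^\circ)$ is the space of $H_p$-coinvariants of $\mathcal{S}(\mathbf{Q}_p^2)\otimes C_c^\infty(G_p/G_p^\circ)$ for the action $h\cdot(\phi\otimes\xi)=\phi((-)h)\otimes\xi(h^{-1}(-))$; $[\phi\otimes\xi]$ denotes the class of $\phi\otimes\xi$. The group $G_p$ acts by $g\cdot(\phi\otimes\xi)=\phi\otimes\xi((-)g)$, which induces an action of $\mathcal{H}^\circ_{G_p}$ on $\mathcal{I}(G_p/G_p^\circ)$ given by $\theta\cdot[\phi\otimes\xi]=[\phi\otimes\int_{G_p}\theta(g)\xi((-)g)\,dg]$.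 *)

theory Defs
  imports "HOL-Analysis.Analysis" "HOL-Algebra.Module" "HOL-Library.Function_Algebras"
begin

section \<open>The field of \<open>p\<close>-adic numbers\<close>

text \<open>
  The prime \<open>p\<close> is the cardinality of a type parameter \<open>'p\<close>, so that \<open>'p padic\<close> below is the field
  of \<open>p\<close>-adic numbers.
\<close>

class prime_card = finite + assumes prime_card: "prime (CARD('a))"

text \<open>
  The normalised absolute value on the rationals, with \<open>\<bar>p\<bar> = 1/p\<close>.
\<close>

definition padic_abs :: "nat \<Rightarrow> rat \<Rightarrow> real" where
  "padic_abs p x = (if x = 0 then 0 else
     (case quotient_of x of (a, b) \<Rightarrow>
        real p powi (int (multiplicity (int p) b) - int (multiplicity (int p) a))))"

lemma padic_abs_0 [simp]: "padic_abs p 0 = 0"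
  by (simp add: padic_abs_def)

lemma padic_abs_frac:
  assumes p: "prime p" and "a \<noteq> 0" "b \<noteq> 0"
  shows "padic_abs p (of_int a / of_int b) =
    real p powi (int (multiplicity (int p) b) - int (multiplicity (int p) a))"
proof -
  obtain c d where q: "quotient_of (of_int a / of_int b) = (c, d)" by (cases "quotient_of (of_int a / of_int b)")
  have d: "d \<noteq> 0" using quotient_of_denom_pos[OF q] by simp
  have e: "(of_int a / of_int b :: rat) = of_int c / of_int d" using quotient_of_div[OF q] .
  have c: "c \<noteq> 0" using e assms d by auto
  have "(of_int (a * d) :: rat) = of_int (c * b)" using e assms d by (simp add: field_simps)
  then have "a * d = c * b" using of_int_eq_iff by blast
  then have "multiplicity (int p) (a * d) = multiplicity (int p) (c * b)" by simp
  then have "multiplicity (int p) a + multiplicity (int p) d = multiplicity (int p) c + multiplicity (int p) b"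
    using p assms c d by (simp add: prime_elem_multiplicity_mult_distrib)
  then show ?thesis using assms q by (simp add: padic_abs_def) (smt (verit) of_nat_add)
qed

lemma rat_frac: obtains a b where "(x::rat) = of_int a / of_int b" "b \<noteq> 0"
proof -
  obtain c d where q: "quotient_of x = (c, d)" by (cases "quotient_of x")
  show ?thesis using that[of c d] quotient_of_div[OF q] quotient_of_denom_pos[OF q] by simp
qed

context
  fixes p :: nat
  assumes p: "prime p"
begin

lemma padic_abs_nonneg: "0 \<le> padic_abs p x"
  by (simp add: padic_abs_def split: prod.split)

lemma padic_abs_eq_0: "padic_abs p x = 0 \<longleftrightarrow> x = 0"
  using p by (auto simp: padic_abs_def split: prod.splits)

lemma padic_abs_1: "padic_abs p 1 = 1"
  using padic_abs_frac[OF p, of 1 1] by simp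

lemma padic_abs_mult: "padic_abs p (x * y) = padic_abs p x * padic_abs p y"
proof (cases "x = 0 \<or> y = 0")
  case False
  obtain a b where x: "x = of_int a / of_int b" "b \<noteq> 0" by (rule rat_frac)
  obtain c d where y: "y = of_int c / of_int d" "d \<noteq> 0" by (rule rat_frac)
  have nz: "a \<noteq> 0" "c \<noteq> 0" using False x y by auto
  have "x * y = of_int (a * c) / of_int (b * d)" using x y by simp
  then have "padic_abs p (x * y) = real p powi (int (multiplicity (int p) (b * d)) - int (multiplicity (int p) (a * c)))"
    using padic_abs_frac[OF p, of "a * c" "b * d"] nz x y by simp
  also have "\<dots> = padic_abs p x * padic_abs p y"
    unfolding x(1) y(1) using p nz x(2) y(2)
    by (simp add: padic_abs_frac prime_elem_multiplicity_mult_distrib flip: power_int_add)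
      (simp add: algebra_simps)
  finally show ?thesis .
qed auto

lemma padic_abs_minus: "padic_abs p (- x) = padic_abs p x"
proof -
  have "padic_abs p (- 1) = 1"
    using padic_abs_mult[of "-1" "-1"] padic_abs_nonneg[of "-1"]
    by (simp add: padic_abs_1) (metis abs_of_nonneg real_sqrt_abs2 real_sqrt_one)
  then show ?thesis using padic_abs_mult[of "-1" x] by simp
qed

lemma padic_abs_diff_commute: "padic_abs p (x - y) = padic_abs p (y - x)"
  using padic_abs_minus[of "x - y"] by simp

lemma padic_abs_add_le: "padic_abs p (x + y) \<le> max (padic_abs p x) (padic_abs p y)"
proof (cases "x = 0 \<or> y = 0 \<or> x + y = 0")
  case True
  then show ?thesis using padic_abs_nonneg[of x] padic_abs_nonneg[of y] by (auto simp: max_def)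
next
  case False
  obtain a b where x: "x = of_int a / of_int b" "b \<noteq> 0" by (rule rat_frac)
  obtain c d where y: "y = of_int c / of_int d" "d \<noteq> 0" by (rule rat_frac)
  define A where "A = a * d" define C where "C = c * b" define D where "D = b * d"
  have D: "D \<noteq> 0" using x y D_def by simp
  have x': "x = of_int A / of_int D" and y': "y = of_int C / of_int D"
    using x y by (simp_all add: A_def C_def D_def)
  then have s: "x + y = of_int (A + C) / of_int D" by (simp add: add_divide_distrib)
  have nz: "A \<noteq> 0" "C \<noteq> 0" "A + C \<noteq> 0" using False x' y' s by auto
  have p1: "1 \<le> real p" using prime_ge_1_nat[OF p] by simp
  have np: "\<not> is_unit (int p)" using prime_gt_1_nat[OF p] by simp
  have m: "min (multiplicity (int p) A) (multiplicity (int p) C) \<le> multiplicity (int p) (A + C)"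
    using nz np
    by (intro multiplicity_geI dvd_add) (auto intro!: multiplicity_dvd')
  have "real p powi (int (multiplicity (int p) D) - int (multiplicity (int p) (A + C)))
     \<le> real p powi (int (multiplicity (int p) D) - int (min (multiplicity (int p) A) (multiplicity (int p) C)))"
    using m p1 by (intro power_int_increasing) auto
  also have "\<dots> \<le> max (padic_abs p x) (padic_abs p y)"
    unfolding x' y' using nz D by (simp add: padic_abs_frac[OF p] min_def)
  finally show ?thesis unfolding s padic_abs_frac[OF p nz(3) D] .
qed

lemma padic_abs_triangle: "padic_abs p (x + y) \<le> padic_abs p x + padic_abs p y"
  using padic_abs_add_le[of x y] padic_abs_nonneg[of x] padic_abs_nonneg[of y] by linarith

lemma padic_abs_reverse_triangle: "\<bar>padic_abs p x - padic_abs p y\<bar> \<le> padic_abs p (x - y)"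
  using padic_abs_triangle[of "x - y" y] padic_abs_triangle[of "y - x" x] padic_abs_diff_commute[of x y] by simp

end



definition padic_cauchy :: "nat \<Rightarrow> (nat \<Rightarrow> rat) \<Rightarrow> bool" where
  "padic_cauchy p X \<longleftrightarrow> (\<forall>e>0. \<exists>k. \<forall>m\<ge>k. \<forall>n\<ge>k. padic_abs p (X m - X n) < e)"

context
  fixes p :: nat
  assumes p: "prime p"
begin

lemma padic_abs_diff_triangle: "padic_abs p (x - z) \<le> padic_abs p (x - y) + padic_abs p (y - z)"
  using padic_abs_triangle[OF p, of "x - y" "y - z"] by simp

lemma padic_cauchy_convergent:
  assumes "padic_cauchy p X" shows "convergent (\<lambda>n. padic_abs p (X n))"
  unfolding Cauchy_convergent_iff[symmetric] Cauchy_def dist_real_def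
  using assms padic_abs_reverse_triangle[OF p] unfolding padic_cauchy_def by (meson order_le_less_trans)

lemma padic_cauchy_bounded:
  assumes "padic_cauchy p X" obtains B where "B > 0" "\<And>n. padic_abs p (X n) \<le> B"
proof -
  have "Bseq (\<lambda>n. padic_abs p (X n))"
    using padic_cauchy_convergent[OF assms] convergent_imp_Bseq by blast
  then show ?thesis using that by (auto simp: Bseq_def padic_abs_nonneg[OF p])
qed

lemma padic_cauchy_const: "padic_cauchy p (\<lambda>_. c)"
  by (simp add: padic_cauchy_def)

lemma padic_cauchy_add:
  assumes "padic_cauchy p X" "padic_cauchy p Y" shows "padic_cauchy p (\<lambda>n. X n + Y n)"
  unfolding padic_cauchy_def
proof (intro allI impI)
  fix e :: real assume "e > 0"
  then obtain k l where kl: "\<forall>m\<ge>k. \<forall>n\<ge>k. padic_abs p (X m - X n) < e"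
      "\<forall>m\<ge>l. \<forall>n\<ge>l. padic_abs p (Y m - Y n) < e"
    using assms unfolding padic_cauchy_def by meson
  have "padic_abs p (X m + Y m - (X n + Y n)) < e" if "m \<ge> max k l" "n \<ge> max k l" for m n
  proof -
    have "padic_abs p (X m - X n) < e" "padic_abs p (Y m - Y n) < e" using kl that by auto
    then show ?thesis
      using padic_abs_add_le[OF p, of "X m - X n" "Y m - Y n"] by (simp add: add_diff_add)
  qed
  then show "\<exists>k. \<forall>m\<ge>k. \<forall>n\<ge>k. padic_abs p (X m + Y m - (X n + Y n)) < e" by blast
qed

lemma padic_cauchy_minus:
  assumes "padic_cauchy p X" shows "padic_cauchy p (\<lambda>n. - X n)"
proof -
  have "padic_abs p (- X m - - X n) = padic_abs p (X m - X n)" for m n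
    using padic_abs_diff_commute[OF p, of "X n" "X m"] by (simp add: algebra_simps)
  then show ?thesis using assms by (simp add: padic_cauchy_def)
qed

lemma padic_cauchy_mult:
  assumes X: "padic_cauchy p X" and Y: "padic_cauchy p Y" shows "padic_cauchy p (\<lambda>n. X n * Y n)"
  unfolding padic_cauchy_def
proof (intro allI impI)
  fix e :: real assume e: "e > 0"
  obtain B where B: "B > 0" "\<And>n. padic_abs p (X n) \<le> B" using padic_cauchy_bounded[OF X] by metis
  obtain C where C: "C > 0" "\<And>n. padic_abs p (Y n) \<le> C" using padic_cauchy_bounded[OF Y] by metis
  obtain k where k: "\<forall>m\<ge>k. \<forall>n\<ge>k. padic_abs p (X m - X n) < e / C"
    using X e C unfolding padic_cauchy_def by (meson divide_pos_pos)
  obtain l where l: "\<forall>m\<ge>l. \<forall>n\<ge>l. padic_abs p (Y m - Y n) < e / B"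
    using Y e B unfolding padic_cauchy_def by (meson divide_pos_pos)
  have "padic_abs p (X m * Y m - X n * Y n) < e" if "m \<ge> max k l" "n \<ge> max k l" for m n
  proof -
    have "padic_abs p (X m) * padic_abs p (Y m - Y n) \<le> B * padic_abs p (Y m - Y n)"
      by (rule mult_right_mono[OF B(2) padic_abs_nonneg[OF p]])
    also have "\<dots> < e" using l that B(1) by (simp add: pos_less_divide_eq mult.commute)
    finally have "padic_abs p (X m) * padic_abs p (Y m - Y n) < e" .
    moreover have "padic_abs p (X m - X n) * padic_abs p (Y n) \<le> padic_abs p (X m - X n) * C"
      by (rule mult_left_mono[OF C(2) padic_abs_nonneg[OF p]])
    moreover have "padic_abs p (X m - X n) * C < e" using k that C(1) by (simp add: pos_less_divide_eq)
    moreover have "X m * Y m - X n * Y n = X m * (Y m - Y n) + (X m - X n) * Y n"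
      by (simp add: algebra_simps)
    ultimately show ?thesis
      using padic_abs_add_le[OF p, of "X m * (Y m - Y n)" "(X m - X n) * Y n"]
      by (simp add: padic_abs_mult[OF p])
  qed
  then show "\<exists>k. \<forall>m\<ge>k. \<forall>n\<ge>k. padic_abs p (X m * Y m - X n * Y n) < e" by blast
qed

lemma padic_cauchy_not_null:
  assumes X: "padic_cauchy p X" and nn: "\<not> (\<lambda>n. padic_abs p (X n)) \<longlonglongrightarrow> 0"
  obtains b k where "b > 0" "\<And>n. n \<ge> k \<Longrightarrow> b < padic_abs p (X n)"
proof -
  obtain L where L: "(\<lambda>n. padic_abs p (X n)) \<longlonglongrightarrow> L"
    using padic_cauchy_convergent[OF X] convergent_def by blast
  have "L \<ge> 0" using L by (rule LIMSEQ_le_const) (auto simp: padic_abs_nonneg[OF p])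
  with nn L have "L > 0" by (metis order_le_less)
  then have "eventually (\<lambda>n. L / 2 < padic_abs p (X n)) sequentially"
    using L by (intro order_tendstoD(1)) auto
  with \<open>L > 0\<close> that[of "L / 2"] show ?thesis by (auto simp: eventually_sequentially)
qed

lemma padic_abs_inverse: "padic_abs p (inverse x) = inverse (padic_abs p x)"
proof (cases "x = 0")
  case False
  then have "padic_abs p (inverse x) * padic_abs p x = 1"
    using padic_abs_mult[OF p, of "inverse x" x] by (simp add: padic_abs_1[OF p])
  then show ?thesis using inverse_unique mult.commute by metis
qed simp

lemma padic_cauchy_inverse:
  assumes X: "padic_cauchy p X" and nn: "\<not> (\<lambda>n. padic_abs p (X n)) \<longlonglongrightarrow> 0"
  shows "padic_cauchy p (\<lambda>n. inverse (X n))"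
  unfolding padic_cauchy_def
proof (intro allI impI)
  fix e :: real assume e: "e > 0"
  obtain b k where b: "b > 0" "\<And>n. n \<ge> k \<Longrightarrow> b < padic_abs p (X n)"
    using padic_cauchy_not_null[OF assms] by metis
  obtain l where l: "\<forall>m\<ge>l. \<forall>n\<ge>l. padic_abs p (X m - X n) < e * (b * b)"
    using X e b unfolding padic_cauchy_def by (meson mult_pos_pos)
  have "padic_abs p (inverse (X m) - inverse (X n)) < e" if "m \<ge> max k l" "n \<ge> max k l" for m n
  proof -
    have bm: "b < padic_abs p (X m)" "b < padic_abs p (X n)" using b that by auto
    then have nz: "X m \<noteq> 0" "X n \<noteq> 0" using b by auto
    have "inverse (X m) - inverse (X n) = (X n - X m) * inverse (X m) * inverse (X n)"
      using nz by (simp add: field_simps)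
    then have "padic_abs p (inverse (X m) - inverse (X n)) =
      padic_abs p (X n - X m) / (padic_abs p (X m) * padic_abs p (X n))"
      by (simp only: padic_abs_mult[OF p] padic_abs_inverse) (simp add: field_simps)
    also have "\<dots> \<le> padic_abs p (X n - X m) / (b * b)"
      using bm b by (intro divide_left_mono mult_mono) (auto simp: padic_abs_nonneg[OF p])
    also have "\<dots> < e" using l that b by (simp add: pos_divide_less_eq)
    finally show ?thesis .
  qed
  then show "\<exists>k. \<forall>m\<ge>k. \<forall>n\<ge>k. padic_abs p (inverse (X m) - inverse (X n)) < e" by blast
qed

end

text \<open>
  The field of \<open>p\<close>-adic numbers is the completion of the rationals: Cauchy sequences for the
  \<open>p\<close>-adic absolute value modulo null sequences.
\<close>

typedef (overloaded) 'p cauchy_seq = "{X. padic_cauchy CARD('p::prime_card) X}"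
  by (rule exI[of _ "\<lambda>_. 0"]) (simp add: padic_cauchy_def)

setup_lifting type_definition_cauchy_seq

instantiation cauchy_seq :: (prime_card) comm_ring_1
begin

lift_definition zero_cauchy_seq :: "'a cauchy_seq" is "\<lambda>_. 0" by (rule padic_cauchy_const[OF prime_card])
lift_definition one_cauchy_seq :: "'a cauchy_seq" is "\<lambda>_. 1" by (rule padic_cauchy_const[OF prime_card])
lift_definition plus_cauchy_seq :: "'a cauchy_seq \<Rightarrow> 'a cauchy_seq \<Rightarrow> 'a cauchy_seq"
  is "\<lambda>X Y n. X n + Y n" by (rule padic_cauchy_add[OF prime_card])
lift_definition uminus_cauchy_seq :: "'a cauchy_seq \<Rightarrow> 'a cauchy_seq"
  is "\<lambda>X n. - X n" by (rule padic_cauchy_minus[OF prime_card])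
lift_definition minus_cauchy_seq :: "'a cauchy_seq \<Rightarrow> 'a cauchy_seq \<Rightarrow> 'a cauchy_seq"
  is "\<lambda>X Y n. X n - Y n"
  using padic_cauchy_add[OF prime_card _ padic_cauchy_minus[OF prime_card]] by fastforce
lift_definition times_cauchy_seq :: "'a cauchy_seq \<Rightarrow> 'a cauchy_seq \<Rightarrow> 'a cauchy_seq"
  is "\<lambda>X Y n. X n * Y n" by (rule padic_cauchy_mult[OF prime_card])

instance
  by standard (transfer; simp add: fun_eq_iff algebra_simps)+

end

lift_definition seq_norm :: "'p::prime_card cauchy_seq \<Rightarrow> real"
  is "\<lambda>X. lim (\<lambda>n. padic_abs CARD('p) (X n))" .

lift_definition seq_inverse :: "'p::prime_card cauchy_seq \<Rightarrow> 'p cauchy_seq"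
  is "\<lambda>X. if (\<lambda>n. padic_abs CARD('p) (X n)) \<longlonglongrightarrow> 0 then (\<lambda>_. 0) else (\<lambda>n. inverse (X n))"
  by (auto intro: padic_cauchy_inverse[OF prime_card] padic_cauchy_const[OF prime_card])

lemma seq_norm_tendsto:
  "(\<lambda>n. padic_abs CARD('p) (Rep_cauchy_seq X n)) \<longlonglongrightarrow> seq_norm (X :: 'p::prime_card cauchy_seq)"
  using padic_cauchy_convergent[OF prime_card] Rep_cauchy_seq[of X]
  by (auto simp: seq_norm.rep_eq convergent_LIMSEQ_iff)

lemma seq_norm_eq_0_iff:
  "seq_norm (X :: 'p::prime_card cauchy_seq) = 0 \<longleftrightarrow> (\<lambda>n. padic_abs CARD('p) (Rep_cauchy_seq X n)) \<longlonglongrightarrow> 0"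
  using seq_norm_tendsto[of X] LIMSEQ_unique by metis

lemma seq_norm_nonneg: "0 \<le> seq_norm (X :: 'p::prime_card cauchy_seq)"
  using seq_norm_tendsto[of X] by (rule LIMSEQ_le_const) (auto simp: padic_abs_nonneg[OF prime_card])

lemma seq_norm_0: "seq_norm (0 :: 'p::prime_card cauchy_seq) = 0"
  by (simp add: seq_norm_eq_0_iff zero_cauchy_seq.rep_eq)

lemma seq_norm_1: "seq_norm (1 :: 'p::prime_card cauchy_seq) = 1"
  using seq_norm_tendsto[of "1 :: 'p cauchy_seq"] LIMSEQ_unique[OF _ tendsto_const]
  by (auto simp: one_cauchy_seq.rep_eq padic_abs_1[OF prime_card])

lemma seq_norm_minus: "seq_norm (- X :: 'p::prime_card cauchy_seq) = seq_norm X"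
  by (simp add: seq_norm.rep_eq uminus_cauchy_seq.rep_eq padic_abs_minus[OF prime_card])

lemma seq_norm_mult: "seq_norm (X * Y :: 'p::prime_card cauchy_seq) = seq_norm X * seq_norm Y"
  using tendsto_mult[OF seq_norm_tendsto[of X] seq_norm_tendsto[of Y]] seq_norm_tendsto[of "X * Y"]
  by (simp add: times_cauchy_seq.rep_eq padic_abs_mult[OF prime_card] LIMSEQ_unique)

lemma seq_norm_add_le: "seq_norm (X + Y :: 'p::prime_card cauchy_seq) \<le> max (seq_norm X) (seq_norm Y)"
  by (rule LIMSEQ_le[OF seq_norm_tendsto tendsto_max[OF seq_norm_tendsto seq_norm_tendsto]])
    (auto simp: plus_cauchy_seq.rep_eq padic_abs_add_le[OF prime_card])

lemma seq_norm_diff_le: "seq_norm (X - Y :: 'p::prime_card cauchy_seq) \<le> max (seq_norm X) (seq_norm Y)"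
  using seq_norm_add_le[of X "- Y"] by (simp add: seq_norm_minus)

lemma seq_inverse_mult:
  assumes "seq_norm (X :: 'p::prime_card cauchy_seq) \<noteq> 0"
  shows "seq_norm (seq_inverse X * X - 1) = 0"
proof -
  have nn: "\<not> (\<lambda>n. padic_abs CARD('p) (Rep_cauchy_seq X n)) \<longlonglongrightarrow> 0"
    using assms seq_norm_eq_0_iff by blast
  obtain b k where "b > 0" and b: "\<And>n. n \<ge> k \<Longrightarrow> b < padic_abs CARD('p) (Rep_cauchy_seq X n)"
    using padic_cauchy_not_null[OF prime_card _ nn] Rep_cauchy_seq[of X] by auto
  then have "Rep_cauchy_seq X n \<noteq> 0" if "n \<ge> k" for n
    using that by force
  then have "eventually (\<lambda>n. padic_abs CARD('p) (Rep_cauchy_seq (seq_inverse X * X - 1) n) = 0) sequentially"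
    using nn by (intro eventually_sequentiallyI[of k])
      (simp add: seq_inverse.rep_eq times_cauchy_seq.rep_eq minus_cauchy_seq.rep_eq one_cauchy_seq.rep_eq)
  then show ?thesis unfolding seq_norm_eq_0_iff by (rule tendsto_eventually)
qed

quotient_type (overloaded) 'p padic = "'p::prime_card cauchy_seq" / "\<lambda>X Y. seq_norm (X - Y) = 0"
proof (rule equivpI)
  show "reflp (\<lambda>X Y :: 'p cauchy_seq. seq_norm (X - Y) = 0)"
    by (rule reflpI) (simp add: seq_norm_0)
  show "symp (\<lambda>X Y :: 'p cauchy_seq. seq_norm (X - Y) = 0)"
    by (rule sympI) (metis minus_diff_eq seq_norm_minus)
  show "transp (\<lambda>X Y :: 'p cauchy_seq. seq_norm (X - Y) = 0)"
  proof (rule transpI)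
    fix X Y Z :: "'p cauchy_seq"
    assume "seq_norm (X - Y) = 0" "seq_norm (Y - Z) = 0"
    then show "seq_norm (X - Z) = 0"
      using seq_norm_add_le[of "X - Y" "Y - Z"] seq_norm_nonneg[of "X - Z"] by simp
  qed
qed

lemma seq_norm_cong: "seq_norm (X - Y :: 'p::prime_card cauchy_seq) = 0 \<Longrightarrow> seq_norm X = seq_norm Y"
  using seq_norm_add_le[of "X - Y" Y] seq_norm_diff_le[of X "X - Y"]
    seq_norm_nonneg[of X] seq_norm_nonneg[of Y] by (simp add: max_def split: if_splits)

instantiation padic :: (prime_card) field
begin

lift_definition zero_padic :: "'a padic" is 0 .
lift_definition one_padic :: "'a padic" is 1 .
lift_definition plus_padic :: "'a padic \<Rightarrow> 'a padic \<Rightarrow> 'a padic" is "(+)"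
proof -
  fix A B C D :: "'a cauchy_seq"
  assume "seq_norm (A - B) = 0" "seq_norm (C - D) = 0"
  then show "seq_norm (A + C - (B + D)) = 0"
    using seq_norm_add_le[of "A - B" "C - D"] seq_norm_nonneg[of "A + C - (B + D)"]
    by (simp add: algebra_simps)
qed
lift_definition uminus_padic :: "'a padic \<Rightarrow> 'a padic" is "uminus"
  by (metis minus_diff_eq minus_diff_minus seq_norm_minus)
lift_definition minus_padic :: "'a padic \<Rightarrow> 'a padic \<Rightarrow> 'a padic" is "(-)"
proof -
  fix A B C D :: "'a cauchy_seq"
  assume "seq_norm (A - B) = 0" "seq_norm (C - D) = 0"
  then show "seq_norm (A - C - (B - D)) = 0"
    using seq_norm_diff_le[of "A - B" "C - D"] seq_norm_nonneg[of "A - C - (B - D)"]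
    by (simp add: algebra_simps)
qed
lift_definition times_padic :: "'a padic \<Rightarrow> 'a padic \<Rightarrow> 'a padic" is "(*)"
proof -
  fix A B C D :: "'a cauchy_seq"
  assume *: "seq_norm (A - B) = 0" "seq_norm (C - D) = 0"
  have "A * C - B * D = (A - B) * C + B * (C - D)" by (simp add: algebra_simps)
  with * show "seq_norm (A * C - B * D) = 0"
    using seq_norm_add_le[of "(A - B) * C" "B * (C - D)"] seq_norm_nonneg[of "A * C - B * D"]
    by (simp add: seq_norm_mult)
qed
lift_definition inverse_padic :: "'a padic \<Rightarrow> 'a padic" is seq_inverse
proof -
  fix A B :: "'a cauchy_seq"
  assume AB: "seq_norm (A - B) = 0"
  show "seq_norm (seq_inverse A - seq_inverse B) = 0"
  proof (cases "seq_norm A = 0")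
    case True
    then have "seq_norm B = 0" using seq_norm_cong[OF AB] by simp
    with True have "seq_inverse A = 0" "seq_inverse B = 0"
      unfolding seq_norm_eq_0_iff
      by (simp_all add: seq_inverse.rep_eq zero_cauchy_seq.rep_eq flip: Rep_cauchy_seq_inject)
    then show ?thesis by (simp add: seq_norm_0)
  next
    case False
    let ?a = "seq_inverse A" and ?b = "seq_inverse B"
    have B: "seq_norm B \<noteq> 0" using seq_norm_cong[OF AB] False by simp
    have "?a - ?b = ?a * (B - A) * ?b + ((?a * A - 1) * ?b - ?a * (?b * B - 1))"
      by (simp add: algebra_simps)
    moreover have "seq_norm (?a * (B - A) * ?b) = 0"
      using AB seq_norm_minus[of "A - B"] by (simp add: seq_norm_mult)
    moreover have "seq_norm ((?a * A - 1) * ?b - ?a * (?b * B - 1)) = 0"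
      using seq_norm_diff_le[of "(?a * A - 1) * ?b" "?a * (?b * B - 1)"]
        seq_inverse_mult[OF False] seq_inverse_mult[OF B]
        seq_norm_nonneg[of "(?a * A - 1) * ?b - ?a * (?b * B - 1)"]
      by (simp add: seq_norm_mult)
    ultimately show ?thesis
      using seq_norm_add_le[of "?a * (B - A) * ?b" "(?a * A - 1) * ?b - ?a * (?b * B - 1)"]
        seq_norm_nonneg[of "?a - ?b"] by simp
  qed
qed
definition divide_padic :: "'a padic \<Rightarrow> 'a padic \<Rightarrow> 'a padic" where
  "divide_padic x y = x * inverse y"

instance
proof
  fix a b c :: "'a padic"
  show "a + b + c = a + (b + c)" by transfer (simp add: algebra_simps seq_norm_0)
  show "a + b = b + a" by transfer (simp add: algebra_simps seq_norm_0)
  show "0 + a = a" by transfer (simp add: seq_norm_0)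
  show "- a + a = 0" by transfer (simp add: seq_norm_0)
  show "a - b = a + - b" by transfer (simp add: seq_norm_0)
  show "a * b * c = a * (b * c)" by transfer (simp add: algebra_simps seq_norm_0)
  show "a * b = b * a" by transfer (simp add: algebra_simps seq_norm_0)
  show "1 * a = a" by transfer (simp add: seq_norm_0)
  show "(a + b) * c = a * c + b * c" by transfer (simp add: algebra_simps seq_norm_0)
  show "(0 :: 'a padic) \<noteq> 1" by transfer (simp add: seq_norm_minus seq_norm_1)
  show "a \<noteq> 0 \<Longrightarrow> inverse a * a = 1" by transfer (simp add: seq_inverse_mult)
  show "a div b = a * inverse b" by (rule divide_padic_def)
  show "inverse (0 :: 'a padic) = 0"
    by transfer (simp add: seq_inverse.rep_eq zero_cauchy_seq.rep_eq zero_cauchy_seq_def[symmetric]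
       seq_norm.rep_eq minus_cauchy_seq.rep_eq)
qed

end

lift_definition padic_norm :: "'p::prime_card padic \<Rightarrow> real" is seq_norm
  by (rule seq_norm_cong)

lemma padic_norm_nonneg: "0 \<le> padic_norm (x :: 'p::prime_card padic)"
  by transfer (rule seq_norm_nonneg)

lemma padic_norm_eq_0: "padic_norm (x :: 'p::prime_card padic) = 0 \<longleftrightarrow> x = 0"
  by transfer simp

lemma padic_norm_mult: "padic_norm (x * y :: 'p::prime_card padic) = padic_norm x * padic_norm y"
  by transfer (rule seq_norm_mult)

lemma padic_norm_minus: "padic_norm (- x :: 'p::prime_card padic) = padic_norm x"
  by transfer (rule seq_norm_minus)

lemma padic_norm_add_le: "padic_norm (x + y :: 'p::prime_card padic) \<le> max (padic_norm x) (padic_norm y)"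
  by transfer (rule seq_norm_add_le)

instantiation padic :: (prime_card) metric_space
begin

definition dist_padic :: "'a padic \<Rightarrow> 'a padic \<Rightarrow> real" where
  "dist_padic x y = padic_norm (x - y)"

definition uniformity_padic :: "('a padic \<times> 'a padic) filter" where
  "uniformity_padic = (INF e\<in>{0<..}. principal {(x, y). dist x y < e})"

definition open_padic :: "'a padic set \<Rightarrow> bool" where
  "open_padic U \<longleftrightarrow> (\<forall>x\<in>U. eventually (\<lambda>(x', y). x' = x \<longrightarrow> y \<in> U) uniformity)"

instance
proof
  fix x y z :: "'a padic"
  show "dist x y = 0 \<longleftrightarrow> x = y" by (simp add: dist_padic_def padic_norm_eq_0)
  show "dist x y \<le> dist x z + dist y z"
    using padic_norm_add_le[of "x - z" "z - y"] padic_norm_minus[of "y - z"]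
      padic_norm_nonneg[of "x - z"] padic_norm_nonneg[of "y - z"]
    by (simp add: dist_padic_def)
qed (simp_all add: uniformity_padic_def open_padic_def)

end

section \<open>Tensor products of function spaces\<close>

definition cscale :: "complex \<Rightarrow> ('x \<Rightarrow> complex) \<Rightarrow> 'x \<Rightarrow> complex" where
  "cscale c f = (\<lambda>x. c * f x)"

global_interpretation fun_vs: vector_space cscale
  by standard (simp_all add: cscale_def fun_eq_iff algebra_simps)

text \<open>
  Tensor products are only needed for spaces of complex-valued functions.  The tensor product of
  spaces of functions on \<open>X\<close> and on \<open>Y\<close> is realised inside the functions on \<open>X \<times> Y\<close>; that this is
  the algebraic tensor product is \<open>tensor_universal\<close> below (uniqueness is clear, as pure tensors span).
\<close>

definition tensor :: "('x \<Rightarrow> complex) \<Rightarrow> ('y \<Rightarrow> complex) \<Rightarrow> 'x \<times> 'y \<Rightarrow> complex" where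
  "tensor f g = (\<lambda>(x, y). f x * g y)"

definition tensor_space :: "('x \<Rightarrow> complex) set \<Rightarrow> ('y \<Rightarrow> complex) set \<Rightarrow> ('x \<times> 'y \<Rightarrow> complex) set" where
  "tensor_space A B = fun_vs.span {tensor a b | a b. a \<in> A \<and> b \<in> B}"

lemma sum_fun_apply: "(\<Sum>i\<in>I. f i) x = (\<Sum>i\<in>I. f i x)" for f :: "'i \<Rightarrow> 'x \<Rightarrow> 'y::comm_monoid_add"
  by (induction I rule: infinite_finite_induct) auto

lemma tensor_sums_zero:
  assumes P: "fun_vs.independent P" and Q: "fun_vs.independent Q"
    and S: "finite S" "S \<subseteq> P" and T: "finite T" "T \<subseteq> Q"
    and z: "(\<Sum>a\<in>S. \<Sum>b\<in>T. cscale (u a b) (tensor a b)) = 0"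
    and ab: "a \<in> S" "b \<in> T"
  shows "u a b = 0"
proof -
  have "(\<Sum>b\<in>T. u a b * b y) = 0" if "a \<in> S" for a y
  proof -
    have "(\<Sum>a\<in>S. cscale (\<Sum>b\<in>T. u a b * b y) a) = 0"
    proof
      fix x
      have "(\<Sum>a\<in>S. \<Sum>b\<in>T. cscale (u a b) (tensor a b)) (x, y) = 0" using z by simp
      then show "(\<Sum>a\<in>S. cscale (\<Sum>b\<in>T. u a b * b y) a) x = 0 x"
        by (simp add: sum_fun_apply cscale_def tensor_def sum_distrib_left sum_distrib_right mult_ac)
    qed
    then show ?thesis using fun_vs.independentD[OF P S, of "\<lambda>a. \<Sum>b\<in>T. u a b * b y" a] that by simp
  qed
  then have "(\<Sum>b\<in>T. cscale (u a b) b) = 0"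
    using ab by (auto simp: fun_eq_iff sum_fun_apply cscale_def)
  then show ?thesis using fun_vs.independentD[OF Q T] ab by auto
qed

lemma inj_on_tensor:
  assumes P: "fun_vs.independent P" and Q: "fun_vs.independent Q"
  shows "inj_on (\<lambda>(a, b). tensor a b) (P \<times> Q)"
proof (rule inj_onI, clarify)
  fix a b a' b' assume mem: "a \<in> P" "b \<in> Q" "a' \<in> P" "b' \<in> Q" and eq: "tensor a b = tensor a' b'"
  define u where "u s t = (if (s, t) = (a, b) then 1 else 0) - (if (s, t) = (a', b') then 1 else (0::complex))" for s t
  have 1: "(\<Sum>s\<in>{a, a'}. \<Sum>t\<in>{b, b'}. cscale (u s t) (tensor s t)) = 0"
    using eq by (cases "a = a'"; cases "b = b'") (simp_all add: u_def)
  have "u a b = 0"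
    by (rule tensor_sums_zero[OF P Q _ _ _ _ 1]) (use mem in auto)
  then show "a = a' \<and> b = b'" by (auto simp: u_def split: if_splits)
qed

lemma independent_tensor:
  assumes P: "fun_vs.independent P" and Q: "fun_vs.independent Q"
  shows "fun_vs.independent {tensor a b | a b. a \<in> P \<and> b \<in> Q}"
  unfolding fun_vs.independent_explicit_module
proof (intro allI impI)
  fix X u v
  assume X: "finite X" "X \<subseteq> {tensor a b | a b. a \<in> P \<and> b \<in> Q}"
    and z: "(\<Sum>v\<in>X. cscale (u v) v) = 0" and v: "v \<in> X"
  let ?t = "\<lambda>(a, b). tensor a b"
  have "X \<subseteq> ?t ` (P \<times> Q)" using X(2) by auto
  then obtain R where R: "finite R" "R \<subseteq> P \<times> Q" "X = ?t ` R"
    using finite_subset_image[OF X(1)] by metis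
  have inj: "inj_on ?t R" using inj_on_subset[OF inj_on_tensor[OF P Q] R(2)] .
  define S T where "S = fst ` R" and "T = snd ` R"
  have fin: "finite S" "finite T" "S \<subseteq> P" "T \<subseteq> Q" using R by (auto simp: S_def T_def)
  define w where "w a b = (if (a, b) \<in> R then u (tensor a b) else 0)" for a b
  have "(\<Sum>a\<in>S. \<Sum>b\<in>T. cscale (w a b) (tensor a b)) = (\<Sum>r\<in>S \<times> T. case r of (a, b) \<Rightarrow> cscale (w a b) (tensor a b))"
    by (simp add: sum.cartesian_product)
  also have "\<dots> = (\<Sum>r\<in>R. case r of (a, b) \<Rightarrow> cscale (u (tensor a b)) (tensor a b))"
    by (rule sum.mono_neutral_cong_right)
      (use R fin in \<open>auto simp: w_def S_def T_def cscale_def fun_eq_iff rev_image_eqI\<close>)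
  also have "\<dots> = (\<Sum>v\<in>X. cscale (u v) v)"
    unfolding R(3) by (subst sum.reindex[OF inj]) (auto intro!: sum.cong)
  finally have 0: "(\<Sum>a\<in>S. \<Sum>b\<in>T. cscale (w a b) (tensor a b)) = 0" using z by simp
  obtain a b where ab: "(a, b) \<in> R" "v = tensor a b" using v R(3) by auto
  then have "a \<in> S" "b \<in> T" by (auto simp: S_def T_def image_iff intro: bexI[of _ "(a, b)"])
  from tensor_sums_zero[OF P Q fin(1,3) fin(2,4) 0 this] ab show "u v = 0" by (simp add: w_def)
qed

lemma tensor_linear:
  "tensor (a + a') b = tensor a b + tensor a' b" "tensor a (b + b') = tensor a b + tensor a b'"
  "tensor (cscale c a) b = cscale c (tensor a b)" "tensor a (cscale c b) = cscale c (tensor a b)"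
  "tensor 0 b = 0" "tensor a 0 = 0"
  by (auto simp: tensor_def cscale_def fun_eq_iff algebra_simps)

theorem tensor_universal:
  fixes scale :: "complex \<Rightarrow> 'w::ab_group_add \<Rightarrow> 'w"
  assumes W: "vector_space scale" and A: "fun_vs.subspace A" and B: "fun_vs.subspace B"
    and add1: "\<And>a a' b. a \<in> A \<Longrightarrow> a' \<in> A \<Longrightarrow> b \<in> B \<Longrightarrow> \<beta> (a + a') b = \<beta> a b + \<beta> a' b"
    and add2: "\<And>a b b'. a \<in> A \<Longrightarrow> b \<in> B \<Longrightarrow> b' \<in> B \<Longrightarrow> \<beta> a (b + b') = \<beta> a b + \<beta> a b'"
    and scale1: "\<And>c a b. a \<in> A \<Longrightarrow> b \<in> B \<Longrightarrow> \<beta> (cscale c a) b = scale c (\<beta> a b)"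
    and scale2: "\<And>c a b. a \<in> A \<Longrightarrow> b \<in> B \<Longrightarrow> \<beta> a (cscale c b) = scale c (\<beta> a b)"
  shows "\<exists>L. Vector_Spaces.linear cscale scale L \<and> (\<forall>a\<in>A. \<forall>b\<in>B. L (tensor a b) = \<beta> a b)"
proof -
  interpret W: vector_space scale by (rule W)
  interpret pair: vector_space_pair cscale scale ..
  obtain P where P: "P \<subseteq> A" "fun_vs.independent P" "A \<subseteq> fun_vs.span P"
    using fun_vs.maximal_independent_subset[of A] by metis
  obtain Q where Q: "Q \<subseteq> B" "fun_vs.independent Q" "B \<subseteq> fun_vs.span Q"
    using fun_vs.maximal_independent_subset[of B] by metis
  have AP: "A = fun_vs.span P" and BQ: "B = fun_vs.span Q"
    using P Q fun_vs.span_minimal[OF _ A] fun_vs.span_minimal[OF _ B] by blast+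
  let ?t = "\<lambda>(a, b). tensor a b" and ?E = "{tensor a b | a b. a \<in> P \<and> b \<in> Q}"
  define f where "f v = (case inv_into (P \<times> Q) ?t v of (a, b) \<Rightarrow> \<beta> a b)" for v
  obtain L where L: "Vector_Spaces.linear cscale scale L" "\<forall>v\<in>?E. L v = f v"
    using pair.linear_independent_extend[OF independent_tensor[OF P(2) Q(2)], of f] by blast
  interpret L: Vector_Spaces.linear cscale scale L by (rule L)
  have base: "L (tensor a b) = \<beta> a b" if "a \<in> P" "b \<in> Q" for a b
  proof -
    have "inv_into (P \<times> Q) ?t (?t (a, b)) = (a, b)"
      by (rule inv_into_f_f[OF inj_on_tensor[OF P(2) Q(2)]]) (use that in simp)
    then show ?thesis using L(2) that by (force simp: f_def)
  qed
  have zero1: "\<beta> 0 b = 0" if "b \<in> B" for b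
    using add1[OF fun_vs.subspace_0[OF A] fun_vs.subspace_0[OF A] that] by simp
  have zero2: "\<beta> a 0 = 0" if "a \<in> A" for a
    using add2[OF that fun_vs.subspace_0[OF B] fun_vs.subspace_0[OF B]] by simp
  have left: "L (tensor a b) = \<beta> a b" if a: "a \<in> P" and b: "b \<in> fun_vs.span Q" for a b
  proof -
    have aA: "a \<in> A" using a P(1) by blast
    have "b \<in> B \<and> L (tensor a b) = \<beta> a b"
      using b
    proof (induction rule: fun_vs.span_induct_alt)
      case base
      show ?case using fun_vs.subspace_0[OF B] by (simp only: tensor_linear L.zero zero2[OF aA])
    next
      case (step c x y)
      then have m: "x \<in> B" "cscale c x \<in> B" "y \<in> B" "cscale c x + y \<in> B"
        using Q(1) fun_vs.subspace_scale[OF B] fun_vs.subspace_add[OF B] by blast+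
      show ?case
        using step base[OF a, of x] m(4)
        by (simp only: tensor_linear L.add L.scale add2[OF aA m(2,3)] scale2[OF aA m(1)])
    qed
    then show ?thesis by blast
  qed
  have "L (tensor a b) = \<beta> a b" if b: "b \<in> B" and a: "a \<in> fun_vs.span P" for a b
  proof -
    have bQ: "b \<in> fun_vs.span Q" using b BQ by blast
    have "a \<in> A \<and> L (tensor a b) = \<beta> a b"
      using a
    proof (induction rule: fun_vs.span_induct_alt)
      case base
      show ?case using fun_vs.subspace_0[OF A] by (simp only: tensor_linear L.zero zero1[OF b])
    next
      case (step c x y)
      then have m: "x \<in> A" "cscale c x \<in> A" "y \<in> A" "cscale c x + y \<in> A"
        using P(1) fun_vs.subspace_scale[OF A] fun_vs.subspace_add[OF A] by blast+
      show ?case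
        using step left[OF _ bQ, of x] m(4)
        by (simp only: tensor_linear L.add L.scale add1[OF m(2,3) b] scale1[OF m(1) b])
    qed
    then show ?thesis by blast
  qed
  then show ?thesis using L(1) AP by blast
qed

section \<open>The groups and the Hecke module\<close>

definition padic_int :: "'p::prime_card padic set" where
  "padic_int = {x. padic_norm x \<le> 1}"

definition GL2 :: "('p::prime_card padic ^ 2 ^ 2) monoid" where
  "GL2 = \<lparr>carrier = {A. invertible A}, monoid.mult = (**), one = mat 1\<rparr>"

text \<open>
  Invertibility over the ring of integers, i.e. the inverse matrix is integral too.
\<close>

definition GL2_int :: "('p::prime_card padic ^ 2 ^ 2) set" where
  "GL2_int = {A. (\<forall>i j. A $ i $ j \<in> padic_int) \<and>
     (\<exists>B. (\<forall>i j. B $ i $ j \<in> padic_int) \<and> A ** B = mat 1 \<and> B ** A = mat 1)}"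

lemma group_GL2: "group (GL2 :: ('p::prime_card padic ^ 2 ^ 2) monoid)"
proof (rule groupI)
  fix A :: "'p padic ^ 2 ^ 2" assume "A \<in> carrier GL2"
  then obtain B where "A ** B = mat 1" "B ** A = mat 1" by (auto simp: GL2_def invertible_def)
  then show "\<exists>B\<in>carrier GL2. B \<otimes>\<^bsub>GL2\<^esub> A = \<one>\<^bsub>GL2\<^esub>"
    by (intro bexI[of _ B]) (auto simp: GL2_def invertible_def)
qed (auto simp: GL2_def matrix_mul_assoc invertible_mult matrix_mul_lid invertible_def[of "mat 1"])

text \<open>
  Functions on \<open>G\<^sub>p\<close> are represented by functions on pairs of arbitrary matrices that vanish outside
  \<open>carrier GG\<close>; this is enforced by \<open>compactly_supported_on\<close> below.  The embedding of \<open>GL2\<close> is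
  \<open>h \<mapsto> (h, h)\<close>.
\<close>

type_synonym 'p GG = "('p padic ^ 2 ^ 2) \<times> ('p padic ^ 2 ^ 2)"

definition GG :: "('p::prime_card GG) monoid" where
  "GG = GL2 \<times>\<times> GL2"

definition GG_int :: "('p::prime_card GG) set" where
  "GG_int = GL2_int \<times> GL2_int"

text \<open>
  Left Haar measures on a group whose topology is the subspace topology of its carrier.  Regularity
  is not listed: for a locally compact second countable group such as \<open>GG\<close> it follows from
  finiteness on compact sets.
\<close>

definition haar_measure :: "('a::topological_space, 'b) monoid_scheme \<Rightarrow> 'a measure \<Rightarrow> bool" where
  "haar_measure G M \<longleftrightarrow>
     sets M = sets (restrict_space borel (carrier G)) \<and>
     (\<forall>g\<in>carrier G. \<forall>A\<in>sets M. emeasure M ((\<lambda>x. g \<otimes>\<^bsub>G\<^esub> x) ` A) = emeasure M A) \<and>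
     (\<forall>K\<subseteq>carrier G. compact K \<longrightarrow> emeasure M K < \<infinity>) \<and>
     emeasure M (carrier G) \<noteq> 0"

definition locally_constant_on :: "'a::topological_space set \<Rightarrow> ('a \<Rightarrow> 'b) \<Rightarrow> bool" where
  "locally_constant_on S f \<longleftrightarrow> (\<forall>x\<in>S. \<exists>U. open U \<and> x \<in> U \<and> (\<forall>y\<in>U \<inter> S. f y = f x))"

definition compactly_supported_on :: "'a::topological_space set \<Rightarrow> ('a \<Rightarrow> complex) \<Rightarrow> bool" where
  "compactly_supported_on S f \<longleftrightarrow> (\<exists>K\<subseteq>S. compact K \<and> (\<forall>x. x \<notin> K \<longrightarrow> f x = 0))"

definition schwartz_space :: "('p::prime_card padic ^ 2 \<Rightarrow> complex) set" where
  "schwartz_space = {\<phi>. locally_constant_on UNIV \<phi> \<and> compactly_supported_on UNIV \<phi>}"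

definition smooth_right_inv :: "('p::prime_card GG \<Rightarrow> complex) set" where
  "smooth_right_inv = {\<xi>. locally_constant_on (carrier GG) \<xi> \<and> compactly_supported_on (carrier GG) \<xi> \<and>
     (\<forall>g\<in>carrier GG. \<forall>k\<in>GG_int. \<xi> (g \<otimes>\<^bsub>GG\<^esub> k) = \<xi> g)}"

definition hecke_algebra :: "'p::prime_card GG measure \<Rightarrow> ('p GG \<Rightarrow> complex) ring" where
  "hecke_algebra M = \<lparr>
     carrier = {\<theta>. compactly_supported_on (carrier GG) \<theta> \<and>
       (\<forall>g\<in>carrier GG. \<forall>k\<in>GG_int. \<forall>k'\<in>GG_int. \<theta> (k \<otimes>\<^bsub>GG\<^esub> g \<otimes>\<^bsub>GG\<^esub> k') = \<theta> g)},
     monoid.mult = (\<lambda>\<theta> \<eta> x. LINT g|M. \<theta> g * \<eta> (inv\<^bsub>GG\<^esub> g \<otimes>\<^bsub>GG\<^esub> x)),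
     one = indicator GG_int,
     zero = 0,
     add = (+)\<rparr>"

text \<open>
  The action of \<open>h\<close> in \<open>GL2\<close>; see \<open>diag_act_tensor\<close> for its effect on pure tensors.
\<close>

definition diag_act :: "'p::prime_card padic ^ 2 ^ 2 \<Rightarrow>
    (('p padic ^ 2) \<times> 'p GG \<Rightarrow> complex) \<Rightarrow> ('p padic ^ 2) \<times> 'p GG \<Rightarrow> complex" where
  "diag_act h f = (\<lambda>(x, g). f (x v* h, inv\<^bsub>GG\<^esub> (h, h) \<otimes>\<^bsub>GG\<^esub> g))"

lemma diag_act_tensor:
  "diag_act h (tensor \<phi> \<xi>) = tensor (\<lambda>x. \<phi> (x v* h)) (\<lambda>g. \<xi> (inv\<^bsub>GG\<^esub> (h, h) \<otimes>\<^bsub>GG\<^esub> g))"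
  by (simp add: diag_act_def tensor_def)

text \<open>
  The action of the Hecke algebra before passing to coinvariants; see \<open>hecke_act_tensor\<close>.
\<close>

definition hecke_act :: "'p::prime_card GG measure \<Rightarrow> ('p GG \<Rightarrow> complex) \<Rightarrow>
    (('p padic ^ 2) \<times> 'p GG \<Rightarrow> complex) \<Rightarrow> ('p padic ^ 2) \<times> 'p GG \<Rightarrow> complex" where
  "hecke_act M \<theta> f = (\<lambda>(x, y). LINT g|M. \<theta> g * f (x, y \<otimes>\<^bsub>GG\<^esub> g))"

lemma hecke_act_tensor:
  "hecke_act M \<theta> (tensor \<phi> \<xi>) = tensor \<phi> (\<lambda>y. LINT g|M. \<theta> g * \<xi> (y \<otimes>\<^bsub>GG\<^esub> g))"
  by (simp add: hecke_act_def tensor_def fun_eq_iff mult.left_commute)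

definition schwartz_tensor :: "(('p::prime_card padic ^ 2) \<times> 'p GG \<Rightarrow> complex) set" where
  "schwartz_tensor = tensor_space schwartz_space smooth_right_inv"

definition coinv_rel :: "(('p::prime_card padic ^ 2) \<times> 'p GG \<Rightarrow> complex) rel" where
  "coinv_rel = {(f, f'). f \<in> schwartz_tensor \<and> f' \<in> schwartz_tensor \<and>
     f - f' \<in> fun_vs.span {diag_act h v - v | h v. h \<in> carrier GL2 \<and> v \<in> schwartz_tensor}}"

definition coinv_class :: "(('p::prime_card padic ^ 2) \<times> 'p GG \<Rightarrow> complex) \<Rightarrow>
    (('p padic ^ 2) \<times> 'p GG \<Rightarrow> complex) set" where
  "coinv_class f = coinv_rel `` {f}"

text \<open>
  The fields \<open>mult\<close> and \<open>one\<close> are not used for modules.  Operations on classes are defined by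
  collecting the results for all representatives.
\<close>

definition coinv_module :: "'p::prime_card GG measure \<Rightarrow>
    ('p GG \<Rightarrow> complex, (('p padic ^ 2) \<times> 'p GG \<Rightarrow> complex) set) module" where
  "coinv_module M = \<lparr>
     carrier = schwartz_tensor // coinv_rel,
     monoid.mult = undefined, one = undefined,
     zero = coinv_class 0,
     add = (\<lambda>X Y. \<Union>f\<in>X. \<Union>f'\<in>Y. coinv_class (f + f')),
     smult = (\<lambda>\<theta> X. \<Union>f\<in>X. coinv_class (hecke_act M \<theta> f))\<rparr>"

definition cyclic_with_generator ::
    "('r, 's) ring_scheme \<Rightarrow> ('r, 'm, 't) module_scheme \<Rightarrow> 'm \<Rightarrow> bool" where
  "cyclic_with_generator R N x \<longleftrightarrow> x \<in> carrier N \<and> carrier N = {r \<odot>\<^bsub>N\<^esub> x | r. r \<in> carrier R}"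

end

theory Submission
  imports Defs "HOL-Algebra.Coset"
begin

text \<open>
  Applying a Hecke operator \<open>\<theta>\<close> to \<open>\<phi>\<^sub>0 \<otimes> \<xi>\<^sub>0\<close> gives \<open>\<phi>\<^sub>0 \<otimes> \<theta>(g\<^sup>-\<^sup>1)\<close>, so the claim is that every class has
  a representative \<open>\<phi>\<^sub>0 \<otimes> \<eta>\<close> with \<open>\<eta>\<close> bi-invariant.

  Up to the action of \<open>GL\<^sub>2\<close>, averaging over unit scalars writes every Schwartz function as a combination of
  characteristic functions of lattices: for \<open>v\<close> primitive in \<open>L\<close>, the union of the translates
  \<open>uv + p\<^sup>mL\<close> over units \<open>u\<close> is a difference of the lattices \<open>\<int>\<^sub>pv + p\<^sup>mL\<close> and \<open>p\<int>\<^sub>pv + p\<^sup>mL\<close>. Hence the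
  coinvariants are spanned by symbols \<open>[A; B, C]\<close> of triples of lattices. Fix \<open>B\<close> and \<open>C\<close>, at distance
  \<open>n\<close> in the tree. The relation between a lattice and its \<open>p + 1\<close> neighbours, together with the stabiliser of
  \<open>B\<close> and \<open>C\<close>, reduces \<open>A\<close> to a vertex on the geodesic from \<open>B\<close> to \<open>C\<close>. For such \<open>A\<close>, say \<open>A = 1\<close>, the
  class of \<open>\<phi>\<^sub>0 \<otimes> ch(KBK \<times> KCK)\<close> is a positive multiple of \<open>[1; B, C]\<close> plus symbols \<open>[1; B, kC]\<close> for which
  \<open>B\<close> and \<open>kC\<close> have distance less than \<open>n\<close>, and induction on \<open>n\<close> applies.
\<close>


section \<open>Arithmetic and topology of the p-adic numbers\<close>

text \<open>Every reduction below has one shape: an identity between symbols whose total is known to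
  be reducible, that is, represented as the overview asks, while each term is either reducible or
  congruent to one unknown symbol F. The terms of the second kind are counted by a positive integer,
  and dividing by it settles F. Symbols depend on lattices, not on homothety classes: the neighbour
  relation contains both L and pL, whose indicators differ. So a step through the tree has to be
  known at all scales at once, and two consecutive vertices are needed to reach the next. The
  induction interlocks: all A at distances below n give the A on the geodesic at distance n, and
  these give all A at distance n. The distance drops for the following reason. Let A be the origin,
  strictly between B and C on the diagonal apartment, and let a be the upper left entry of k. If a
  is a unit, k is the product of an element fixing A and B and one fixing C, so kC contributes the
  same class as C. If not, the paths from A to B and from A to kC share their first edge, and the
  distance is at most n - 2.\<close>

lift_definition const_seq :: "rat \<Rightarrow> 'p::prime_card cauchy_seq" is "\<lambda>r _. r"
  by (rule padic_cauchy_const[OF prime_card])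

lift_definition padic_of_rat :: "rat \<Rightarrow> 'p::prime_card padic" is const_seq .

lemma seq_norm_const: "seq_norm (const_seq r :: 'p::prime_card cauchy_seq) = padic_abs CARD('p) r"
  by transfer simp

lemma padic_norm_of_rat: "padic_norm (padic_of_rat r :: 'p::prime_card padic) = padic_abs CARD('p) r"
  by transfer (rule seq_norm_const)

lemma padic_of_rat_add: "padic_of_rat (r + s) = (padic_of_rat r + padic_of_rat s :: 'p::prime_card padic)"
proof -
  have "const_seq (r + s) = (const_seq r + const_seq s :: 'p cauchy_seq)" by transfer simp
  then show ?thesis by transfer (simp add: seq_norm_0)
qed

lemma padic_of_rat_diff: "padic_of_rat (r - s) = (padic_of_rat r - padic_of_rat s :: 'p::prime_card padic)"
  using padic_of_rat_add[of "r - s" s, where 'p='p] by simp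

lemma padic_of_rat_1: "padic_of_rat 1 = (1 :: 'p::prime_card padic)"
proof -
  have "const_seq 1 = (1 :: 'p cauchy_seq)" by transfer simp
  then show ?thesis by transfer (simp add: seq_norm_0)
qed

lemma padic_of_rat_of_nat: "padic_of_rat (of_nat n) = (of_nat n :: 'p::prime_card padic)"
proof (induction n)
  case 0
  show ?case using padic_of_rat_diff[of 0 0, where 'p='p] by simp
next
  case (Suc n)
  then show ?case by (simp add: padic_of_rat_add padic_of_rat_1)
qed

lemma padic_norm_0 [simp]: "padic_norm (0 :: 'p::prime_card padic) = 0"
  by (simp add: padic_norm_eq_0)

lemma padic_norm_1 [simp]: "padic_norm (1 :: 'p::prime_card padic) = 1"
  by transfer (rule seq_norm_1)

lemma padic_norm_inverse: "padic_norm (inverse x) = inverse (padic_norm (x :: 'p::prime_card padic))"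
proof (cases "x = 0")
  case False
  then have "padic_norm (inverse x) * padic_norm x = 1" by (simp flip: padic_norm_mult)
  then show ?thesis using inverse_unique mult.commute by metis
qed simp

lemma padic_norm_divide: "padic_norm (x / y) = padic_norm x / padic_norm (y :: 'p::prime_card padic)"
  by (simp add: divide_inverse padic_norm_mult padic_norm_inverse)

lemma padic_norm_power: "padic_norm (x ^ n) = padic_norm (x :: 'p::prime_card padic) ^ n"
  by (induction n) (simp_all add: padic_norm_mult)

lemma padic_norm_powi: "padic_norm (x powi k) = padic_norm (x :: 'p::prime_card padic) powi k"
  by (simp add: power_int_def padic_norm_power padic_norm_inverse)

lemma padic_norm_diff_le: "padic_norm (x - y :: 'p::prime_card padic) \<le> max (padic_norm x) (padic_norm y)"
  using padic_norm_add_le[of x "- y"] by (simp add: padic_norm_minus)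

lemma padic_norm_diff_commute: "padic_norm (x - y) = padic_norm (y - x :: 'p::prime_card padic)"
  using padic_norm_minus[of "x - y"] by simp

lemma padic_norm_add_eq:
  assumes "padic_norm y < padic_norm (x :: 'p::prime_card padic)"
  shows "padic_norm (x + y) = padic_norm x" "padic_norm (y + x) = padic_norm x"
    "padic_norm (x - y) = padic_norm x" "padic_norm (y - x) = padic_norm x"
proof -
  have *: "padic_norm (x + z) = padic_norm x" if "padic_norm z < padic_norm x" for z
    using that padic_norm_add_le[of x z] padic_norm_diff_le[of "x + z" z] by simp
  show "padic_norm (x + y) = padic_norm x" "padic_norm (y + x) = padic_norm x"
    using *[OF assms] by (simp_all add: add.commute)
  show "padic_norm (x - y) = padic_norm x" "padic_norm (y - x) = padic_norm x"
    using *[of "- y"] assms padic_norm_diff_commute[of x y] by (simp_all add: padic_norm_minus)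
qed

abbreviation unif :: "'p::prime_card padic" where
  "unif \<equiv> of_nat CARD('p)"

lemma prime_card_gt_1: "1 < real CARD('p::prime_card)"
  using prime_gt_1_nat[OF prime_card, where 'a1='p] by simp

lemma padic_norm_of_nat:
  assumes "n \<noteq> 0"
  shows "padic_norm (of_nat n :: 'p::prime_card padic) = (1 / real CARD('p)) ^ multiplicity CARD('p) n"
proof -
  have "padic_abs CARD('p) (of_nat n) = real CARD('p) powi (- int (multiplicity (int CARD('p)) (int n)))"
    using padic_abs_frac[OF prime_card, of "int n" 1, where 'a1='p] assms by simp
  also have "multiplicity (int CARD('p)) (int n) = multiplicity CARD('p) n"
  proof (rule multiplicity_eqI)
    have np: "\<not> is_unit CARD('p)" using prime_gt_1_nat[OF prime_card, where 'a1='p] by simp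
    show "int CARD('p) ^ multiplicity CARD('p) n dvd int n"
      by (simp add: multiplicity_dvd flip: of_nat_power)
    show "\<not> int CARD('p) ^ Suc (multiplicity CARD('p) n) dvd int n"
      using power_dvd_iff_le_multiplicity[OF assms np, of "Suc (multiplicity CARD('p) n)"]
      by (simp del: power_Suc flip: of_nat_power)
  qed
  finally show ?thesis
    by (simp add: padic_norm_of_rat[symmetric] padic_of_rat_of_nat power_int_minus power_one_over inverse_eq_divide)
qed

lemma padic_norm_unif [simp]: "padic_norm (unif :: 'p::prime_card padic) = 1 / real CARD('p)"
  using padic_norm_of_nat[of "CARD('p)", where 'p='p] prime_gt_1_nat[OF prime_card, where 'a1='p]
  by (simp add: multiplicity_self)

lemma unif_nonzero [simp]: "(unif :: 'p::prime_card padic) \<noteq> 0"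
  using prime_card_gt_1[where 'p='p] by (simp flip: padic_norm_eq_0)

lemma padic_norm_of_nat_le_1: "padic_norm (of_nat n :: 'p::prime_card padic) \<le> 1"
  using prime_card_gt_1[where 'p='p] by (cases "n = 0") (simp_all add: padic_norm_of_nat power_le_one)

lemma padic_norm_of_nat_eq_1:
  assumes "\<not> CARD('p) dvd n"
  shows "padic_norm (of_nat n :: 'p::prime_card padic) = 1"
proof -
  have "n \<noteq> 0" using assms by (metis dvd_0_right)
  then show ?thesis using assms by (simp add: padic_norm_of_nat not_dvd_imp_multiplicity_0 del: neq0_conv)
qed

text \<open>Turns closeness of natural numbers back into a congruence; this gives uniqueness of
  representatives modulo p^m.\<close>

lemma power_dvd_of_padic_norm:
  assumes "padic_norm (of_nat n :: 'p::prime_card padic) \<le> (1 / real CARD('p)) ^ m"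
  shows "CARD('p) ^ m dvd n"
proof (cases "n = 0")
  case False
  then have "(1 / real CARD('p)) ^ multiplicity CARD('p) n \<le> (1 / real CARD('p)) ^ m"
    using assms by (simp add: padic_norm_of_nat)
  then have "m \<le> multiplicity CARD('p) n"
    using prime_card_gt_1[where 'p='p] by (subst (asm) power_decreasing_iff) auto
  then show ?thesis by (rule multiplicity_dvd')
qed simp

section \<open>Rational approximation, the value group and digits\<close>

lemma padic_rat_dense:
  assumes "e > 0"
  obtains r where "padic_norm (x - padic_of_rat r :: 'p::prime_card padic) < e"
proof -
  have "\<exists>r. padic_norm (x - padic_of_rat r) < e"
  proof (transfer fixing: e)
    fix X :: "'p cauchy_seq"
    have "padic_cauchy CARD('p) (Rep_cauchy_seq X)" using Rep_cauchy_seq[of X] by simp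
    moreover have "e / 2 > 0" using assms by simp
    ultimately obtain k where k: "\<And>m n. m \<ge> k \<Longrightarrow> n \<ge> k \<Longrightarrow>
        padic_abs CARD('p) (Rep_cauchy_seq X m - Rep_cauchy_seq X n) < e / 2"
      unfolding padic_cauchy_def by meson
    let ?r = "Rep_cauchy_seq X k"
    have "seq_norm (X - const_seq ?r) \<le> e / 2"
      using seq_norm_tendsto[of "X - const_seq ?r"]
      by (rule LIMSEQ_le_const2)
        (use k in \<open>auto simp: minus_cauchy_seq.rep_eq const_seq.rep_eq intro!: exI[of _ k] less_imp_le\<close>)
    then show "\<exists>r. seq_norm (X - const_seq r) < e" using assms by (intro exI[of _ ?r]) auto
  qed
  then show ?thesis using that by blast
qed

text \<open>In an ultrametric an error smaller than |x| cannot change the norm. So norms of nonzero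
  elements are norms of rationals, hence powers of p.\<close>

lemma padic_rat_dense_same_norm:
  assumes "x \<noteq> 0" "e > 0"
  obtains r where "padic_norm (x - padic_of_rat r :: 'p::prime_card padic) < e"
    "padic_abs CARD('p) r = padic_norm x"
proof -
  have "padic_norm x > 0" using assms padic_norm_nonneg[of x] by (simp add: padic_norm_eq_0 less_le)
  then obtain r where r: "padic_norm (x - padic_of_rat r) < min e (padic_norm x)"
    using padic_rat_dense[of "min e (padic_norm x)" x] assms by auto
  then have "padic_norm (x - (x - padic_of_rat r)) = padic_norm x"
    by (intro padic_norm_add_eq) auto
  then show ?thesis using r that by (auto simp: padic_norm_of_rat)
qed

lemma padic_norm_discrete:
  assumes "x \<noteq> 0"
  obtains k where "padic_norm (x :: 'p::prime_card padic) = real CARD('p) powi k"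
proof -
  obtain r where r: "padic_abs CARD('p) r = padic_norm x"
    using padic_rat_dense_same_norm[OF assms, of 1] by auto
  then have "r \<noteq> 0" using assms by (auto simp: padic_norm_eq_0)
  then show ?thesis using r that by (auto simp: padic_abs_def split: prod.splits dest: sym)
qed

lemma padic_unit_decomp:
  assumes "x \<noteq> (0 :: 'p::prime_card padic)"
  obtains k u where "x = unif powi k * u" "padic_norm u = 1"
proof -
  obtain k where k: "padic_norm x = real CARD('p) powi k" by (rule padic_norm_discrete[OF assms])
  have "padic_norm (x / unif powi (-k)) = 1"
    using prime_card_gt_1[where 'p='p]
    by (simp only: padic_norm_divide padic_norm_powi padic_norm_inverse padic_norm_unif k power_int_one_over power_int_minus) simp
  then show ?thesis using that[of "-k" "x / unif powi (-k)"] by simp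
qed

lemma powi_less_cancel_iff: "1 < (x::real) \<Longrightarrow> x powi m < x powi n \<longleftrightarrow> m < n"
  using power_int_strict_increasing[of m n x] power_int_increasing[of n m x] by linarith

lemma powi_le_cancel_iff: "1 < (x::real) \<Longrightarrow> x powi m \<le> x powi n \<longleftrightarrow> m \<le> n"
  using powi_less_cancel_iff[of x n m] by linarith

text \<open>The value group is discrete, with no norm strictly between 1/p and 1. This makes
  division by p possible below norm 1, and the unit sphere closed.\<close>

lemma padic_norm_lt_1_iff:
  "padic_norm x < 1 \<longleftrightarrow> padic_norm (x :: 'p::prime_card padic) \<le> 1 / real CARD('p)"
proof (cases "x = 0")
  case False
  then obtain k where k: "padic_norm x = real CARD('p) powi k" by (rule padic_norm_discrete)
  have p: "1 < real CARD('p)" by (rule prime_card_gt_1)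
  have "real CARD('p) powi k < 1 \<longleftrightarrow> k < 0"
    using powi_less_cancel_iff[OF p, of k 0] by simp
  moreover have "real CARD('p) powi k \<le> real CARD('p) powi -1 \<longleftrightarrow> k \<le> -1"
    using powi_le_cancel_iff[OF p, of k "-1"] by simp
  ultimately show ?thesis unfolding k by (auto simp: power_int_minus divide_inverse)
qed (use prime_card_gt_1[where 'p='p] in auto)

lemma padic_norm_lt_1_divide:
  assumes "padic_norm (x :: 'p::prime_card padic) < 1"
  shows "padic_norm (x / unif) \<le> 1"
  using assms prime_card_gt_1[where 'p='p]
  by (simp add: padic_norm_lt_1_iff padic_norm_divide field_simps)

lemma padic_residue:
  assumes "padic_norm (x :: 'p::prime_card padic) \<le> 1"
  obtains j where "j < CARD('p)" "padic_norm (x - of_nat j) < 1"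
proof (cases "x = 0")
  case True
  then show ?thesis using that[of 0] prime_gt_0_nat[OF prime_card, where 'a1='p] by simp
next
  case False
  let ?p = "CARD('p)"
  obtain r where r: "padic_norm (x - padic_of_rat r) < 1" "padic_abs ?p r = padic_norm x"
    using padic_rat_dense_same_norm[OF False, of 1] by auto
  obtain a b where q: "quotient_of r = (a, b)" by (cases "quotient_of r")
  have b: "b > 0" "coprime a b" "r = of_int a / of_int b"
    using quotient_of_denom_pos[OF q] quotient_of_coprime[OF q] quotient_of_div[OF q] by auto
  have "a \<noteq> 0" using r(2) b False by (auto simp: padic_norm_eq_0)
  have pr: "prime (int ?p)" using prime_card[where 'a='p] by simp
  have p1: "1 < real ?p" by (rule prime_card_gt_1)
  have nd: "\<not> int ?p dvd b"
  proof
    assume d: "int ?p dvd b"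
    then have "\<not> int ?p dvd a" using b pr not_prime_unit by (metis coprime_common_divisor)
    then have "multiplicity (int ?p) a = 0" by (rule not_dvd_imp_multiplicity_0)
    moreover have "multiplicity (int ?p) b > 0"
      using d b pr by (auto intro!: Suc_leI[THEN less_le_trans[rotated]] simp: prime_multiplicity_gt_zero_iff)
    ultimately have "padic_abs ?p r > 1"
      using \<open>a \<noteq> 0\<close> b p1 padic_abs_frac[OF prime_card, of a b, where 'a1='p]
      by (simp add: one_less_power)
    then show False using assms r by simp
  qed
  then have "coprime (int ?p) b" using pr prime_imp_coprime by blast
  \<comment> \<open>\<open>v\<close> inverts the denominator \<open>b\<close> modulo p, so
    \<open>a * v\<close> is the residue of a/b.\<close>
  then obtain u v where uv: "u * int ?p + v * b = 1" using bezout_int[of "int ?p" b] by auto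
  define j where "j = nat ((a * v) mod int ?p)"
  have jlt: "j < ?p" and jm: "int j = (a * v) mod int ?p"
    using p1 by (simp_all add: j_def nat_less_iff)
  have "int ?p dvd a - int j * b"
  proof -
    have "int ?p dvd a * v - int j" unfolding jm by (simp add: dvd_minus_mod)
    then obtain c where "a * v - int j = int ?p * c" by (auto simp: dvd_def)
    moreover have "a - int j * b = (a * v - int j) * b + a * (1 - v * b)" by (simp add: algebra_simps)
    moreover have "1 - v * b = u * int ?p" using uv by simp
    ultimately have "a - int j * b = int ?p * c * b + a * (u * int ?p)" by (simp only:)
    then show ?thesis by simp
  qed
  moreover have "r - of_nat j = of_int (a - int j * b) / of_int b" using b by (simp add: field_simps)
  ultimately have "padic_abs ?p (r - of_nat j) < 1"
  proof (cases "a - int j * b = 0")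
    case False
    have "multiplicity (int ?p) b = 0" using nd by (rule not_dvd_imp_multiplicity_0)
    moreover have "multiplicity (int ?p) (a - int j * b) > 0"
      using \<open>int ?p dvd a - int j * b\<close> False pr by (simp add: prime_multiplicity_gt_zero_iff)
    ultimately show ?thesis
      using padic_abs_frac[OF prime_card False, of b, where 'a1='p] b p1
        \<open>r - of_nat j = of_int (a - int j * b) / of_int b\<close>
        powi_less_cancel_iff[OF p1, of "- int (multiplicity (int ?p) (a - int j * b))" 0]
      by simp
  qed simp
  then have "padic_norm (padic_of_rat r - of_nat j :: 'p padic) < 1"
    by (simp add: padic_of_rat_diff padic_of_rat_of_nat flip: padic_norm_of_rat)
  then have "padic_norm (x - of_nat j) < 1"
    using r(1) padic_norm_add_le[of "x - padic_of_rat r" "padic_of_rat r - of_nat j"] by simp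
  then show ?thesis using that jlt by blast
qed

text \<open>Digit expansion: split off a residue, divide by p and recurse. The numbers below p^m
  serve as a finite net for compactness and, much later, as representatives of the units modulo
  p^m.\<close>

lemma padic_approx:
  assumes "padic_norm (x :: 'p::prime_card padic) \<le> 1"
  shows "\<exists>a < CARD('p) ^ m. padic_norm (x - of_nat a) \<le> (1 / real CARD('p)) ^ m"
  using assms
proof (induction m arbitrary: x)
  case 0
  then show ?case by simp
next
  case (Suc m)
  obtain j where j: "j < CARD('p)" "padic_norm (x - of_nat j) < 1" using padic_residue[OF Suc.prems] .
  have "padic_norm ((x - of_nat j) / unif) \<le> 1" by (rule padic_norm_lt_1_divide[OF j(2)])
  then obtain a where a: "a < CARD('p) ^ m" "padic_norm ((x - of_nat j) / unif - of_nat a) \<le> (1 / real CARD('p)) ^ m"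
    using Suc.IH by blast
  let ?a = "j + CARD('p) * a"
  have "x - of_nat ?a = unif * ((x - of_nat j) / unif - of_nat a)" by (simp add: field_simps)
  then have "padic_norm (x - of_nat ?a) = 1 / real CARD('p) * padic_norm ((x - of_nat j) / unif - of_nat a)"
    by (simp only: padic_norm_mult padic_norm_unif)
  also have "\<dots> \<le> (1 / real CARD('p)) ^ Suc m"
    using mult_left_mono[OF a(2), of "1 / real CARD('p)"] by simp
  finally have "padic_norm (x - of_nat ?a) \<le> (1 / real CARD('p)) ^ Suc m" .
  moreover have "?a < CARD('p) ^ Suc m"
  proof -
    have "Suc a \<le> CARD('p) ^ m" using a by simp
    then have "CARD('p) * Suc a \<le> CARD('p) ^ Suc m" by (simp only: power_Suc mult_le_mono2)
    then show ?thesis using j by simp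
  qed
  ultimately show ?case by blast
qed

section \<open>Completeness, local compactness and continuity of the operations\<close>

lemma dist_padic: "dist x y = padic_norm (x - y :: 'p::prime_card padic)"
  by (rule dist_padic_def)

instance padic :: (prime_card) complete_space
proof
  fix X :: "nat \<Rightarrow> 'a padic"
  assume X: "Cauchy X"
  \<comment> \<open>Each term is replaced by a rational within 1/(n+1) of it. The rationals form a
    Cauchy sequence, and its class in the completion is the limit.\<close>
  have "\<exists>r. padic_norm (X n - padic_of_rat r) < inverse (real (Suc n))" for n
    using padic_rat_dense[of "inverse (real (Suc n))" "X n"] by auto
  then obtain r where r: "\<And>n. padic_norm (X n - padic_of_rat (r n)) < inverse (real (Suc n))" by metis
  have null: "(\<lambda>n. X n - padic_of_rat (r n)) \<longlonglongrightarrow> 0"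
    unfolding tendsto_dist_iff[of _ "0 :: 'a padic"] dist_padic
    by (rule tendsto_sandwich[OF _ _ tendsto_const LIMSEQ_inverse_real_of_nat])
      (use r in \<open>auto simp: padic_norm_nonneg intro!: always_eventually less_imp_le\<close>)
  have small: "\<exists>k. \<forall>n\<ge>k. padic_norm (X n - padic_of_rat (r n)) < e" if "e > 0" for e
    using null that by (auto simp: lim_sequentially dist_padic)
  have "padic_cauchy CARD('a) r"
    unfolding padic_cauchy_def
  proof (intro allI impI)
    fix e :: real assume e: "e > 0"
    obtain k where k: "\<forall>m\<ge>k. \<forall>n\<ge>k. padic_norm (X m - X n) < e"
      using X e unfolding Cauchy_def dist_padic by blast
    obtain l where l: "\<forall>n\<ge>l. padic_norm (X n - padic_of_rat (r n)) < e" using small[OF e] by blast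
    have "padic_abs CARD('a) (r m - r n) < e" if "m \<ge> max k l" "n \<ge> max k l" for m n
    proof -
      have "padic_of_rat (r m - r n) = (X m - X n) - ((X m - padic_of_rat (r m)) - (X n - padic_of_rat (r n)))"
        by (simp add: padic_of_rat_diff)
      moreover have "padic_norm (X m - X n) < e" "padic_norm (X m - padic_of_rat (r m)) < e"
        "padic_norm (X n - padic_of_rat (r n)) < e" using k l that by auto
      ultimately have "padic_norm (padic_of_rat (r m - r n) :: 'a padic) < e"
        using padic_norm_diff_le[of "X m - X n" "(X m - padic_of_rat (r m)) - (X n - padic_of_rat (r n))"]
          padic_norm_diff_le[of "X m - padic_of_rat (r m)" "X n - padic_of_rat (r n)"] by simp
      then show ?thesis by (simp add: padic_norm_of_rat)
    qed
    then show "\<exists>k. \<forall>m\<ge>k. \<forall>n\<ge>k. padic_abs CARD('a) (r m - r n) < e" by blast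
  qed
  then have rep: "Rep_cauchy_seq (Abs_cauchy_seq r :: 'a cauchy_seq) = r"
    by (simp add: Abs_cauchy_seq_inverse)
  define y where "y = abs_padic (Abs_cauchy_seq r :: 'a cauchy_seq)"
  have lim: "(\<lambda>n. padic_of_rat (r n)) \<longlonglongrightarrow> y"
    unfolding lim_sequentially
  proof (intro allI impI)
    fix e :: real assume e: "e > 0"
    then obtain k where k: "\<And>m n. m \<ge> k \<Longrightarrow> n \<ge> k \<Longrightarrow> padic_abs CARD('a) (r m - r n) < e / 2"
      using \<open>padic_cauchy CARD('a) r\<close> unfolding padic_cauchy_def by (meson half_gt_zero)
    have "dist (padic_of_rat (r n)) y < e" if "n \<ge> k" for n
    proof -
      have "padic_norm (padic_of_rat (r n) - y) = seq_norm (const_seq (r n) - Abs_cauchy_seq r :: 'a cauchy_seq)"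
        unfolding y_def padic_of_rat_def by (simp add: padic_norm.abs_eq minus_padic.abs_eq)
      also have "\<dots> \<le> e / 2"
        using seq_norm_tendsto[of "const_seq (r n) - Abs_cauchy_seq r :: 'a cauchy_seq"]
        by (rule LIMSEQ_le_const2)
          (use k that in \<open>auto simp: minus_cauchy_seq.rep_eq const_seq.rep_eq rep intro!: exI[of _ k] less_imp_le\<close>)
      finally show ?thesis using e by (simp add: dist_padic)
    qed
    then show "\<exists>k. \<forall>n\<ge>k. dist (padic_of_rat (r n)) y < e" by blast
  qed
  have "X \<longlonglongrightarrow> y"
    unfolding lim_sequentially
  proof (intro allI impI)
    fix e :: real assume e: "e > 0"
    obtain k where k: "\<forall>n\<ge>k. dist (padic_of_rat (r n)) y < e" using lim e unfolding lim_sequentially by blast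
    obtain l where l: "\<forall>n\<ge>l. padic_norm (X n - padic_of_rat (r n)) < e" using small[OF e] by blast
    have "dist (X n) y < e" if "n \<ge> max k l" for n
      using k l that padic_norm_add_le[of "X n - padic_of_rat (r n)" "padic_of_rat (r n) - y"]
      by (auto simp: dist_padic) (smt (verit))
    then show "\<exists>k. \<forall>n\<ge>k. dist (X n) y < e" by blast
  qed
  then show "convergent X" by (auto simp: convergent_def)
qed

text \<open>Multiplication by p^n moves the ball into the integers, where the numbers below p^(n+m)
  form a net of radius p^-(n+m).\<close>

lemma compact_cball_padic: "compact (cball (0 :: 'p::prime_card padic) r)"
  unfolding compact_eq_totally_bounded
proof (intro conjI allI impI)
  show "complete (cball (0 :: 'p padic) r)" by (simp add: complete_eq_closed)
  fix e :: real assume e: "e > 0"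
  have p: "1 < real CARD('p)" by (rule prime_card_gt_1)
  obtain n where n: "r \<le> real CARD('p) ^ n" using real_arch_pow[OF p, of r] by (auto intro: less_imp_le)
  obtain m where m: "(1 / real CARD('p)) ^ m < e" using real_arch_pow_inv[OF e, of "1 / real CARD('p)"] p by auto
  let ?c = "\<lambda>a. of_nat a / unif ^ n :: 'p padic"
  have "\<exists>a < CARD('p) ^ (n + m). x \<in> ball (?c a) e" if "x \<in> cball 0 r" for x
  proof -
    have "padic_norm x \<le> real CARD('p) ^ n" using that n by (auto simp: dist_padic padic_norm_minus)
    then have "padic_norm (x * unif ^ n) \<le> 1"
      using p by (simp add: padic_norm_mult padic_norm_power field_simps)
    then obtain a where a: "a < CARD('p) ^ (n + m)"
        "padic_norm (x * unif ^ n - of_nat a) \<le> (1 / real CARD('p)) ^ (n + m)"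
      using padic_approx by blast
    have "x - ?c a = (x * unif ^ n - of_nat a) / unif ^ n" by (simp add: field_simps)
    then have "padic_norm (x - ?c a) = padic_norm (x * unif ^ n - of_nat a) / (1 / real CARD('p)) ^ n"
      by (simp add: padic_norm_divide padic_norm_power)
    also have "\<dots> \<le> (1 / real CARD('p)) ^ m" using a(2) p by (simp add: power_add field_simps)
    also note m
    finally show ?thesis using a(1) by (auto simp: dist_padic padic_norm_diff_commute[of x])
  qed
  then have "cball 0 r \<subseteq> (\<Union>x\<in>?c ` {..<CARD('p) ^ (n + m)}. ball x e)" by blast
  moreover have "finite (?c ` {..<CARD('p) ^ (n + m)})" by simp
  ultimately show "\<exists>k. finite k \<and> cball (0 :: 'p padic) r \<subseteq> (\<Union>x\<in>k. ball x e)" by blast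
qed

instance padic :: (prime_card) heine_borel
proof
  fix f :: "nat \<Rightarrow> 'a padic"
  assume "bounded (range f)"
  then obtain r where "\<forall>y\<in>range f. dist 0 y \<le> r"
    using bounded_any_center[of "range f" "0 :: 'a padic"] by blast
  then have r: "range f \<subseteq> cball 0 r" by auto
  have "seq_compact (cball (0 :: 'a padic) r)"
    using compact_cball_padic by (simp add: compact_eq_seq_compact_metric)
  then show "\<exists>l r. strict_mono (r::nat\<Rightarrow>nat) \<and> ((f \<circ> r) \<longlongrightarrow> l) sequentially"
    using r unfolding seq_compact_def by blast
qed

instance padic :: (prime_card) topological_group_add
proof
  fix a b :: "'a padic"
  show "LIM x (nhds a \<times>\<^sub>F nhds b). fst x + snd x :> nhds (a + b)"
    unfolding nhds_prod[symmetric] tendsto_iff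
  proof (intro allI impI)
    fix e :: real assume e: "e > 0"
    have "dist (fst x + snd x) (a + b) < e" if "dist (fst x) a < e" "dist (snd x) b < e" for x
      using that padic_norm_add_le[of "fst x - a" "snd x - b"] by (simp add: dist_padic add_diff_add)
    moreover have "eventually (\<lambda>x. dist (fst x) a < e) (nhds (a, b))" "eventually (\<lambda>x. dist (snd x) b < e) (nhds (a, b))"
      using tendstoD[OF tendsto_fst[OF tendsto_ident_at, of "(a, b)" UNIV] e] tendstoD[OF tendsto_snd[OF tendsto_ident_at, of "(a, b)" UNIV] e]
      by (auto simp: eventually_nhds_conv_at e)
    ultimately show "eventually (\<lambda>x. dist (fst x + snd x) (a + b) < e) (nhds (a, b))"
      by (auto elim: eventually_elim2)
  qed
next
  fix a :: "'a padic"
  show "(uminus \<longlongrightarrow> - a) (nhds a)"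
    unfolding tendsto_iff
  proof (intro allI impI)
    fix e :: real assume e: "e > 0"
    have "dist (- x) (- a) = dist x a" for x
      by (simp add: dist_padic padic_norm_diff_commute)
    then show "eventually (\<lambda>x. dist (- x) (- a) < e) (nhds a)"
      using e by (simp add: eventually_nhds_metric) blast
  qed
qed

instance padic :: (prime_card) topological_ab_group_add ..

instance padic :: (prime_card) topological_semigroup_mult
proof
  fix a b :: "'a padic"
  show "LIM x (nhds a \<times>\<^sub>F nhds b). fst x * snd x :> nhds (a * b)"
    unfolding nhds_prod[symmetric] tendsto_iff
  proof (intro allI impI)
    fix e :: real assume e: "e > 0"
    \<comment> \<open>Since \<open>d\<close> is at most 1, the norm of \<open>snd x\<close> stays
      below \<open>B\<close>. Both summands of the error then have norm below \<open>d * B\<close>,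
      which is at most \<open>e\<close>.\<close>
    define B where "B = max (padic_norm a) (padic_norm b) + 1"
    define d where "d = min 1 (e / B)"
    have B: "B > 0" using padic_norm_nonneg[of a] by (simp add: B_def)
    then have d: "d > 0" using e by (simp add: d_def)
    have main: "dist (fst x * snd x) (a * b) < e" if "dist (fst x) a < d" "dist (snd x) b < d" for x
    proof -
      have lt: "padic_norm (fst x - a) < d" "padic_norm (snd x - b) < d" using that by (simp_all add: dist_padic)
      have "padic_norm (snd x) < B"
        using padic_norm_add_le[of "snd x - b" b] lt padic_norm_nonneg[of a] padic_norm_nonneg[of b]
        by (auto simp: B_def d_def max_def split: if_splits)
      have 1: "padic_norm (fst x - a) * padic_norm (snd x) < d * B"
        using lt \<open>padic_norm (snd x) < B\<close> by (intro mult_strict_mono) (auto simp: padic_norm_nonneg d)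
      have "padic_norm a < B" by (simp add: B_def)
      then have 2: "padic_norm a * padic_norm (snd x - b) < B * d"
        using lt B by (intro mult_strict_mono) (auto simp: padic_norm_nonneg)
      have "d * B \<le> e" using B by (simp add: d_def min_def field_simps split: if_splits)
      moreover have "fst x * snd x - a * b = (fst x - a) * snd x + a * (snd x - b)" by (simp add: algebra_simps)
      ultimately show ?thesis
        using 1 2 padic_norm_add_le[of "(fst x - a) * snd x" "a * (snd x - b)"]
        by (simp add: dist_padic padic_norm_mult mult.commute)
    qed
    have "eventually (\<lambda>x. dist (fst x) a < d) (nhds (a, b))" "eventually (\<lambda>x. dist (snd x) b < d) (nhds (a, b))"
      using tendstoD[OF tendsto_fst[OF tendsto_ident_at, of "(a, b)" UNIV] d] tendstoD[OF tendsto_snd[OF tendsto_ident_at, of "(a, b)" UNIV] d]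
      by (auto simp: eventually_nhds_conv_at d)
    then show "eventually (\<lambda>x. dist (fst x * snd x) (a * b) < e) (nhds (a, b))"
      by eventually_elim (rule main)
  qed
qed

lemma open_padic_norm_le:
  assumes "0 < c"
  shows "open {x :: 'p::prime_card padic. padic_norm x \<le> c}"
  unfolding open_dist
proof (intro ballI exI[of _ c] conjI allI impI)
  fix x y :: "'p padic" assume "x \<in> {x. padic_norm x \<le> c}" "dist y x < c"
  then show "y \<in> {x. padic_norm x \<le> c}"
    using padic_norm_add_le[of "y - x" x] by (auto simp: dist_padic)
qed (rule assms)

lemma open_padic_norm_eq:
  assumes "0 < c"
  shows "open {x :: 'p::prime_card padic. padic_norm x = c}"
  unfolding open_dist
proof (intro ballI exI[of _ c] conjI allI impI)
  fix x y :: "'p padic" assume "x \<in> {x. padic_norm x = c}" "dist y x < c"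
  then show "y \<in> {x. padic_norm x = c}"
    using padic_norm_add_eq(2)[of "y - x" x] by (auto simp: dist_padic)
qed (rule assms)

lemma closed_padic_norm: "closed {x :: 'p::prime_card padic. padic_norm x \<le> c}"
proof -
  have "{x :: 'p padic. padic_norm x \<le> c} = cball 0 c" by (auto simp: dist_padic padic_norm_minus)
  then show ?thesis by simp
qed

lemma continuous_on_padic_mult:
  fixes f g :: "'b::topological_space \<Rightarrow> 'p::prime_card padic"
  assumes "continuous_on S f" "continuous_on S g"
  shows "continuous_on S (\<lambda>x. f x * g x)"
  using assms unfolding continuous_on_def by (auto intro: tendsto_mult)


section \<open>Two by two matrices\<close>

definition mat2 :: "'a::zero \<Rightarrow> 'a \<Rightarrow> 'a \<Rightarrow> 'a \<Rightarrow> 'a ^ 2 ^ 2" where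
  "mat2 a b c d = vector [vector [a, b], vector [c, d]]"

lemma mat2_nth [simp]:
  "mat2 a b c d $ 1 $ 1 = a" "mat2 a b c d $ 1 $ 2 = b"
  "mat2 a b c d $ 2 $ 1 = c" "mat2 a b c d $ 2 $ 2 = d"
  by (simp_all add: mat2_def)

lemma mat2_eta: "mat2 (A $ 1 $ 1) (A $ 1 $ 2) (A $ 2 $ 1) (A $ 2 $ 2) = A"
  by (simp add: vec_eq_iff forall_2)

lemma mat2_cases: obtains a b c d where "A = mat2 a b c d"
  using mat2_eta[of A] by metis

lemma mat2_eq_iff [simp]: "mat2 a b c d = mat2 a' b' c' d' \<longleftrightarrow> a = a' \<and> b = b' \<and> c = c' \<and> d = d'"
  by (auto simp: vec_eq_iff forall_2)

lemma mat2_mult [simp]: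
  "mat2 a b c d ** mat2 a' b' c' d' =
    (mat2 (a * a' + b * c') (a * b' + b * d') (c * a' + d * c') (c * b' + d * d') :: 'a::semiring_1 ^ 2 ^ 2)"
  by (simp add: vec_eq_iff forall_2 matrix_matrix_mult_def sum_2)

lemma mat2_one: "mat 1 = mat2 1 0 0 (1 :: 'a::zero_neq_one)"
  by (simp add: vec_eq_iff forall_2 mat_def)

lemma det_mat2 [simp]: "det (mat2 a b c d) = a * d - b * (c :: 'a::comm_ring_1)"
  by (simp add: det_2)

lemma vector_mat2: "vector [x, y] v* mat2 a b c d = vector [x * a + y * c, x * b + y * (d :: 'a::comm_semiring_1)]"
  by (simp add: vec_eq_iff forall_2 vector_matrix_mult_def sum_2 mult.commute)

lemma vector2_cases: obtains x y where "v = (vector [x, y] :: 'a::zero ^ 2)"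
proof -
  have "v = vector [v $ 1, v $ 2]" by (simp add: vec_eq_iff forall_2)
  then show ?thesis using that by blast
qed

lemma mat2_in_GL2: "mat2 a b c d \<in> carrier GL2 \<longleftrightarrow> a * d - b * c \<noteq> (0 :: 'p::prime_card padic)"
  by (simp add: GL2_def invertible_det_nz)

lemma mult_GL2 [simp]: "A \<otimes>\<^bsub>GL2\<^esub> B = A ** B"
  by (simp add: GL2_def)

lemma one_GL2 [simp]: "\<one>\<^bsub>GL2\<^esub> = mat 1"
  by (simp add: GL2_def)

lemma mult_in_GL2 [simp]: "A \<in> carrier GL2 \<Longrightarrow> B \<in> carrier GL2 \<Longrightarrow> A ** B \<in> carrier (GL2 :: ('p::prime_card padic ^ 2 ^ 2) monoid)"
  by (simp add: GL2_def invertible_mult)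

lemma det_GL2: "A \<in> carrier GL2 \<longleftrightarrow> det (A :: 'p::prime_card padic ^ 2 ^ 2) \<noteq> 0"
  by (simp add: GL2_def invertible_det_nz)

section \<open>Integers and integral matrices\<close>

lemma padic_int_iff: "x \<in> padic_int \<longleftrightarrow> padic_norm x \<le> 1"
  by (simp add: padic_int_def)

lemma padic_int_ring [simp, intro]:
  "0 \<in> padic_int" "1 \<in> padic_int"
  "x \<in> padic_int \<Longrightarrow> y \<in> padic_int \<Longrightarrow> x + y \<in> padic_int"
  "x \<in> padic_int \<Longrightarrow> y \<in> padic_int \<Longrightarrow> x - y \<in> padic_int"
  "x \<in> padic_int \<Longrightarrow> - x \<in> padic_int"
  "x \<in> padic_int \<Longrightarrow> y \<in> padic_int \<Longrightarrow> x * y \<in> padic_int"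
  using padic_norm_add_le[of x y] padic_norm_diff_le[of x y]
  by (auto simp: padic_int_def padic_norm_minus padic_norm_mult mult_le_one padic_norm_nonneg)

lemma of_nat_padic_int [simp, intro]: "of_nat n \<in> padic_int"
  by (simp add: padic_int_iff padic_norm_of_nat_le_1)

lemma padic_int_add_cancel [simp]:
  assumes "y \<in> padic_int"
  shows "x + y \<in> padic_int \<longleftrightarrow> x \<in> padic_int" "y + x \<in> padic_int \<longleftrightarrow> x \<in> padic_int"
    "x - y \<in> padic_int \<longleftrightarrow> x \<in> padic_int"
proof -
  show 1: "x + y \<in> padic_int \<longleftrightarrow> x \<in> padic_int"
    using padic_int_ring(4)[of "x + y" y] padic_int_ring(3)[of x y] assms by (metis add_diff_cancel_right')
  then show "y + x \<in> padic_int \<longleftrightarrow> x \<in> padic_int" by (simp only: add.commute)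
  show "x - y \<in> padic_int \<longleftrightarrow> x \<in> padic_int"
    using padic_int_ring(3)[of "x - y" y] padic_int_ring(4)[of x y] assms by (metis diff_add_cancel)
qed

lemma padic_int_mult_unit:
  assumes "padic_norm u = 1"
  shows "x * u \<in> padic_int \<longleftrightarrow> x \<in> padic_int" "u * x \<in> padic_int \<longleftrightarrow> x \<in> padic_int"
  using assms by (simp_all add: padic_int_iff padic_norm_mult)

text \<open>An integral inverse makes the determinant a unit by multiplicativity; conversely the
  adjugate divided by a unit determinant is integral.\<close>

lemma mat2_in_GL2_int:
  "mat2 a b c d \<in> (GL2_int :: ('p::prime_card padic ^ 2 ^ 2) set) \<longleftrightarrow>
     a \<in> padic_int \<and> b \<in> padic_int \<and> c \<in> padic_int \<and> d \<in> padic_int \<and> padic_norm (a * d - b * c) = 1"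
    (is "?l \<longleftrightarrow> ?r")
proof
  assume ?l
  then obtain B where B: "\<And>i j. B $ i $ j \<in> padic_int" "mat2 a b c d ** B = mat 1"
    and A: "\<And>i j. mat2 a b c d $ i $ j \<in> padic_int" by (auto simp: GL2_int_def)
  have abcd: "a \<in> padic_int" "b \<in> padic_int" "c \<in> padic_int" "d \<in> padic_int"
    using A[of 1 1] A[of 1 2] A[of 2 1] A[of 2 2] by auto
  have "det (mat2 a b c d) * det B = 1" using B(2) by (metis det_I det_mul)
  then have "padic_norm (det (mat2 a b c d)) * padic_norm (det B) = 1" by (metis padic_norm_mult padic_norm_1)
  moreover have "det B \<in> padic_int" using B(1) by (simp add: det_2)
  moreover have "det (mat2 a b c d) \<in> padic_int" using abcd by simp
  ultimately have "padic_norm (det (mat2 a b c d)) = 1"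
    unfolding padic_int_iff
    by (smt (verit) mult_left_le padic_norm_nonneg)
  with abcd show ?r by simp
next
  assume r: ?r
  define D where "D = a * d - b * c"
  have D: "padic_norm D = 1" "D \<noteq> 0" using r by (auto simp: D_def)
  have i: "x / D \<in> padic_int" if "x \<in> padic_int" for x
    using that D by (simp add: padic_int_iff padic_norm_divide)
  let ?B = "mat2 (d / D) (- b / D) (- c / D) (a / D)"
  have "mat2 a b c d ** ?B = mat 1" "?B ** mat2 a b c d = mat 1"
    using D(2) by (simp_all add: mat2_one field_simps) (simp_all add: D_def algebra_simps)
  moreover have "\<forall>i j. ?B $ i $ j \<in> padic_int" using r i by (auto simp: forall_2)
  moreover have "\<forall>i j. mat2 a b c d $ i $ j \<in> padic_int" using r by (simp add: forall_2)
  ultimately show ?l unfolding GL2_int_def by blast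
qed

lemma GL2_int_iff:
  "A \<in> GL2_int \<longleftrightarrow> (\<forall>i j. A $ i $ j \<in> padic_int) \<and> padic_norm (det A) = 1"
  using mat2_in_GL2_int[of "A $ 1 $ 1" "A $ 1 $ 2" "A $ 2 $ 1" "A $ 2 $ 2"]
  by (auto simp: mat2_eta forall_2 det_2)

lemma subgroup_GL2_int: "subgroup GL2_int (GL2 :: ('p::prime_card padic ^ 2 ^ 2) monoid)"
proof (rule group.subgroupI[OF group_GL2])
  show "GL2_int \<subseteq> carrier (GL2 :: ('p padic ^ 2 ^ 2) monoid)"
    by (auto simp: GL2_int_iff det_GL2)
  have "mat 1 \<in> (GL2_int :: ('p padic ^ 2 ^ 2) set)" by (simp add: mat2_one mat2_in_GL2_int)
  then show "(GL2_int :: ('p padic ^ 2 ^ 2) set) \<noteq> {}" by blast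
  fix A B :: "'p padic ^ 2 ^ 2" assume A: "A \<in> GL2_int"
  then obtain C where C: "C \<in> GL2_int" "A ** C = mat 1" "C ** A = mat 1"
    by (fastforce simp: GL2_int_def)
  then have "inv\<^bsub>GL2\<^esub> A = C"
    by (intro monoid.inv_char[OF group.is_monoid[OF group_GL2]]) (use A in \<open>auto simp: GL2_int_iff det_GL2\<close>)
  then show "inv\<^bsub>GL2\<^esub> A \<in> GL2_int" using C by simp
  assume "B \<in> GL2_int"
  moreover from this A have "(A ** B) $ i $ j \<in> padic_int" for i j
    by (simp add: GL2_int_iff matrix_matrix_mult_def sum_2)
  ultimately show "A \<otimes>\<^bsub>GL2\<^esub> B \<in> GL2_int"
    using A by (simp add: GL2_int_iff det_mul padic_norm_mult)
qed

section \<open>The group and its maximal compact subgroup\<close>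

lemma group_GG: "group (GG :: 'p::prime_card GG monoid)"
  unfolding GG_def by (rule DirProd_group[OF group_GL2 group_GL2])

interpretation GL: group "GL2 :: ('p::prime_card padic ^ 2 ^ 2) monoid"
  by (rule group_GL2)

interpretation G: group "GG :: 'p::prime_card GG monoid"
  by (rule group_GG)

interpretation K: subgroup GL2_int "GL2 :: ('p::prime_card padic ^ 2 ^ 2) monoid"
  by (rule subgroup_GL2_int)

lemma subgroup_GG_int: "subgroup GG_int (GG :: 'p::prime_card GG monoid)"
  unfolding GG_def GG_int_def by (rule DirProd_subgroups[OF group_GL2 subgroup_GL2_int group_GL2 subgroup_GL2_int])

interpretation KK: subgroup GG_int "GG :: 'p::prime_card GG monoid"
  by (rule subgroup_GG_int)

lemma mult_GG: "x \<otimes>\<^bsub>GG\<^esub> y = (fst x ** fst y, snd x ** snd y)"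
  by (simp add: GG_def mult_DirProd')

lemma carrier_GG: "carrier GG = carrier GL2 \<times> carrier GL2"
  by (simp add: GG_def)

lemma mult_GG_assoc: "x \<otimes>\<^bsub>GG\<^esub> y \<otimes>\<^bsub>GG\<^esub> z = x \<otimes>\<^bsub>GG\<^esub> (y \<otimes>\<^bsub>GG\<^esub> z)"
  by (simp add: mult_GG matrix_mul_assoc)

lemma mult_GG_in_carrier_iff:
  assumes "x \<in> carrier GG"
  shows "x \<otimes>\<^bsub>GG\<^esub> y \<in> carrier GG \<longleftrightarrow> y \<in> carrier GG" "y \<otimes>\<^bsub>GG\<^esub> x \<in> carrier GG \<longleftrightarrow> y \<in> carrier GG"
  using assms by (auto simp: mult_GG carrier_GG det_GL2 det_mul mem_Times_iff)

abbreviation gcoset :: "'p::prime_card GG \<Rightarrow> 'p GG set" where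
  "gcoset g \<equiv> g <#\<^bsub>GG\<^esub> GG_int"

lemma mem_gcoset:
  assumes "g \<in> carrier GG"
  shows "x \<in> gcoset g \<longleftrightarrow> inv\<^bsub>GG\<^esub> g \<otimes>\<^bsub>GG\<^esub> x \<in> GG_int"
proof
  assume "x \<in> gcoset g"
  then show "inv\<^bsub>GG\<^esub> g \<otimes>\<^bsub>GG\<^esub> x \<in> GG_int"
    using assms KK.mem_carrier by (auto simp: l_coset_def mult_GG_assoc[symmetric])
next
  assume "inv\<^bsub>GG\<^esub> g \<otimes>\<^bsub>GG\<^esub> x \<in> GG_int"
  moreover from this have "x \<in> carrier GG"
    using KK.mem_carrier mult_GG_in_carrier_iff(1)[of "inv\<^bsub>GG\<^esub> g" x] assms by auto
  then have "x = g \<otimes>\<^bsub>GG\<^esub> (inv\<^bsub>GG\<^esub> g \<otimes>\<^bsub>GG\<^esub> x)" using assms by (simp add: mult_GG_assoc[symmetric])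
  ultimately show "x \<in> gcoset g" by (auto simp: l_coset_def)
qed

lemma gcoset_subset: "g \<in> carrier GG \<Longrightarrow> gcoset g \<subseteq> carrier GG"
  using KK.mem_carrier by (auto simp: l_coset_def)

lemma gcoset_self: "g \<in> carrier GG \<Longrightarrow> g \<in> gcoset g"
  using KK.one_closed G.r_one by (force simp: l_coset_def)

lemma gcoset_eq:
  assumes "g \<in> carrier GG" "x \<in> gcoset g"
  shows "gcoset x = gcoset g"
  using assms G.l_repr_independence subgroup_GG_int by metis

lemma gcoset_mult:
  assumes "h \<in> carrier GG" "g \<in> carrier GG"
  shows "x \<in> gcoset (h \<otimes>\<^bsub>GG\<^esub> g) \<longleftrightarrow> inv\<^bsub>GG\<^esub> h \<otimes>\<^bsub>GG\<^esub> x \<in> gcoset g"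
  using assms by (simp add: mem_gcoset G.inv_mult_group mult_GG_assoc)

lemma gcoset_K_mult:
  assumes "g \<in> carrier GG" "k \<in> GG_int"
  shows "x \<otimes>\<^bsub>GG\<^esub> k \<in> gcoset g \<longleftrightarrow> x \<in> gcoset g"
proof -
  have *: "y \<otimes>\<^bsub>GG\<^esub> k \<in> GG_int" if "y \<in> GG_int" "k \<in> GG_int" for y k using that by simp
  show ?thesis
  proof
    assume "x \<otimes>\<^bsub>GG\<^esub> k \<in> gcoset g"
    then have "inv\<^bsub>GG\<^esub> g \<otimes>\<^bsub>GG\<^esub> x \<otimes>\<^bsub>GG\<^esub> k \<in> GG_int" using assms by (simp add: mem_gcoset mult_GG_assoc)
    from *[OF this, of "inv\<^bsub>GG\<^esub> k"] have "inv\<^bsub>GG\<^esub> g \<otimes>\<^bsub>GG\<^esub> x \<otimes>\<^bsub>GG\<^esub> (k \<otimes>\<^bsub>GG\<^esub> inv\<^bsub>GG\<^esub> k) \<in> GG_int"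
      using KK.m_inv_closed[OF assms(2)] by (simp only: mult_GG_assoc)
    then have "inv\<^bsub>GG\<^esub> g \<otimes>\<^bsub>GG\<^esub> (x \<otimes>\<^bsub>GG\<^esub> \<one>\<^bsub>GG\<^esub>) \<in> GG_int" using assms KK.mem_carrier by (simp add: mult_GG_assoc)
    moreover have "x \<otimes>\<^bsub>GG\<^esub> \<one>\<^bsub>GG\<^esub> = x" by (simp add: prod_eq_iff mult_DirProd' GG_def)
    ultimately show "x \<in> gcoset g" using assms by (simp add: mem_gcoset)
  next
    assume "x \<in> gcoset g"
    then show "x \<otimes>\<^bsub>GG\<^esub> k \<in> gcoset g" using assms by (simp add: mem_gcoset flip: mult_GG_assoc)
  qed
qed

lemma continuous_on_matrix_mult:
  fixes f g :: "'b::topological_space \<Rightarrow> 'p::prime_card padic ^ 2 ^ 2"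
  assumes "continuous_on S f" "continuous_on S g"
  shows "continuous_on S (\<lambda>x. f x ** g x)"
  unfolding matrix_matrix_mult_def
  by (intro continuous_on_vec_lambda continuous_on_sum continuous_on_padic_mult continuous_on_component assms)

lemma continuous_on_mult_GG:
  "continuous_on S (\<lambda>x. g \<otimes>\<^bsub>GG\<^esub> x)" "continuous_on S (\<lambda>x. x \<otimes>\<^bsub>GG\<^esub> g)"
  unfolding mult_GG
  by (intro continuous_intros continuous_on_matrix_mult)+

lemma open_GL2_int: "open (GL2_int :: ('p::prime_card padic ^ 2 ^ 2) set)"
proof -
  have e: "open ((\<lambda>A. A $ i $ j) -` {x. padic_norm x \<le> 1} :: ('p padic ^ 2 ^ 2) set)" for i j
    by (rule open_vimage[OF open_padic_norm_le]) (auto intro!: continuous_on_component continuous_on_id)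
  have d: "open ((\<lambda>A. A $ 1 $ 1 * A $ 2 $ 2 - A $ 1 $ 2 * A $ 2 $ 1) -` {x. padic_norm x = 1} :: ('p padic ^ 2 ^ 2) set)"
    by (rule open_vimage[OF open_padic_norm_eq])
      (auto intro!: continuous_on_diff continuous_on_padic_mult continuous_on_component continuous_on_id)
  have "GL2_int = (\<Inter>i. \<Inter>j. (\<lambda>A. A $ i $ j) -` {x. padic_norm x \<le> 1}) \<inter>
      ((\<lambda>A. A $ 1 $ 1 * A $ 2 $ 2 - A $ 1 $ 2 * A $ 2 $ 1) -` {x. padic_norm x = 1} :: ('p padic ^ 2 ^ 2) set)"
    by (auto simp: GL2_int_iff padic_int_def det_2)
  also have "open \<dots>" by (intro open_Int open_INT d e ballI) auto
  finally show ?thesis .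
qed

lemma compact_GL2_int: "compact (GL2_int :: ('p::prime_card padic ^ 2 ^ 2) set)"
  unfolding compact_eq_bounded_closed
proof
  have e: "closed ((\<lambda>A. A $ i $ j) -` {x. padic_norm x \<le> 1} :: ('p padic ^ 2 ^ 2) set)" for i j
    by (rule closed_vimage[OF closed_padic_norm]) (auto intro!: continuous_on_component continuous_on_id)
  \<comment> \<open>The unit sphere is closed because the norms below 1 are those at most 1/p, which
    is an open condition.\<close>
  have "{x :: 'p padic. padic_norm x = 1} = {x. padic_norm x \<le> 1} - {x. padic_norm x \<le> 1 / real CARD('p)}"
    using padic_norm_lt_1_iff[where 'p='p] by force
  also have "closed \<dots>" using open_padic_norm_le[of "1 / real CARD('p)", where 'p='p] prime_card_gt_1[where 'p='p]
    by (intro closed_Diff closed_padic_norm) auto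
  finally have d: "closed ((\<lambda>A. A $ 1 $ 1 * A $ 2 $ 2 - A $ 1 $ 2 * A $ 2 $ 1) -` {x. padic_norm x = 1} :: ('p padic ^ 2 ^ 2) set)"
    by (rule closed_vimage)
      (auto intro!: continuous_on_diff continuous_on_padic_mult continuous_on_component continuous_on_id)
  have "GL2_int = (\<Inter>i. \<Inter>j. (\<lambda>A. A $ i $ j) -` {x. padic_norm x \<le> 1}) \<inter>
      ((\<lambda>A. A $ 1 $ 1 * A $ 2 $ 2 - A $ 1 $ 2 * A $ 2 $ 1) -` {x. padic_norm x = 1} :: ('p padic ^ 2 ^ 2) set)"
    by (auto simp: GL2_int_iff padic_int_def det_2)
  also have "closed \<dots>" by (intro closed_Int closed_INT d e ballI)
  finally show "closed (GL2_int :: ('p padic ^ 2 ^ 2) set)" .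
  have "dist 0 A \<le> 4" if A: "A \<in> GL2_int" for A :: "'p padic ^ 2 ^ 2"
  proof -
    have "dist 0 A \<le> (\<Sum>i\<in>UNIV. dist (0 $ i) (A $ i))"
      unfolding dist_vec_def by (rule L2_set_le_sum) simp
    also have "\<dots> \<le> (\<Sum>i\<in>UNIV. \<Sum>j\<in>UNIV. dist (0 $ i $ j) (A $ i $ j))"
      by (rule sum_mono, subst dist_vec_def, rule L2_set_le_sum) simp
    also have "\<dots> \<le> (\<Sum>i\<in>(UNIV::2 set). \<Sum>j\<in>(UNIV::2 set). 1)"
      using A by (intro sum_mono) (simp add: dist_padic padic_norm_minus GL2_int_iff padic_int_iff)
    finally show ?thesis by simp
  qed
  then show "bounded (GL2_int :: ('p padic ^ 2 ^ 2) set)"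
    unfolding bounded_any_center[of _ 0] by blast
qed

lemma compact_gcoset: "compact (gcoset (g :: 'p::prime_card GG))"
proof -
  have "gcoset g = (\<lambda>x. g \<otimes>\<^bsub>GG\<^esub> x) ` GG_int" by (auto simp: l_coset_def)
  moreover have "compact (GG_int :: 'p GG set)"
    unfolding GG_int_def by (intro compact_Times compact_GL2_int)
  ultimately show ?thesis using compact_continuous_image[OF continuous_on_mult_GG(1)] by metis
qed

lemma open_gcoset:
  assumes "g \<in> carrier GG"
  shows "open (gcoset (g :: 'p::prime_card GG))"
proof -
  have "gcoset g = (\<lambda>x. inv\<^bsub>GG\<^esub> g \<otimes>\<^bsub>GG\<^esub> x) -` GG_int" using mem_gcoset[OF assms] by auto
  moreover have "open (GG_int :: 'p GG set)"
    unfolding GG_int_def by (intro open_Times open_GL2_int)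
  ultimately show ?thesis using open_vimage[OF _ continuous_on_mult_GG(1)] by metis
qed


section \<open>Reduction to bi-invariant functions\<close>

text \<open>Points of \<open>GG\<close> are pairs but are treated as elements of a single group, so
  quantifiers over them stay unsplit.\<close>

declare split_paired_All [simp del] split_paired_Ex [simp del]

text \<open>The sets \<open>E x\<close> form a partition. Thinning a finite subcover until
  \<open>E\<close> is injective on its representatives makes the chosen classes disjoint. This is
  applied to cosets in the group and to balls in the plane.\<close>

lemma finite_partition_decomp:
  fixes f :: "'a::topological_space \<Rightarrow> complex"
  assumes C: "compact C" and out: "\<And>x. x \<notin> C \<Longrightarrow> f x = 0"
    and E: "\<And>x. x \<in> C \<Longrightarrow> open (E x)" "\<And>x. x \<in> C \<Longrightarrow> x \<in> E x"
    and Eeq: "\<And>x y. x \<in> C \<Longrightarrow> y \<in> E x \<Longrightarrow> E y = E x"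
    and feq: "\<And>x y. x \<in> C \<Longrightarrow> y \<in> E x \<Longrightarrow> f y = f x"
  obtains X where "finite X" "X \<subseteq> C" "f = (\<Sum>x\<in>X. cscale (f x) (indicator (E x)))"
proof -
  obtain D where D: "D \<subseteq> C" "finite D" "C \<subseteq> (\<Union>x\<in>D. E x)"
    using compactE_image[OF C, of C E] E by blast
  obtain X where X: "X \<subseteq> D" "inj_on E X" "E ` D = E ` X"
    using subset_image_inj[of "E ` D" E D] by auto
  have XC: "X \<subseteq> C" "finite X" using X D finite_subset by auto
  have "f y = (\<Sum>x\<in>X. cscale (f x) (indicator (E x))) y" for y
  proof (cases "\<exists>x\<in>X. y \<in> E x")
    case True
    then obtain x where x: "x \<in> X" "y \<in> E x" by blast
    have "y \<notin> E z" if "z \<in> X - {x}" for z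
      using that x X(2) XC(1) Eeq[of z y] Eeq[of x y] unfolding inj_on_def by (metis DiffE insertI1 subsetD)
    then have "(\<Sum>z\<in>X. f z * indicator (E z) y) = f x * indicator (E x) y"
      using x XC by (subst sum.remove[of _ x]) (auto intro!: sum.neutral)
    then show ?thesis using x XC feq[of x y] by (auto simp: sum_fun_apply cscale_def)
  next
    case False
    then have "y \<notin> C" using D(3) X(3) by (metis UN_iff subsetD)
    then show ?thesis using False out by (simp add: sum_fun_apply cscale_def)
  qed
  then show ?thesis using that XC by blast
qed

section \<open>Schwartz functions and right invariant functions\<close>

definition std_lattice :: "('p::prime_card padic ^ 2) set" where
  "std_lattice = {v. \<forall>i. v $ i \<in> padic_int}"

lemma vector_in_std_lattice [simp]: "vector [x, y] \<in> std_lattice \<longleftrightarrow> x \<in> padic_int \<and> y \<in> padic_int"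
  by (simp add: std_lattice_def forall_2)

lemma compact_std_lattice: "compact (std_lattice :: ('p::prime_card padic ^ 2) set)"
  unfolding compact_eq_bounded_closed
proof
  have "dist 0 v \<le> 2" if v: "v \<in> std_lattice" for v :: "'p padic ^ 2"
  proof -
    have "dist 0 v \<le> (\<Sum>i\<in>UNIV. dist (0 $ i) (v $ i))"
      unfolding dist_vec_def by (rule L2_set_le_sum) simp
    also have "\<dots> \<le> (\<Sum>i\<in>(UNIV::2 set). 1)"
      using v by (intro sum_mono) (simp add: dist_padic padic_norm_minus std_lattice_def padic_int_iff)
    finally show ?thesis by simp
  qed
  then show "bounded (std_lattice :: ('p padic ^ 2) set)"
    unfolding bounded_any_center[of _ 0] by blast
  have e: "closed ((\<lambda>v. v $ i) -` {x. padic_norm x \<le> 1} :: ('p padic ^ 2) set)" for i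
    by (rule closed_vimage[OF closed_padic_norm]) (auto intro!: continuous_on_component continuous_on_id)
  have "std_lattice = (\<Inter>i. (\<lambda>v. v $ i) -` {x. padic_norm x \<le> 1} :: ('p padic ^ 2) set)"
    by (auto simp: std_lattice_def padic_int_iff)
  also have "closed \<dots>" by (intro closed_INT e ballI)
  finally show "closed (std_lattice :: ('p padic ^ 2) set)" .
qed

lemma open_std_lattice: "open (std_lattice :: ('p::prime_card padic ^ 2) set)"
proof -
  have e: "open ((\<lambda>v. v $ i) -` {x. padic_norm x \<le> 1} :: ('p padic ^ 2) set)" for i
    by (rule open_vimage[OF open_padic_norm_le]) (auto intro!: continuous_on_component continuous_on_id)
  have "std_lattice = (\<Inter>i. (\<lambda>v. v $ i) -` {x. padic_norm x \<le> 1} :: ('p padic ^ 2) set)"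
    by (auto simp: std_lattice_def padic_int_iff)
  also have "open \<dots>" by (intro open_INT e ballI) auto
  finally show ?thesis .
qed

lemma indicator_in_schwartz_space:
  assumes "compact S" "open S"
  shows "indicator S \<in> schwartz_space"
proof -
  have "open (- S)" using assms compact_imp_closed by blast
  have "\<exists>U. open U \<and> x \<in> U \<and> (\<forall>y\<in>U. indicator S y = (indicator S x :: complex))" for x
  proof (cases "x \<in> S")
    case True
    then show ?thesis using assms(2) by (intro exI[of _ S]) auto
  next
    case False
    then show ?thesis using \<open>open (- S)\<close> by (intro exI[of _ "- S"]) auto
  qed
  then show ?thesis
    using assms(1) by (auto simp: schwartz_space_def locally_constant_on_def compactly_supported_on_def intro!: exI[of _ S])
qed

text \<open>The cosets of \<open>GG_int\<close> are open, and right invariant functions are constant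
  on them.\<close>

lemma smooth_right_inv_eq:
  "smooth_right_inv = {\<xi> :: 'p::prime_card GG \<Rightarrow> complex. compactly_supported_on (carrier GG) \<xi> \<and>
     (\<forall>g\<in>carrier GG. \<forall>k\<in>GG_int. \<xi> (g \<otimes>\<^bsub>GG\<^esub> k) = \<xi> g)}"
proof -
  have "locally_constant_on (carrier GG) \<xi>"
    if *: "\<forall>g\<in>carrier GG. \<forall>k\<in>GG_int. \<xi> (g \<otimes>\<^bsub>GG\<^esub> k) = \<xi> g" for \<xi> :: "'p GG \<Rightarrow> complex"
    unfolding locally_constant_on_def
  proof (intro ballI exI conjI)
    fix x y :: "'p GG" assume x: "x \<in> carrier GG"
    show "open (gcoset x)" "x \<in> gcoset x" using open_gcoset[OF x] gcoset_self[OF x] by simp_all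
    assume "y \<in> gcoset x \<inter> carrier GG"
    then show "\<xi> y = \<xi> x" using * x by (auto simp: l_coset_def)
  qed
  then show ?thesis by (auto simp: smooth_right_inv_def)
qed

lemma smooth_right_inv_outside:
  "\<xi> \<in> smooth_right_inv \<Longrightarrow> x \<notin> carrier GG \<Longrightarrow> \<xi> x = 0"
  by (auto simp: smooth_right_inv_def compactly_supported_on_def)

text \<open>Outside the carrier both sides vanish, so invariance can be used without a side
  condition on \<open>x\<close>.\<close>

lemma smooth_right_inv_mult:
  assumes "\<xi> \<in> smooth_right_inv" "k \<in> GG_int"
  shows "\<xi> (x \<otimes>\<^bsub>GG\<^esub> k) = \<xi> x"
proof (cases "x \<in> carrier GG")
  case False
  then show ?thesis
    using smooth_right_inv_outside[OF assms(1)] mult_GG_in_carrier_iff(2)[OF KK.mem_carrier[OF assms(2)]] by simp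
qed (use assms in \<open>auto simp: smooth_right_inv_def\<close>)

lemma indicator_gcoset_smooth:
  assumes "g \<in> carrier GG"
  shows "indicator (gcoset g) \<in> smooth_right_inv"
  unfolding smooth_right_inv_eq compactly_supported_on_def
  using compact_gcoset[of g] gcoset_subset[OF assms] gcoset_K_mult[OF assms]
  by (auto simp: indicator_def intro!: exI[of _ "gcoset g"])

lemma smooth_right_inv_decomp:
  assumes "\<xi> \<in> smooth_right_inv"
  obtains X where "finite X" "X \<subseteq> carrier GG" "\<xi> = (\<Sum>x\<in>X. cscale (\<xi> x) (indicator (gcoset x)))"
proof -
  obtain C where C: "C \<subseteq> carrier GG" "compact C" "\<And>x. x \<notin> C \<Longrightarrow> \<xi> x = 0"
    using assms by (auto simp: smooth_right_inv_def compactly_supported_on_def)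
  show ?thesis
  proof (rule finite_partition_decomp[OF C(2,3), where E="\<lambda>x. gcoset x"])
    fix X assume "finite X" "X \<subseteq> C" "\<xi> = (\<Sum>x\<in>X. cscale (\<xi> x) (indicator (gcoset x)))"
    then show thesis using C(1) by (intro that[of X]) simp_all
  next
    fix x y assume x: "x \<in> C"
    then have xc: "x \<in> carrier GG" using C(1) by blast
    show "open (gcoset x)" by (rule open_gcoset[OF xc])
    show "x \<in> gcoset x" by (rule gcoset_self[OF xc])
    assume y: "y \<in> gcoset x"
    show "gcoset y = gcoset x" by (rule gcoset_eq[OF xc y])
    show "\<xi> y = \<xi> x" using y assms by (auto simp: l_coset_def smooth_right_inv_mult)
  qed simp_all
qed

text \<open>The carrier of the Hecke algebra (see \<open>carrier_hecke_algebra\<close>), in a form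
  that exhibits it as a part of \<open>smooth_right_inv\<close> and allows left invariance at every
  matrix pair.\<close>

definition bi_inv :: "('p::prime_card GG \<Rightarrow> complex) set" where
  "bi_inv = {\<theta> \<in> smooth_right_inv. \<forall>g. \<forall>k\<in>GG_int. \<theta> (k \<otimes>\<^bsub>GG\<^esub> g) = \<theta> g}"

lemma carrier_hecke_algebra: "carrier (hecke_algebra M) = bi_inv"
proof
  show "bi_inv \<subseteq> carrier (hecke_algebra M)"
  proof
    fix \<theta> :: "'a GG \<Rightarrow> complex" assume "\<theta> \<in> bi_inv"
    then have s: "\<theta> \<in> smooth_right_inv" and l: "\<And>g k. k \<in> GG_int \<Longrightarrow> \<theta> (k \<otimes>\<^bsub>GG\<^esub> g) = \<theta> g"
      by (simp_all add: bi_inv_def)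
    have "\<forall>g\<in>carrier GG. \<forall>k\<in>GG_int. \<forall>k'\<in>GG_int. \<theta> (k \<otimes>\<^bsub>GG\<^esub> g \<otimes>\<^bsub>GG\<^esub> k') = \<theta> g"
      by (intro ballI) (simp only: smooth_right_inv_mult[OF s] l)
    then show "\<theta> \<in> carrier (hecke_algebra M)" using s by (simp add: hecke_algebra_def smooth_right_inv_eq)
  qed
  show "carrier (hecke_algebra M) \<subseteq> bi_inv"
  proof
    fix \<theta> assume "\<theta> \<in> carrier (hecke_algebra M)"
    then have cs: "compactly_supported_on (carrier GG) \<theta>"
      and inv: "\<And>g k k'. g \<in> carrier GG \<Longrightarrow> k \<in> GG_int \<Longrightarrow> k' \<in> GG_int \<Longrightarrow> \<theta> (k \<otimes>\<^bsub>GG\<^esub> g \<otimes>\<^bsub>GG\<^esub> k') = \<theta> g"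
      by (auto simp: hecke_algebra_def)
    have "\<theta> (g \<otimes>\<^bsub>GG\<^esub> k) = \<theta> g" if "g \<in> carrier GG" "k \<in> GG_int" for g k
      using inv[of g "\<one>\<^bsub>GG\<^esub>" k] that by simp
    then have s: "\<theta> \<in> smooth_right_inv" using cs by (simp add: smooth_right_inv_eq)
    have "\<theta> (k \<otimes>\<^bsub>GG\<^esub> g) = \<theta> g" if k: "k \<in> GG_int" for g k
    proof (cases "g \<in> carrier GG")
      case True
      then show ?thesis using inv[of g k "\<one>\<^bsub>GG\<^esub>"] k KK.mem_carrier[OF k] by simp
    next
      case False
      then show ?thesis
        using smooth_right_inv_outside[OF s] mult_GG_in_carrier_iff(1)[OF KK.mem_carrier[OF k]] by simp
    qed
    with s show "\<theta> \<in> bi_inv" by (simp add: bi_inv_def)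
  qed
qed

section \<open>Hecke operators as finite sums over cosets\<close>

definition second_right_inv :: "(('p::prime_card padic ^ 2) \<times> 'p GG \<Rightarrow> complex) set" where
  "second_right_inv = {f. \<forall>x y. \<forall>k\<in>GG_int. f (x, y \<otimes>\<^bsub>GG\<^esub> k) = f (x, y)}"

text \<open>The form that \<open>hecke_act\<close> takes when \<open>X\<close> represents the cosets
  supporting \<open>\<theta>\<close>, each coset having volume 1.\<close>

definition coset_act :: "'p::prime_card GG set \<Rightarrow> ('p GG \<Rightarrow> complex) \<Rightarrow>
    (('p padic ^ 2) \<times> 'p GG \<Rightarrow> complex) \<Rightarrow> ('p padic ^ 2) \<times> 'p GG \<Rightarrow> complex" where
  "coset_act X \<theta> f = (\<lambda>(x, y). \<Sum>z\<in>X. \<theta> z * f (x, y \<otimes>\<^bsub>GG\<^esub> z))"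

lemma haar_space:
  assumes "haar_measure G M"
  shows "space M = carrier G"
proof -
  have "sets M = sets (restrict_space borel (carrier G))" using assms by (simp only: haar_measure_def)
  then have "space M = space (restrict_space borel (carrier G))" by (rule sets_eq_imp_space_eq)
  then show ?thesis by (simp add: space_restrict_space)
qed

lemma haar_gcoset:
  fixes M :: "('p::prime_card) GG measure"
  assumes M: "haar_measure GG M" "emeasure M GG_int = 1" and g: "g \<in> carrier GG"
  shows "gcoset g \<in> sets M" "emeasure M (gcoset g) = 1"
proof -
  have s: "gcoset x \<in> sets M" if "x \<in> carrier GG" for x
  proof -
    have "gcoset x \<in> sets (restrict_space borel (carrier GG))"
      using open_gcoset[OF that] gcoset_subset[OF that]
      by (auto simp: sets_restrict_space image_iff intro!: bexI[of _ "gcoset x"])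
    then show ?thesis using M by (simp add: haar_measure_def)
  qed
  from g show "gcoset g \<in> sets M" by (rule s)
  have "gcoset \<one>\<^bsub>GG\<^esub> = GG_int" using KK.mem_carrier by (force simp: l_coset_def)
  then have "GG_int \<in> sets M" using s[of "\<one>\<^bsub>GG\<^esub>"] by (metis G.one_closed)
  then have "emeasure M ((\<lambda>x. g \<otimes>\<^bsub>GG\<^esub> x) ` GG_int) = emeasure M GG_int"
    using M g by (simp add: haar_measure_def)
  moreover have "(\<lambda>x. g \<otimes>\<^bsub>GG\<^esub> x) ` GG_int = gcoset g" by (auto simp: l_coset_def)
  ultimately show "emeasure M (gcoset g) = 1" using M by simp
qed

text \<open>The integrand is constant on every coset. The decomposition of \<open>\<theta>\<close>
  along \<open>X\<close> is a hypothesis, so that one integral can be evaluated with different sets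
  of representatives.\<close>

lemma hecke_act_eq_coset_act:
  fixes M :: "('p::prime_card) GG measure"
  assumes M: "haar_measure GG M" "emeasure M GG_int = 1"
    and X: "finite X" "X \<subseteq> carrier GG"
    and \<theta>: "\<And>g. g \<in> carrier GG \<Longrightarrow> \<theta> g = (\<Sum>z\<in>X. \<theta> z * indicator (gcoset z) g)"
    and f: "f \<in> second_right_inv"
  shows "hecke_act M \<theta> f = coset_act X \<theta> f"
proof -
  have "(LINT g|M. \<theta> g * f (x, y \<otimes>\<^bsub>GG\<^esub> g)) = (\<Sum>z\<in>X. \<theta> z * f (x, y \<otimes>\<^bsub>GG\<^esub> z))" for x y
  proof -
    have "\<theta> g * f (x, y \<otimes>\<^bsub>GG\<^esub> g) = (\<Sum>z\<in>X. indicator (gcoset z) g *\<^sub>R (\<theta> z * f (x, y \<otimes>\<^bsub>GG\<^esub> z)))"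
      if "g \<in> carrier GG" for g
    proof -
      have "\<theta> z * indicator (gcoset z) g * f (x, y \<otimes>\<^bsub>GG\<^esub> g) = indicator (gcoset z) g *\<^sub>R (\<theta> z * f (x, y \<otimes>\<^bsub>GG\<^esub> z))"
        if "z \<in> X" for z
      proof (cases "g \<in> gcoset z")
        case True
        then obtain k where "k \<in> GG_int" "g = z \<otimes>\<^bsub>GG\<^esub> k" by (auto simp: l_coset_def)
        then have "f (x, y \<otimes>\<^bsub>GG\<^esub> g) = f (x, y \<otimes>\<^bsub>GG\<^esub> z)"
          using f by (simp add: second_right_inv_def flip: mult_GG_assoc)
        with True show ?thesis by simp
      qed simp
      then show ?thesis using \<theta>[OF that] by (simp add: sum_distrib_right)
    qed
    then have "(LINT g|M. \<theta> g * f (x, y \<otimes>\<^bsub>GG\<^esub> g))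
        = (LINT g|M. (\<Sum>z\<in>X. indicator (gcoset z) g *\<^sub>R (\<theta> z * f (x, y \<otimes>\<^bsub>GG\<^esub> z))))"
      using haar_space[OF M(1)] by (intro Bochner_Integration.integral_cong) auto
    also have "has_bochner_integral M (\<lambda>g. \<Sum>z\<in>X. indicator (gcoset z) g *\<^sub>R (\<theta> z * f (x, y \<otimes>\<^bsub>GG\<^esub> z)))
        (\<Sum>z\<in>X. measure M (gcoset z) *\<^sub>R (\<theta> z * f (x, y \<otimes>\<^bsub>GG\<^esub> z)))"
      using haar_gcoset[OF M] X(2)
      by (intro has_bochner_integral_sum has_bochner_integral_indicator) auto
    then have "(LINT g|M. (\<Sum>z\<in>X. indicator (gcoset z) g *\<^sub>R (\<theta> z * f (x, y \<otimes>\<^bsub>GG\<^esub> z))))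
        = (\<Sum>z\<in>X. measure M (gcoset z) *\<^sub>R (\<theta> z * f (x, y \<otimes>\<^bsub>GG\<^esub> z)))"
      by (rule has_bochner_integral_integral_eq)
    also have "\<dots> = (\<Sum>z\<in>X. \<theta> z * f (x, y \<otimes>\<^bsub>GG\<^esub> z))"
      using haar_gcoset[OF M] X(2) by (intro sum.cong) (auto simp: measure_def)
    finally show ?thesis .
  qed
  then show ?thesis by (simp add: hecke_act_def coset_act_def)
qed

lemma subspace_second_right_inv: "fun_vs.subspace second_right_inv"
  by (auto simp: fun_vs.subspace_def second_right_inv_def cscale_def)

lemma schwartz_tensor_right_inv: "schwartz_tensor \<subseteq> second_right_inv"
  unfolding schwartz_tensor_def tensor_space_def
  by (rule fun_vs.span_minimal[OF _ subspace_second_right_inv])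
    (auto simp: second_right_inv_def tensor_def smooth_right_inv_mult)

lemma coset_act_linear:
  "coset_act X \<theta> (f + g) = coset_act X \<theta> f + coset_act X \<theta> g"
  "coset_act X \<theta> (f - g) = coset_act X \<theta> f - coset_act X \<theta> g"
  "coset_act X \<theta> (cscale c f) = cscale c (coset_act X \<theta> f)"
  "coset_act X \<theta> 0 = 0"
  by (auto simp: coset_act_def cscale_def fun_eq_iff algebra_simps sum.distrib sum_subtractf sum_distrib_left)

lemma coset_act_diag_act: "coset_act X \<theta> (diag_act h f) = diag_act h (coset_act X \<theta> f)"
  by (simp add: coset_act_def diag_act_def fun_eq_iff mult_GG_assoc)

lemma coset_act_tensor:
  "coset_act X \<theta> (tensor \<phi> \<xi>) = tensor \<phi> (\<lambda>y. \<Sum>z\<in>X. \<theta> z * \<xi> (y \<otimes>\<^bsub>GG\<^esub> z))"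
  by (simp add: coset_act_def tensor_def fun_eq_iff sum_distrib_left mult.left_commute)

lemma inj_on_mult_GG:
  assumes "k \<in> carrier GG" "X \<subseteq> carrier GG"
  shows "inj_on (\<lambda>z. k \<otimes>\<^bsub>GG\<^esub> z) X"
proof (rule inj_on_inverseI)
  fix z assume "z \<in> X"
  then have "z \<in> carrier GG" using assms(2) by blast
  then show "inv\<^bsub>GG\<^esub> k \<otimes>\<^bsub>GG\<^esub> (k \<otimes>\<^bsub>GG\<^esub> z) = z"
    using assms(1) by (simp flip: mult_GG_assoc)
qed

text \<open>Left multiplication by \<open>k\<close> permutes the cosets in the support of
  \<open>\<theta>\<close>, so the translated representatives serve as well as
  \<open>X\<close>.\<close>

lemma bi_inv_translate_decomp:
  assumes \<theta>: "\<theta> \<in> bi_inv" and k: "k \<in> GG_int" and X: "X \<subseteq> carrier GG"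
    and dec: "\<And>g. g \<in> carrier GG \<Longrightarrow> \<theta> g = (\<Sum>z\<in>X. \<theta> z * indicator (gcoset z) g)"
    and g: "g \<in> carrier GG"
  shows "\<theta> g = (\<Sum>z\<in>(\<lambda>z. k \<otimes>\<^bsub>GG\<^esub> z) ` X. \<theta> z * indicator (gcoset z) g)"
proof -
  have kc: "k \<in> carrier GG" using k KK.mem_carrier by blast
  have inj: "inj_on (\<lambda>z. k \<otimes>\<^bsub>GG\<^esub> z) X"
    by (rule inj_on_mult_GG[OF kc X])
  have inv: "\<theta> (k \<otimes>\<^bsub>GG\<^esub> g) = \<theta> g" if "k \<in> GG_int" for g k using \<theta> that by (simp add: bi_inv_def)
  have "\<theta> g = \<theta> (inv\<^bsub>GG\<^esub> k \<otimes>\<^bsub>GG\<^esub> g)" using k by (simp add: inv)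
  also have "\<dots> = (\<Sum>z\<in>X. \<theta> z * indicator (gcoset z) (inv\<^bsub>GG\<^esub> k \<otimes>\<^bsub>GG\<^esub> g))"
    using g kc by (intro dec) auto
  also have "\<dots> = (\<Sum>z\<in>X. \<theta> (k \<otimes>\<^bsub>GG\<^esub> z) * indicator (gcoset (k \<otimes>\<^bsub>GG\<^esub> z)) g)"
  proof (rule sum.cong[OF refl])
    fix z assume "z \<in> X"
    then have "z \<in> carrier GG" using X by blast
    then show "\<theta> z * indicator (gcoset z) (inv\<^bsub>GG\<^esub> k \<otimes>\<^bsub>GG\<^esub> g)
        = \<theta> (k \<otimes>\<^bsub>GG\<^esub> z) * indicator (gcoset (k \<otimes>\<^bsub>GG\<^esub> z)) g"
      using gcoset_mult[OF kc] k by (simp add: inv indicator_def)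
  qed
  finally show ?thesis by (simp add: sum.reindex[OF inj])
qed

text \<open>Only right invariance of the new second factor is delicate, since \<open>k\<close> need
  not map \<open>X\<close> to itself. The sums over \<open>X\<close> and over its translate by
  \<open>k\<close> compute the same integral, and bi-invariance of \<open>\<theta>\<close> turns the
  second into the value at \<open>y\<close> times \<open>k\<close>.\<close>

lemma coset_act_schwartz_tensor:
  fixes M :: "('p::prime_card) GG measure" and X :: "'p GG set"
  assumes M: "haar_measure GG M" "emeasure M GG_int = 1"
    and \<theta>: "\<theta> \<in> bi_inv" and X: "finite X" "X \<subseteq> carrier GG"
    and dec: "\<And>g. g \<in> carrier GG \<Longrightarrow> \<theta> g = (\<Sum>z\<in>X. \<theta> z * indicator (gcoset z) g)"
    and f: "f \<in> schwartz_tensor"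
  shows "coset_act X \<theta> f \<in> schwartz_tensor"
proof -
  have main: "(\<lambda>y. \<Sum>z\<in>X. \<theta> z * \<xi> (y \<otimes>\<^bsub>GG\<^esub> z)) \<in> smooth_right_inv" (is "?\<xi> \<in> _")
    if \<xi>: "\<xi> \<in> smooth_right_inv" for \<xi> :: "'p GG \<Rightarrow> complex"
    unfolding smooth_right_inv_eq
  proof (intro CollectI conjI ballI)
    obtain C where C: "C \<subseteq> carrier GG" "compact C" "\<And>x. x \<notin> C \<Longrightarrow> \<xi> x = 0"
      using \<xi> by (auto simp: smooth_right_inv_def compactly_supported_on_def)
    let ?D = "\<Union>z\<in>X. (\<lambda>y. y \<otimes>\<^bsub>GG\<^esub> inv\<^bsub>GG\<^esub> z) ` C"
    have "compact ?D" using X C by (intro compact_UN compact_continuous_image continuous_on_mult_GG) auto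
    moreover have "?D \<subseteq> carrier GG"
      using X C by (intro UN_least image_subsetI G.m_closed G.inv_closed) blast+
    moreover have "?\<xi> y = 0" if y: "y \<notin> ?D" for y
    proof (rule sum.neutral, rule ballI)
      fix z assume z: "z \<in> X"
      have "y \<otimes>\<^bsub>GG\<^esub> z \<notin> C"
      proof
        assume c: "y \<otimes>\<^bsub>GG\<^esub> z \<in> C"
        then have "y \<in> carrier GG" using C X z mult_GG_in_carrier_iff(2)[of z y] by auto
        then have "y = y \<otimes>\<^bsub>GG\<^esub> z \<otimes>\<^bsub>GG\<^esub> inv\<^bsub>GG\<^esub> z" using z X by (simp add: mult_GG_assoc subset_iff)
        then show False using y c z by blast
      qed
      then show "\<theta> z * \<xi> (y \<otimes>\<^bsub>GG\<^esub> z) = 0" using C by simp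
    qed
    ultimately show "compactly_supported_on (carrier GG) ?\<xi>"
      unfolding compactly_supported_on_def by blast
    fix y k :: "'p GG" assume y: "y \<in> carrier GG" and k: "k \<in> GG_int"
    have kc: "k \<in> carrier GG" using k KK.mem_carrier by blast
    \<comment> \<open>The constant 1 is not a Schwartz function, but the integral formula only asks
      for right invariance in the second variable.\<close>
    let ?f = "tensor (\<lambda>_ :: 'p padic ^ 2. 1) \<xi>"
    have f: "?f \<in> second_right_inv" using \<xi> by (auto simp: second_right_inv_def tensor_def smooth_right_inv_mult)
    let ?X = "(\<lambda>z. k \<otimes>\<^bsub>GG\<^esub> z) ` X"
    have inj: "inj_on (\<lambda>z. k \<otimes>\<^bsub>GG\<^esub> z) X" by (rule inj_on_mult_GG[OF kc X(2)])
    have "coset_act X \<theta> ?f = hecke_act M \<theta> ?f"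
      by (rule hecke_act_eq_coset_act[OF M X dec f, symmetric])
    also have "\<dots> = coset_act ?X \<theta> ?f"
      using X kc
      by (intro hecke_act_eq_coset_act[OF M _ _ bi_inv_translate_decomp[OF \<theta> k X(2) dec] f])
        (simp, intro image_subsetI G.m_closed, blast+)
    finally have "coset_act X \<theta> ?f (0, y) = coset_act ?X \<theta> ?f (0, y)" by simp
    then have "?\<xi> y = (\<Sum>z\<in>X. \<theta> (k \<otimes>\<^bsub>GG\<^esub> z) * \<xi> (y \<otimes>\<^bsub>GG\<^esub> (k \<otimes>\<^bsub>GG\<^esub> z)))"
      by (simp add: coset_act_def tensor_def sum.reindex[OF inj])
    also have "\<dots> = ?\<xi> (y \<otimes>\<^bsub>GG\<^esub> k)" using \<theta> k by (simp add: bi_inv_def mult_GG_assoc)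
    finally show "?\<xi> (y \<otimes>\<^bsub>GG\<^esub> k) = ?\<xi> y" by simp
  qed
  have "fun_vs.subspace {f. coset_act X \<theta> f \<in> schwartz_tensor}"
    unfolding fun_vs.subspace_def schwartz_tensor_def tensor_space_def
    by (auto simp: coset_act_linear fun_vs.span_zero fun_vs.span_add fun_vs.span_scale)
  moreover have "{tensor a b |a b. a \<in> schwartz_space \<and> b \<in> smooth_right_inv} \<subseteq> {f. coset_act X \<theta> f \<in> schwartz_tensor}"
  proof clarify
    fix a :: "'p padic ^ 2 \<Rightarrow> complex" and b
    assume "a \<in> schwartz_space" "b \<in> (smooth_right_inv :: ('p GG \<Rightarrow> complex) set)"
    then show "coset_act X \<theta> (tensor a b) \<in> schwartz_tensor"
      unfolding coset_act_tensor schwartz_tensor_def tensor_space_def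
      using main by (blast intro: fun_vs.span_base)
  qed
  ultimately have "schwartz_tensor \<subseteq> {f. coset_act X \<theta> f \<in> schwartz_tensor}"
    unfolding schwartz_tensor_def tensor_space_def by (intro fun_vs.span_minimal)
  then show ?thesis using f by blast
qed

section \<open>Coinvariants and a criterion for cyclicity\<close>

definition coinv_span :: "(('p::prime_card padic ^ 2) \<times> 'p GG \<Rightarrow> complex) set" where
  "coinv_span = fun_vs.span {diag_act h v - v | h v. h \<in> carrier GL2 \<and> v \<in> schwartz_tensor}"

lemma coinv_rel_iff: "(f, g) \<in> coinv_rel \<longleftrightarrow> f \<in> schwartz_tensor \<and> g \<in> schwartz_tensor \<and> f - g \<in> coinv_span"
  by (simp add: coinv_rel_def coinv_span_def)

lemma equiv_coinv_rel: "equiv schwartz_tensor (coinv_rel :: (('p::prime_card padic ^ 2) \<times> 'p GG \<Rightarrow> complex) rel)" (is "equiv ?S ?R")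
proof (rule equivI)
  show "?R \<subseteq> ?S \<times> ?S" by (auto simp: coinv_rel_iff)
  show "refl_on ?S ?R"
    by (auto simp: refl_on_def coinv_rel_iff coinv_span_def fun_vs.span_zero)
  show "sym ?R"
  proof (rule symI)
    fix f g :: "('p padic ^ 2) \<times> 'p GG \<Rightarrow> complex" assume *: "(f, g) \<in> coinv_rel"
    then have "- (f - g) \<in> coinv_span"
      unfolding coinv_rel_iff coinv_span_def by (intro fun_vs.span_neg) simp
    then show "(g, f) \<in> coinv_rel" using * by (simp add: coinv_rel_iff)
  qed
  show "trans ?R"
  proof (rule transI)
    fix f g h :: "('p padic ^ 2) \<times> 'p GG \<Rightarrow> complex" assume *: "(f, g) \<in> coinv_rel" "(g, h) \<in> coinv_rel"
    then have "(f - g) + (g - h) \<in> coinv_span"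
      unfolding coinv_rel_iff coinv_span_def by (intro fun_vs.span_add) simp_all
    then show "(f, h) \<in> coinv_rel" using * by (simp add: coinv_rel_iff)
  qed
qed

text \<open>One set \<open>X\<close> serves all functions \<open>f\<close> at once, so linearity and
  compatibility with \<open>diag_act\<close> can be read off from finite sums.\<close>

lemma hecke_act_finite:
  fixes M :: "('p::prime_card) GG measure" and \<theta> :: "'p GG \<Rightarrow> complex"
  assumes M: "haar_measure GG M" "emeasure M GG_int = 1" and \<theta>: "\<theta> \<in> bi_inv"
  shows "\<exists>X \<subseteq> carrier GG. (\<forall>g. \<theta> g = (\<Sum>z\<in>X. \<theta> z * indicator (gcoset z) g)) \<and>
    (\<forall>f\<in>second_right_inv. hecke_act M \<theta> f = coset_act X \<theta> f) \<and>
    (\<forall>f\<in>schwartz_tensor. coset_act X \<theta> f \<in> schwartz_tensor)"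
proof -
  have "\<theta> \<in> smooth_right_inv" using \<theta> by (simp add: bi_inv_def)
  then obtain X where X: "finite X" "X \<subseteq> carrier GG" "\<theta> = (\<Sum>x\<in>X. cscale (\<theta> x) (indicator (gcoset x)))"
    by (rule smooth_right_inv_decomp)
  have dec: "\<theta> g = (\<Sum>z\<in>X. \<theta> z * indicator (gcoset z) g)" for g
    by (subst X(3)) (simp add: sum_fun_apply cscale_def)
  show ?thesis
    by (intro exI[of _ X] conjI allI ballI X(2) dec hecke_act_eq_coset_act[OF M X(1,2) dec]
        coset_act_schwartz_tensor[OF M \<theta> X(1,2) dec])
qed

text \<open>Right translations commute with the diagonal left action, so Hecke operators preserve
  the span that is divided out.\<close>

lemma hecke_act_coinv_rel:
  fixes M :: "('p::prime_card) GG measure"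
  assumes M: "haar_measure GG M" "emeasure M GG_int = 1" and \<theta>: "\<theta> \<in> bi_inv" and fg: "(f, g) \<in> coinv_rel"
  shows "(hecke_act M \<theta> f, hecke_act M \<theta> g) \<in> coinv_rel"
proof -
  obtain X where "X \<subseteq> carrier GG" "\<And>g. \<theta> g = (\<Sum>z\<in>X. \<theta> z * indicator (gcoset z) g)"
    and X: "\<And>f. f \<in> second_right_inv \<Longrightarrow> hecke_act M \<theta> f = coset_act X \<theta> f"
    "\<And>f. f \<in> schwartz_tensor \<Longrightarrow> coset_act X \<theta> f \<in> schwartz_tensor"
    using hecke_act_finite[OF M \<theta>] by blast
  have "fun_vs.subspace {f. coset_act X \<theta> f \<in> coinv_span}"
    unfolding fun_vs.subspace_def coinv_span_def
    by (auto simp: coset_act_linear fun_vs.span_zero fun_vs.span_add fun_vs.span_scale)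
  moreover have "{diag_act h v - v | h v. h \<in> carrier GL2 \<and> v \<in> schwartz_tensor} \<subseteq> {f. coset_act X \<theta> f \<in> coinv_span}"
  proof clarify
    fix h :: "'p padic ^ 2 ^ 2" and v :: "('p padic ^ 2) \<times> 'p GG \<Rightarrow> complex"
    assume "h \<in> carrier GL2" "v \<in> schwartz_tensor"
    then show "coset_act X \<theta> (diag_act h v - v) \<in> coinv_span"
      unfolding coset_act_linear coset_act_diag_act coinv_span_def
      using X(2) by (blast intro: fun_vs.span_base)
  qed
  ultimately have "coinv_span \<subseteq> {f. coset_act X \<theta> f \<in> coinv_span}"
    by (subst coinv_span_def) (intro fun_vs.span_minimal)
  then show ?thesis
    using fg X schwartz_tensor_right_inv by (auto simp: coinv_rel_iff subset_iff simp flip: coset_act_linear)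
qed

lemma phi0_tensor_in_schwartz_tensor:
  assumes "\<xi> \<in> smooth_right_inv"
  shows "tensor (indicator std_lattice) \<xi> \<in> schwartz_tensor"
  unfolding schwartz_tensor_def tensor_space_def
  using indicator_in_schwartz_space[OF compact_std_lattice open_std_lattice] assms
  by (blast intro: fun_vs.span_base)

lemma GG_int_eq_gcoset: "GG_int = gcoset (\<one>\<^bsub>GG\<^esub> :: 'p::prime_card GG)"
  using KK.mem_carrier by (force simp: l_coset_def)

text \<open>Inversion exchanges left and right invariance. The support of the new function is
  covered by the inverses of finitely many cosets, which are translates of the compact set
  \<open>GG_int\<close>.\<close>

lemma bi_inv_inverse:
  fixes \<eta> :: "'p::prime_card GG \<Rightarrow> complex"
  assumes \<eta>: "\<eta> \<in> bi_inv"
  shows "(\<lambda>y. if y \<in> carrier GG then \<eta> (inv\<^bsub>GG\<^esub> y) else 0) \<in> bi_inv" (is "?\<theta> \<in> _")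
proof -
  have s: "\<eta> \<in> smooth_right_inv" using \<eta> by (simp add: bi_inv_def)
  obtain X where X: "finite X" "X \<subseteq> carrier GG" "\<eta> = (\<Sum>x\<in>X. cscale (\<eta> x) (indicator (gcoset x)))"
    using smooth_right_inv_decomp[OF s] .
  have left: "\<eta> (k \<otimes>\<^bsub>GG\<^esub> g) = \<eta> g" if "k \<in> GG_int" for k g using \<eta> that by (simp add: bi_inv_def)
  let ?D = "\<Union>z\<in>X. (\<lambda>y. y \<otimes>\<^bsub>GG\<^esub> inv\<^bsub>GG\<^esub> z) ` GG_int"
  have "compact (GG_int :: 'p GG set)"
    using compact_gcoset[of "\<one>\<^bsub>GG\<^esub> :: 'p GG"] by (simp only: GG_int_eq_gcoset[symmetric])
  then have "compact ?D"
    using X(1) by (intro compact_UN compact_continuous_image continuous_on_mult_GG)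
  moreover have "?D \<subseteq> carrier GG"
    using X KK.mem_carrier by (intro UN_least image_subsetI G.m_closed G.inv_closed) blast+
  moreover have "?\<theta> y = 0" if y: "y \<notin> ?D" for y
  proof (cases "y \<in> carrier GG")
    case True
    have "inv\<^bsub>GG\<^esub> y \<notin> gcoset z" if z: "z \<in> X" for z
    proof
      assume "inv\<^bsub>GG\<^esub> y \<in> gcoset z"
      then obtain k where k: "k \<in> GG_int" "inv\<^bsub>GG\<^esub> y = z \<otimes>\<^bsub>GG\<^esub> k" by (auto simp: l_coset_def)
      have "inv\<^bsub>GG\<^esub> (inv\<^bsub>GG\<^esub> y) = inv\<^bsub>GG\<^esub> k \<otimes>\<^bsub>GG\<^esub> inv\<^bsub>GG\<^esub> z"
        unfolding k(2) using k(1) z X KK.mem_carrier by (intro G.inv_mult_group) auto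
      then have "y = inv\<^bsub>GG\<^esub> k \<otimes>\<^bsub>GG\<^esub> inv\<^bsub>GG\<^esub> z" using True by simp
      then show False using y z KK.m_inv_closed[OF k(1)] by blast
    qed
    then show ?thesis by (subst X(3)) (simp add: sum_fun_apply cscale_def)
  qed simp
  ultimately have "compactly_supported_on (carrier GG) ?\<theta>"
    unfolding compactly_supported_on_def by blast
  moreover have "?\<theta> (g \<otimes>\<^bsub>GG\<^esub> k) = ?\<theta> g" if "k \<in> GG_int" for g k
  proof (cases "g \<in> carrier GG")
    case True
    then show ?thesis
      using that KK.mem_carrier[OF that] left[of "inv\<^bsub>GG\<^esub> k" "inv\<^bsub>GG\<^esub> g"] by (simp add: G.inv_mult_group)
  qed (use mult_GG_in_carrier_iff(2)[OF KK.mem_carrier[OF that]] in simp)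
  moreover have "?\<theta> (k \<otimes>\<^bsub>GG\<^esub> g) = ?\<theta> g" if "k \<in> GG_int" for g k
  proof (cases "g \<in> carrier GG")
    case True
    then show ?thesis
      using that KK.mem_carrier[OF that] smooth_right_inv_mult[OF s, of "inv\<^bsub>GG\<^esub> k" "inv\<^bsub>GG\<^esub> g"]
      by (simp add: G.inv_mult_group)
  qed (use mult_GG_in_carrier_iff(1)[OF KK.mem_carrier[OF that]] in simp)
  ultimately show ?thesis unfolding bi_inv_def smooth_right_inv_eq mem_Collect_eq by blast
qed

text \<open>This disposes of the measure and of the module structure: the remaining hypothesis
  \<open>key\<close> speaks of functions modulo \<open>coinv_span\<close> only.\<close>

theorem cyclic_if_bi_inv_representatives:
  fixes M :: "('p::prime_card) GG measure"
  assumes M: "haar_measure GG M" "emeasure M GG_int = 1"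
    and key: "\<And>f :: ('p padic ^ 2) \<times> 'p GG \<Rightarrow> complex. f \<in> schwartz_tensor \<Longrightarrow>
      \<exists>\<eta>\<in>bi_inv. f - tensor (indicator std_lattice) \<eta> \<in> coinv_span"
  shows "cyclic_with_generator (hecke_algebra M) (coinv_module M)
           (coinv_class (tensor (indicator std_lattice) (indicator GG_int)))"
proof -
  let ?x = "tensor (indicator std_lattice) (indicator GG_int) :: ('p padic ^ 2) \<times> 'p GG \<Rightarrow> complex"
  have xi0: "indicator GG_int \<in> (smooth_right_inv :: ('p GG \<Rightarrow> complex) set)"
    using indicator_gcoset_smooth[of "\<one>\<^bsub>GG\<^esub> :: 'p GG"] G.one_closed by (simp only: GG_int_eq_gcoset[symmetric])
  then have x: "?x \<in> schwartz_tensor" by (rule phi0_tensor_in_schwartz_tensor)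
  \<comment> \<open>\<open>smult\<close> is a union over representatives; compatibility with
    \<open>coinv_rel\<close> makes all members of the union the same class.\<close>
  have act: "\<theta> \<odot>\<^bsub>coinv_module M\<^esub> coinv_class ?x = coinv_class (hecke_act M \<theta> ?x)" if \<theta>: "\<theta> \<in> bi_inv" for \<theta>
  proof -
    have "coinv_class (hecke_act M \<theta> f) = coinv_class (hecke_act M \<theta> ?x)" if "f \<in> coinv_class ?x" for f
    proof -
      have "(hecke_act M \<theta> ?x, hecke_act M \<theta> f) \<in> coinv_rel"
        using that by (intro hecke_act_coinv_rel[OF M \<theta>]) (auto simp: coinv_class_def)
      then show ?thesis unfolding coinv_class_def using equiv_class_eq[OF equiv_coinv_rel] by metis
    qed
    moreover have "?x \<in> coinv_class ?x" unfolding coinv_class_def by (rule equiv_class_self[OF equiv_coinv_rel x])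
    moreover have "\<theta> \<odot>\<^bsub>coinv_module M\<^esub> coinv_class ?x = (\<Union>f\<in>coinv_class ?x. coinv_class (hecke_act M \<theta> f))"
      by (simp only: coinv_module_def module.simps)
    ultimately show ?thesis by (metis (no_types, lifting) SUP_cong UN_constant empty_iff)
  qed
  have st: "hecke_act M \<theta> ?x \<in> schwartz_tensor" if "\<theta> \<in> bi_inv" for \<theta>
  proof -
    have "(?x, ?x) \<in> coinv_rel" using equiv_coinv_rel x by (rule equiv_class_self[unfolded Image_singleton_iff])
    from hecke_act_coinv_rel[OF M that this] show ?thesis by (simp only: coinv_rel_iff)
  qed
  have gen: "\<exists>\<theta>\<in>bi_inv. hecke_act M \<theta> ?x = tensor (indicator std_lattice) \<eta>" if \<eta>: "\<eta> \<in> bi_inv" for \<eta>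
  proof
    let ?\<theta> = "\<lambda>y. if y \<in> carrier GG then \<eta> (inv\<^bsub>GG\<^esub> y) else 0"
    show \<theta>: "?\<theta> \<in> bi_inv" by (rule bi_inv_inverse[OF \<eta>])
    obtain X where X: "X \<subseteq> carrier GG" "\<And>g. ?\<theta> g = (\<Sum>z\<in>X. ?\<theta> z * indicator (gcoset z) g)"
      "\<And>f. f \<in> second_right_inv \<Longrightarrow> hecke_act M ?\<theta> f = coset_act X ?\<theta> f"
      "\<And>f. f \<in> schwartz_tensor \<Longrightarrow> coset_act X ?\<theta> f \<in> schwartz_tensor"
      using hecke_act_finite[OF M \<theta>] by blast
    have "(\<Sum>z\<in>X. ?\<theta> z * indicator GG_int (y \<otimes>\<^bsub>GG\<^esub> z)) = \<eta> y" for y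
    proof (cases "y \<in> carrier GG")
      case True
      have "(\<Sum>z\<in>X. ?\<theta> z * indicator GG_int (y \<otimes>\<^bsub>GG\<^esub> z)) = (\<Sum>z\<in>X. ?\<theta> z * indicator (gcoset z) (inv\<^bsub>GG\<^esub> y))"
      proof (rule sum.cong[OF refl])
        fix z assume "z \<in> X"
        then have z: "z \<in> carrier GG" using X by blast
        have "inv\<^bsub>GG\<^esub> y \<in> gcoset z \<longleftrightarrow> inv\<^bsub>GG\<^esub> (y \<otimes>\<^bsub>GG\<^esub> z) \<in> GG_int"
          using z True by (simp add: mem_gcoset G.inv_mult_group)
        also have "\<dots> \<longleftrightarrow> y \<otimes>\<^bsub>GG\<^esub> z \<in> GG_int"
          using KK.m_inv_closed[of "y \<otimes>\<^bsub>GG\<^esub> z"] KK.m_inv_closed[of "inv\<^bsub>GG\<^esub> (y \<otimes>\<^bsub>GG\<^esub> z)"] z True by auto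
        finally show "?\<theta> z * indicator GG_int (y \<otimes>\<^bsub>GG\<^esub> z) = ?\<theta> z * indicator (gcoset z) (inv\<^bsub>GG\<^esub> y)"
          by (simp add: indicator_def)
      qed
      also have "\<dots> = ?\<theta> (inv\<^bsub>GG\<^esub> y)" by (rule X(2)[symmetric])
      also have "\<dots> = \<eta> y" using True by simp
      finally show ?thesis .
    next
      case False
      then have "\<eta> y = 0" using \<eta> by (simp add: bi_inv_def smooth_right_inv_outside)
      moreover have "y \<otimes>\<^bsub>GG\<^esub> z \<notin> GG_int" if "z \<in> X" for z
        using False mult_GG_in_carrier_iff(2)[of z y] KK.mem_carrier X(1) that by blast
      ultimately show ?thesis by simp
    qed
    then have "coset_act X ?\<theta> ?x = tensor (indicator std_lattice) \<eta>" by (simp add: coset_act_tensor)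
    moreover have "?x \<in> second_right_inv" using x schwartz_tensor_right_inv by blast
    ultimately show "hecke_act M ?\<theta> ?x = tensor (indicator std_lattice) \<eta>" using X(3) by simp
  qed
  show ?thesis
    unfolding cyclic_with_generator_def carrier_hecke_algebra
  proof
    have car: "carrier (coinv_module M) = schwartz_tensor // coinv_rel" by (simp add: coinv_module_def)
    show "coinv_class ?x \<in> carrier (coinv_module M)"
      unfolding car coinv_class_def by (rule quotientI[OF x])
    show "carrier (coinv_module M) = {r \<odot>\<^bsub>coinv_module M\<^esub> coinv_class ?x |r. r \<in> bi_inv}"
    proof
      show "{r \<odot>\<^bsub>coinv_module M\<^esub> coinv_class ?x |r. r \<in> bi_inv} \<subseteq> carrier (coinv_module M)"
      proof clarify
        fix \<theta> assume \<theta>: "\<theta> \<in> (bi_inv :: ('p GG \<Rightarrow> complex) set)"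
        show "\<theta> \<odot>\<^bsub>coinv_module M\<^esub> coinv_class ?x \<in> carrier (coinv_module M)"
          unfolding act[OF \<theta>] car by (unfold coinv_class_def) (rule quotientI[OF st[OF \<theta>]])
      qed
      show "carrier (coinv_module M) \<subseteq> {r \<odot>\<^bsub>coinv_module M\<^esub> coinv_class ?x |r. r \<in> bi_inv}"
      proof
        fix Y assume "Y \<in> carrier (coinv_module M)"
        then obtain f where f: "f \<in> schwartz_tensor" "Y = coinv_class f"
          unfolding car coinv_class_def by (auto elim: quotientE)
        obtain \<eta> where \<eta>: "\<eta> \<in> bi_inv" "f - tensor (indicator std_lattice) \<eta> \<in> coinv_span" using key[OF f(1)] by blast
        obtain \<theta> where \<theta>: "\<theta> \<in> bi_inv" "hecke_act M \<theta> ?x = tensor (indicator std_lattice) \<eta>" using gen[OF \<eta>(1)] by blast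
        have "(f, hecke_act M \<theta> ?x) \<in> coinv_rel" using f \<eta> st[OF \<theta>(1)] \<theta>(2) by (simp add: coinv_rel_iff)
        then have "Y = coinv_class (hecke_act M \<theta> ?x)"
          unfolding f(2) coinv_class_def by (rule equiv_class_eq[OF equiv_coinv_rel])
        then show "Y \<in> {r \<odot>\<^bsub>coinv_module M\<^esub> coinv_class ?x |r. r \<in> bi_inv}" using act[OF \<theta>(1)] \<theta>(1) by blast
      qed
    qed
  qed
qed


section \<open>Lattice symbols and the neighbour relation\<close>

text \<open>Modulo \<open>coinv_span\<close>, these are the functions obtained from the generator by
  Hecke operators. They form a subspace, so the remaining work is linear algebra modulo
  \<open>reducible\<close>.\<close>

definition reducible :: "(('p::prime_card padic ^ 2) \<times> 'p GG \<Rightarrow> complex) set" where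
  "reducible = {f. \<exists>\<eta>\<in>bi_inv. f - tensor (indicator std_lattice) \<eta> \<in> coinv_span}"

lemma subspace_bi_inv: "fun_vs.subspace (bi_inv :: ('p::prime_card GG \<Rightarrow> complex) set)"
proof (rule fun_vs.subspaceI)
  show "0 \<in> (bi_inv :: ('p GG \<Rightarrow> complex) set)"
    by (simp add: bi_inv_def smooth_right_inv_eq compactly_supported_on_def exI[of _ "{}"])
  fix \<theta> \<eta> :: "'p GG \<Rightarrow> complex" and c
  assume \<theta>: "\<theta> \<in> bi_inv"
  then obtain C where C: "C \<subseteq> carrier GG" "compact C" "\<forall>x. x \<notin> C \<longrightarrow> \<theta> x = 0"
    unfolding bi_inv_def smooth_right_inv_eq compactly_supported_on_def by blast
  have "compactly_supported_on (carrier GG) (cscale c \<theta>)"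
    unfolding compactly_supported_on_def
    using C by (intro exI[of _ C]) (simp add: cscale_def)
  then show "cscale c \<theta> \<in> bi_inv"
    using \<theta> by (simp add: bi_inv_def smooth_right_inv_eq cscale_def)
  assume \<eta>: "\<eta> \<in> bi_inv"
  then obtain D where D: "D \<subseteq> carrier GG" "compact D" "\<forall>x. x \<notin> D \<longrightarrow> \<eta> x = 0"
    unfolding bi_inv_def smooth_right_inv_eq compactly_supported_on_def by blast
  have "compactly_supported_on (carrier GG) (\<theta> + \<eta>)"
    unfolding compactly_supported_on_def
    using C D by (intro exI[of _ "C \<union> D"]) (simp add: compact_Un)
  then show "\<theta> + \<eta> \<in> bi_inv"
    using \<theta> \<eta> by (simp add: bi_inv_def smooth_right_inv_eq)
qed

lemma subspace_coinv_span: "fun_vs.subspace coinv_span"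
  unfolding coinv_span_def by (rule fun_vs.subspace_span)

lemma subspace_reducible: "fun_vs.subspace (reducible :: (('p::prime_card padic ^ 2) \<times> 'p GG \<Rightarrow> complex) set)"
proof (rule fun_vs.subspaceI)
  show "0 \<in> (reducible :: (('p padic ^ 2) \<times> 'p GG \<Rightarrow> complex) set)"
    unfolding reducible_def
    by (auto simp: tensor_linear fun_vs.subspace_0[OF subspace_coinv_span] intro!: bexI[of _ 0] fun_vs.subspace_0[OF subspace_bi_inv])
  fix f g :: "('p padic ^ 2) \<times> 'p GG \<Rightarrow> complex" and c
  assume "f \<in> reducible"
  then obtain \<eta> where \<eta>: "\<eta> \<in> bi_inv" "f - tensor (indicator std_lattice) \<eta> \<in> coinv_span" by (auto simp: reducible_def)
  have "cscale c f - tensor (indicator std_lattice) (cscale c \<eta>) \<in> coinv_span"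
    using fun_vs.subspace_scale[OF subspace_coinv_span \<eta>(2), of c]
    by (simp add: tensor_linear fun_vs.scale_right_diff_distrib)
  then show "cscale c f \<in> reducible"
    using fun_vs.subspace_scale[OF subspace_bi_inv \<eta>(1)] by (auto simp: reducible_def)
  assume "g \<in> reducible"
  then obtain \<theta> where \<theta>: "\<theta> \<in> bi_inv" "g - tensor (indicator std_lattice) \<theta> \<in> coinv_span" by (auto simp: reducible_def)
  have "f + g - tensor (indicator std_lattice) (\<eta> + \<theta>) \<in> coinv_span"
    using fun_vs.subspace_add[OF subspace_coinv_span \<eta>(2) \<theta>(2)] by (simp add: tensor_linear add_diff_add)
  then show "f + g \<in> reducible"
    using fun_vs.subspace_add[OF subspace_bi_inv \<eta>(1) \<theta>(1)] by (auto simp: reducible_def)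
qed

lemma coinv_span_reducible: "f \<in> coinv_span \<Longrightarrow> f \<in> reducible"
  unfolding reducible_def
  by (auto simp: tensor_linear intro!: bexI[of _ 0] fun_vs.subspace_0[OF subspace_bi_inv])

lemma tensor_bi_inv_reducible: "\<eta> \<in> bi_inv \<Longrightarrow> tensor (indicator std_lattice) \<eta> \<in> reducible"
  unfolding reducible_def
  by (auto simp: fun_vs.subspace_0[OF subspace_coinv_span] intro!: bexI[of _ \<eta>])

lemmas reducible_add = fun_vs.subspace_add[OF subspace_reducible]
lemmas reducible_diff = fun_vs.subspace_diff[OF subspace_reducible]
lemmas reducible_scale = fun_vs.subspace_scale[OF subspace_reducible]
lemmas reducible_sum = fun_vs.subspace_sum[OF subspace_reducible]
lemmas reducible_0 = fun_vs.subspace_0[OF subspace_reducible]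

lemma reducible_cong:
  assumes "f - g \<in> reducible"
  shows "f \<in> reducible \<longleftrightarrow> g \<in> reducible"
  using reducible_add[OF assms, of g] reducible_diff[OF _ assms, of f] by auto

text \<open>With \<open>J\<close> the indices whose term is congruent to \<open>F\<close>, the sum
  is \<open>card J\<close> times \<open>F\<close> up to reducible terms. By \<open>ex\<close> the
  set \<open>J\<close> is nonempty, so its size can be divided out.\<close>

lemma reducible_of_sum:
  assumes I: "finite I" and s: "(\<Sum>i\<in>I. f i) \<in> reducible"
    and alt: "\<And>i. i \<in> I \<Longrightarrow> f i \<in> reducible \<or> f i - F \<in> reducible"
    and ex: "\<exists>i\<in>I. f i - F \<in> reducible"
  shows "F \<in> reducible"
proof -
  define J where "J = {i \<in> I. f i - F \<in> reducible}"
  have J: "finite J" "J \<subseteq> I" "J \<noteq> {}" using I ex by (auto simp: J_def)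
  have "(\<Sum>i\<in>I. f i) = (\<Sum>i\<in>J. f i) + (\<Sum>i\<in>I - J. f i)"
    using I J by (simp add: sum.subset_diff add.commute)
  also have "(\<Sum>i\<in>J. f i) = (\<Sum>i\<in>J. f i - F) + cscale (of_nat (card J)) F"
    by (auto simp: fun_eq_iff sum_fun_apply cscale_def sum_subtractf)
  finally have "cscale (of_nat (card J)) F = (\<Sum>i\<in>I. f i) - (\<Sum>i\<in>J. f i - F) - (\<Sum>i\<in>I - J. f i)"
    by (simp add: fun_eq_iff)
  moreover have "(\<Sum>i\<in>J. f i - F) \<in> reducible" by (rule reducible_sum) (simp add: J_def)
  moreover have "(\<Sum>i\<in>I - J. f i) \<in> reducible" by (rule reducible_sum) (use alt in \<open>auto simp: J_def\<close>)
  ultimately have "cscale (of_nat (card J)) F \<in> reducible" using s by (simp add: reducible_diff)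
  then have "cscale (1 / of_nat (card J)) (cscale (of_nat (card J)) F) \<in> reducible" by (rule reducible_scale)
  moreover have "cscale (1 / of_nat (card J)) (cscale (of_nat (card J)) F) = F"
    using J by (simp add: cscale_def fun_eq_iff card_gt_0_iff)
  ultimately show ?thesis by simp
qed

text \<open>
  A matrix stands for the lattice spanned by its columns. The Schwartz component is the indicator of the
  row lattice \<open>\<int>\<^sub>p\<^sup>2 A\<^sup>-\<^sup>1\<close> dual to \<open>A \<int>\<^sub>p\<^sup>2\<close>, so that \<open>GL\<^sub>2\<close> acts on all three arguments from the left.
\<close>

definition lattice_symbol :: "'p::prime_card padic ^ 2 ^ 2 \<Rightarrow> 'p padic ^ 2 ^ 2 \<Rightarrow> 'p padic ^ 2 ^ 2 \<Rightarrow>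
    ('p padic ^ 2) \<times> 'p GG \<Rightarrow> complex" where
  "lattice_symbol A B C = tensor (\<lambda>x. indicator std_lattice (x v* A)) (indicator (gcoset (B, C)))"

lemma continuous_on_vector_matrix_mult:
  fixes A :: "'p::prime_card padic ^ 2 ^ 2"
  shows "continuous_on S (\<lambda>x. x v* A)"
  unfolding vector_matrix_mult_def
  by (intro continuous_on_vec_lambda continuous_on_sum continuous_on_padic_mult continuous_on_component
      continuous_on_const continuous_on_id)

lemma inv_GL2:
  assumes "A \<in> carrier (GL2 :: ('p::prime_card padic ^ 2 ^ 2) monoid)"
  shows "inv\<^bsub>GL2\<^esub> A ** A = mat 1" "A ** inv\<^bsub>GL2\<^esub> A = mat 1"
  using GL.l_inv[OF assms] GL.r_inv[OF assms] by simp_all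

lemma lattice_symbol_in_schwartz_tensor:
  assumes "A \<in> carrier GL2" "B \<in> carrier GL2" "C \<in> carrier GL2"
  shows "lattice_symbol A B C \<in> schwartz_tensor"
proof -
  let ?S = "(\<lambda>x. x v* A) -` std_lattice"
  have "?S = (\<lambda>x. x v* inv\<^bsub>GL2\<^esub> A) ` std_lattice"
  proof
    show "?S \<subseteq> (\<lambda>x. x v* inv\<^bsub>GL2\<^esub> A) ` std_lattice"
    proof
      fix x assume "x \<in> ?S"
      moreover have "x = (x v* A) v* inv\<^bsub>GL2\<^esub> A"
        by (simp add: vector_matrix_mul_assoc inv_GL2[OF assms(1)])
      ultimately show "x \<in> (\<lambda>x. x v* inv\<^bsub>GL2\<^esub> A) ` std_lattice" by (metis image_eqI vimageD)
    qed
    show "(\<lambda>x. x v* inv\<^bsub>GL2\<^esub> A) ` std_lattice \<subseteq> ?S"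
      by (auto simp: vector_matrix_mul_assoc inv_GL2[OF assms(1)])
  qed
  then have "compact ?S"
    using compact_continuous_image[OF continuous_on_vector_matrix_mult compact_std_lattice] by metis
  moreover have "open ?S"
    using open_vimage[OF open_std_lattice continuous_on_vector_matrix_mult] .
  ultimately have "indicator ?S \<in> schwartz_space" by (rule indicator_in_schwartz_space)
  moreover have "indicator ?S = (\<lambda>x. indicator std_lattice (x v* A) :: complex)"
    by (simp add: indicator_def fun_eq_iff)
  ultimately show ?thesis
    unfolding lattice_symbol_def schwartz_tensor_def tensor_space_def
    using indicator_gcoset_smooth[of "(B, C)"] assms
    by (intro fun_vs.span_base) (auto simp: carrier_GG)
qed

lemma diag_act_diff_reducible:
  assumes "h \<in> carrier GL2" "f \<in> schwartz_tensor"
  shows "diag_act h f - f \<in> reducible" "f - diag_act h f \<in> reducible"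
proof -
  have *: "diag_act h f - f \<in> coinv_span"
    unfolding coinv_span_def using assms by (blast intro: fun_vs.span_base)
  then show "diag_act h f - f \<in> reducible" by (rule coinv_span_reducible)
  from fun_vs.subspace_neg[OF subspace_coinv_span *] show "f - diag_act h f \<in> reducible"
    by (simp add: coinv_span_reducible)
qed

lemma diag_act_tensor_gcoset:
  assumes "h \<in> carrier GL2" "B \<in> carrier GL2" "C \<in> carrier GL2"
  shows "diag_act h (tensor \<phi> (indicator (gcoset (B, C)))) =
    tensor (\<lambda>x. \<phi> (x v* h)) (indicator (gcoset (h ** B, h ** C)))"
proof -
  have "indicator (gcoset (B, C)) (inv\<^bsub>GG\<^esub> (h, h) \<otimes>\<^bsub>GG\<^esub> g) = (indicator (gcoset (h ** B, h ** C)) g :: complex)" for g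
    using gcoset_mult[of "(h, h)" "(B, C)" g] assms by (simp add: carrier_GG mult_GG indicator_def)
  then show ?thesis by (simp add: diag_act_tensor)
qed

lemma gcoset_K:
  assumes "B \<in> carrier GL2" "C \<in> carrier GL2" "k \<in> GL2_int" "k' \<in> GL2_int"
  shows "gcoset (B ** k, C ** k') = gcoset (B, C)"
proof (rule gcoset_eq)
  show "(B, C) \<in> carrier GG" using assms by (simp add: carrier_GG)
  have "(B ** k, C ** k') = (B, C) \<otimes>\<^bsub>GG\<^esub> (k, k')" by (simp add: mult_GG)
  then show "(B ** k, C ** k') \<in> gcoset (B, C)" using assms by (auto simp: l_coset_def GG_int_def)
qed

lemma std_lattice_mult_K:
  assumes "k \<in> GL2_int"
  shows "x v* k \<in> std_lattice \<longleftrightarrow> (x :: 'p::prime_card padic ^ 2) \<in> std_lattice"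
proof -
  have *: "x v* k \<in> std_lattice" if "x \<in> std_lattice" "k \<in> GL2_int" for x :: "'p padic ^ 2" and k
    using that by (simp add: std_lattice_def GL2_int_iff vector_matrix_mult_def sum_2)
  have "x v* k v* inv\<^bsub>GL2\<^esub> k = x"
    using K.mem_carrier[OF assms] by (simp add: vector_matrix_mul_assoc inv_GL2)
  then show ?thesis using *[of x k] *[of "x v* k" "inv\<^bsub>GL2\<^esub> k"] K.m_inv_closed[OF assms] assms by metis
qed

lemma lattice_symbol_K:
  assumes "A \<in> carrier GL2" "B \<in> carrier GL2" "C \<in> carrier GL2" "k1 \<in> GL2_int" "k2 \<in> GL2_int" "k3 \<in> GL2_int"
  shows "lattice_symbol (A ** k1) (B ** k2) (C ** k3) = lattice_symbol A B C"
  using assms std_lattice_mult_K[OF assms(4)]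
  by (simp add: lattice_symbol_def gcoset_K indicator_def flip: vector_matrix_mul_assoc)

lemma lattice_symbol_diag_act:
  assumes "h \<in> carrier GL2" "B \<in> carrier GL2" "C \<in> carrier GL2"
  shows "lattice_symbol (h ** A) (h ** B) (h ** C) = diag_act h (lattice_symbol A B C)"
  using assms by (simp add: lattice_symbol_def diag_act_tensor_gcoset vector_matrix_mul_assoc)

text \<open>\<open>h\<close> moves the triple and the factors in \<open>GL2_int\<close> change the
  bases of the three lattices. With \<open>B' = B\<close> and \<open>C' = C\<close> this is the
  action of the common stabiliser of two lattices on the third.\<close>

lemma lattice_symbol_cong:
  assumes GL: "h \<in> carrier GL2" "A \<in> carrier GL2" "B \<in> carrier GL2" "C \<in> carrier GL2"
      "A' \<in> carrier GL2" "B' \<in> carrier GL2" "C' \<in> carrier GL2"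
    and K: "k1 \<in> GL2_int" "k2 \<in> GL2_int" "k3 \<in> GL2_int"
    and eq: "h ** A = A' ** k1" "h ** B = B' ** k2" "h ** C = C' ** k3"
  shows "lattice_symbol A' B' C' - lattice_symbol A B C \<in> reducible"
    "lattice_symbol A B C - lattice_symbol A' B' C' \<in> reducible"
    "lattice_symbol A' B' C' \<in> reducible \<longleftrightarrow> lattice_symbol A B C \<in> reducible"
proof -
  have "lattice_symbol A' B' C' = diag_act h (lattice_symbol A B C)"
    using lattice_symbol_K[OF GL(5-7) K] lattice_symbol_diag_act[OF GL(1,3,4), of A] eq by simp
  then show "lattice_symbol A' B' C' - lattice_symbol A B C \<in> reducible"
    "lattice_symbol A B C - lattice_symbol A' B' C' \<in> reducible"
    using diag_act_diff_reducible[OF GL(1) lattice_symbol_in_schwartz_tensor[OF GL(2-4)]] by simp_all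
  then show "lattice_symbol A' B' C' \<in> reducible \<longleftrightarrow> lattice_symbol A B C \<in> reducible"
    by (intro reducible_cong)
qed

text \<open>
  For a lattice \<open>L\<close>, each vector of \<open>L\<close> outside \<open>pL\<close> lies in exactly one sublattice of index \<open>p\<close> of
  \<open>L\<close>, and each vector of \<open>pL\<close> lies in all \<open>p + 1\<close> of them.
\<close>

lemma neighbour_indicators:
  fixes y :: "'p::prime_card padic ^ 2"
  shows "(\<Sum>j<CARD('p). indicator std_lattice (y v* mat2 unif (of_nat j) 0 1)) + indicator std_lattice (y v* mat2 1 0 0 unif)
    = indicator std_lattice (y v* mat2 unif 0 0 unif) + of_nat CARD('p) * (indicator std_lattice y :: complex)"
proof -
  obtain a b where y: "y = vector [a, b]" by (rule vector2_cases)
  let ?p = "unif :: 'p padic"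
  have s: "(\<Sum>j<CARD('p). indicator std_lattice (y v* mat2 ?p (of_nat j) 0 1)) =
      (\<Sum>j<CARD('p). if a * ?p \<in> padic_int \<and> a * of_nat j + b \<in> padic_int then 1 else 0 :: complex)"
    by (intro sum.cong refl) (simp add: y vector_mat2 indicator_def)
  have t: "indicator std_lattice (y v* mat2 1 0 0 ?p) = (if a \<in> padic_int \<and> b * ?p \<in> padic_int then 1 else 0 :: complex)"
    "indicator std_lattice (y v* mat2 ?p 0 0 ?p) = (if a * ?p \<in> padic_int \<and> b * ?p \<in> padic_int then 1 else 0 :: complex)"
    "indicator std_lattice y = (if a \<in> padic_int \<and> b \<in> padic_int then 1 else 0 :: complex)"
    by (simp_all add: y vector_mat2 indicator_def)
  show ?thesis
  proof (cases "a \<in> padic_int")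
    case a: True
    then have "a * of_nat j \<in> padic_int" "a * ?p \<in> padic_int" for j by (auto simp only: padic_int_ring of_nat_padic_int)
    moreover have "b * ?p \<in> padic_int" if "b \<in> padic_int" using that by (auto simp only: padic_int_ring of_nat_padic_int)
    ultimately show ?thesis using a unfolding s t by simp
  next
    case a: False
    show ?thesis
    proof (cases "a * ?p \<in> padic_int")
      case ap: False
      then show ?thesis using a unfolding s t by simp
    next
      case ap: True
      have na: "a \<noteq> 0" using a by auto
      have n1: "padic_norm a > 1" using a by (simp add: padic_int_iff)
      have nlt: "\<not> padic_norm (a * ?p) < 1"
        using padic_norm_lt_1_divide[of "a * ?p"] a by (auto simp: padic_int_iff)
      \<comment> \<open>In this case |a| = p, so \<open>a * of_nat j + b\<close> is integral only
        for \<open>j\<close> the residue of -b/a. This \<open>j\<close> gives the single lattice of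
        the first kind that contains \<open>y\<close>.\<close>
      have key: "a * of_nat j + b \<in> padic_int \<longleftrightarrow> padic_norm (- b / a - of_nat j) < 1" for j
      proof -
        have eq: "a * of_nat j + b = - a * (- b / a - of_nat j)" using na by (simp add: field_simps)
        have p1: "1 < real CARD('p)" by (rule prime_card_gt_1)
        have "padic_norm (a * ?p) = 1" using nlt ap by (simp add: padic_int_iff)
        then have na': "padic_norm a = real CARD('p)" using p1 by (simp add: padic_norm_mult field_simps)
        have "padic_norm (a * of_nat j + b) = real CARD('p) * padic_norm (- b / a - of_nat j)"
          unfolding eq by (simp only: padic_norm_mult padic_norm_minus na')
        then show ?thesis
          unfolding padic_norm_lt_1_iff padic_int_iff using p1 by (simp add: pos_le_divide_eq mult.commute)
      qed
      have "(\<Sum>j<CARD('p). if a * ?p \<in> padic_int \<and> a * of_nat j + b \<in> padic_int then 1 else 0 :: complex)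
          = (if b * ?p \<in> padic_int then 1 else 0)"
      proof (cases "b * ?p \<in> padic_int")
        case True
        have "padic_norm (b * ?p) \<le> padic_norm (a * ?p)"
          using nlt True by (simp add: padic_int_iff)
        then have "padic_norm b \<le> padic_norm a"
          using prime_card_gt_1[where 'p='p] by (simp add: padic_norm_mult divide_le_cancel)
        then have "padic_norm (- b / a) \<le> 1"
          using n1 by (simp only: padic_norm_divide padic_norm_minus) (simp add: divide_le_eq)
        then obtain j where j: "j < CARD('p)" "padic_norm (- b / a - of_nat j) < 1" by (rule padic_residue)
        have uniq: "i = j" if i: "i < CARD('p)" "padic_norm (- b / a - of_nat i) < 1" for i
        proof (rule ccontr)
          assume "i \<noteq> j"
          have "padic_norm (of_nat i - of_nat j :: 'p padic) < 1"
            using padic_norm_diff_le[of "- b / a - of_nat j" "- b / a - of_nat i"] i j by simp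
          moreover have "padic_norm (of_nat i - of_nat j :: 'p padic) = 1"
          proof (cases "i < j")
            case True
            then have "\<not> CARD('p) dvd j - i" using j by (simp add: nat_dvd_not_less)
            then show ?thesis
              using True padic_norm_of_nat_eq_1[of "j - i", where 'p='p] by (simp add: of_nat_diff padic_norm_diff_commute)
          next
            case False
            then have "\<not> CARD('p) dvd i - j" using i \<open>i \<noteq> j\<close> by (simp add: nat_dvd_not_less)
            then show ?thesis using False padic_norm_of_nat_eq_1[of "i - j", where 'p='p] by (simp add: of_nat_diff)
          qed
          ultimately show False by simp
        qed
        have "(\<Sum>j<CARD('p). if a * ?p \<in> padic_int \<and> a * of_nat j + b \<in> padic_int then 1 else 0 :: complex)
            = (\<Sum>i<CARD('p). if i = j then 1 else 0)"
        proof (rule sum.cong[OF refl])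
          fix i assume "i \<in> {..<CARD('p)}"
          then have "a * of_nat i + b \<in> padic_int \<longleftrightarrow> i = j" using j uniq[of i] unfolding key by blast
          then show "(if a * ?p \<in> padic_int \<and> a * of_nat i + b \<in> padic_int then 1 else 0 :: complex) = (if i = j then 1 else 0)"
            using ap by simp
        qed
        then show ?thesis using True j by simp
      next
        case False
        have "a * of_nat j + b \<notin> padic_int" for j
        proof
          assume "a * of_nat j + b \<in> padic_int"
          then have "(a * of_nat j + b) * ?p \<in> padic_int" by (auto simp only: padic_int_ring of_nat_padic_int)
          then have "b * ?p + (a * ?p) * of_nat j \<in> padic_int" by (simp add: algebra_simps)
          moreover have "(a * ?p) * of_nat j \<in> padic_int" using ap by (auto simp only: padic_int_ring of_nat_padic_int)
          ultimately show False using False by simp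
        qed
        then show ?thesis using False by simp
      qed
      then show ?thesis using a ap unfolding s t by simp
    qed
  qed
qed

lemma neighbour_relation:
  fixes g :: "'p::prime_card padic ^ 2 ^ 2"
  shows "(\<Sum>j<CARD('p). lattice_symbol (g ** mat2 unif (of_nat j) 0 1) B C) + lattice_symbol (g ** mat2 1 0 0 unif) B C
    = lattice_symbol (g ** mat2 unif 0 0 unif) B C + cscale (of_nat CARD('p)) (lattice_symbol g B C)"
proof
  fix z :: "('p padic ^ 2) \<times> 'p GG"
  obtain x y where z: "z = (x, y)" by (cases z)
  show "((\<Sum>j<CARD('p). lattice_symbol (g ** mat2 unif (of_nat j) 0 1) B C) + lattice_symbol (g ** mat2 1 0 0 unif) B C) z
    = (lattice_symbol (g ** mat2 unif 0 0 unif) B C + cscale (of_nat CARD('p)) (lattice_symbol g B C)) z"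
    using arg_cong[OF neighbour_indicators[of "x v* g"], of "\<lambda>w. w * indicator (gcoset (B, C)) y"]
    by (simp add: z lattice_symbol_def tensor_def sum_fun_apply cscale_def sum_distrib_right distrib_right vector_matrix_mul_assoc)
qed

text \<open>One step outwards in the tree: in the applications the neighbours not yet known are
  moved to one another by the stabiliser of \<open>B\<close> and \<open>C\<close>, and
  \<open>F\<close> represents their common class.\<close>

lemma reducible_by_neighbours:
  fixes g :: "'p::prime_card padic ^ 2 ^ 2"
  assumes j: "\<And>j. j < CARD('p) \<Longrightarrow> lattice_symbol (g ** mat2 unif (of_nat j) 0 1) B C \<in> reducible \<or>
      lattice_symbol (g ** mat2 unif (of_nat j) 0 1) B C - F \<in> reducible"
    and inf: "lattice_symbol (g ** mat2 1 0 0 unif) B C \<in> reducible \<or> lattice_symbol (g ** mat2 1 0 0 unif) B C - F \<in> reducible"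
    and ex: "\<exists>j<CARD('p). lattice_symbol (g ** mat2 unif (of_nat j) 0 1) B C - F \<in> reducible"
    and g: "lattice_symbol (g ** mat2 unif 0 0 unif) B C \<in> reducible" "lattice_symbol g B C \<in> reducible"
  shows "F \<in> reducible"
proof -
  define f where "f i = (if i < CARD('p) then lattice_symbol (g ** mat2 unif (of_nat i) 0 1) B C
    else lattice_symbol (g ** mat2 1 0 0 unif) B C)" for i
  have "(\<Sum>i\<in>{..<Suc CARD('p)}. f i) = lattice_symbol (g ** mat2 unif 0 0 unif) B C + cscale (of_nat CARD('p)) (lattice_symbol g B C)"
    using neighbour_relation[of g B C] by (simp add: f_def)
  also have "\<dots> \<in> reducible" using g by (intro reducible_add reducible_scale)
  finally show ?thesis
    by (rule reducible_of_sum[rotated]) (use j inf ex in \<open>auto simp: f_def intro: less_SucI\<close>)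
qed

lemma swap_in_GL2_int: "mat2 0 1 1 0 \<in> (GL2_int :: ('p::prime_card padic ^ 2 ^ 2) set)"
  by (simp add: mat2_in_GL2_int padic_norm_minus)

text \<open>The same step towards the other end of the apartment. Swapping the basis vectors of
  \<open>g\<close> leaves its lattice alone but singles out the opposite neighbour on the apartment
  in the list of all \<open>p + 1\<close>.\<close>

lemma reducible_by_lower_neighbours:
  fixes g :: "'p::prime_card padic ^ 2 ^ 2"
  assumes GL: "g \<in> carrier GL2" "B \<in> carrier GL2" "C \<in> carrier GL2"
    and j: "\<And>j. j < CARD('p) \<Longrightarrow> lattice_symbol (g ** mat2 1 0 (of_nat j) unif) B C - F \<in> reducible"
    and inf: "lattice_symbol (g ** mat2 unif 0 0 1) B C \<in> reducible"
    and g: "lattice_symbol (g ** mat2 unif 0 0 unif) B C \<in> reducible" "lattice_symbol g B C \<in> reducible"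
  shows "F \<in> reducible"
proof -
  let ?w = "mat2 0 1 1 0 :: 'p padic ^ 2 ^ 2"
  have one: "mat 1 \<in> (GL2_int :: ('p padic ^ 2 ^ 2) set)" by (simp add: mat2_one mat2_in_GL2_int)
  have eq: "lattice_symbol (g ** ?w ** N) B C = lattice_symbol (g ** (?w ** N ** ?w)) B C" if "N \<in> carrier GL2" for N
  proof -
    have "?w \<in> carrier GL2" by (simp add: mat2_in_GL2)
    then have "g ** ?w ** N \<in> carrier GL2" using GL(1) that by simp
    from lattice_symbol_K[OF this GL(2,3) swap_in_GL2_int one one] show ?thesis
      by (simp add: matrix_mul_assoc)
  qed
  have mem: "mat2 unif (of_nat j) 0 1 \<in> carrier (GL2 :: ('p padic ^ 2 ^ 2) monoid)"
    "mat2 1 0 0 unif \<in> carrier (GL2 :: ('p padic ^ 2 ^ 2) monoid)"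
    "mat2 unif 0 0 unif \<in> carrier (GL2 :: ('p padic ^ 2 ^ 2) monoid)" for j
    by (simp_all add: mat2_in_GL2)
  have "lattice_symbol (g ** ?w) B C = lattice_symbol g B C"
    using lattice_symbol_K[OF GL swap_in_GL2_int one one] by simp
  then show ?thesis
    using j inf g zero_less_card_finite[where 'a='p]
    by (intro reducible_by_neighbours[of "g ** ?w" B C F])
      (auto simp: eq[OF mem(1)] eq[OF mem(2)] eq[OF mem(3)] intro!: exI[of _ 0] simp del: of_nat_0)
qed


section \<open>Every lattice triple is reducible\<close>

lemma unif_powi_add: "unif powi (a + b) = (unif powi a * unif powi b :: 'p::prime_card padic)"
  by (simp add: power_int_add)

lemma unif_powi_diff: "unif powi (a - b) = (unif powi a / unif powi b :: 'p::prime_card padic)"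
  by (simp add: power_int_diff)

lemmas unif_powi_simps = unif_powi_add unif_powi_diff power_int_minus

lemma padic_norm_unif_powi: "padic_norm (unif powi k :: 'p::prime_card padic) = real CARD('p) powi (- k)"
  by (simp add: padic_norm_powi power_int_one_over power_int_minus inverse_eq_divide)

lemma unif_powi_padic_int: "(unif powi k :: 'p::prime_card padic) \<in> padic_int \<longleftrightarrow> 0 \<le> k"
  using powi_le_cancel_iff[OF prime_card_gt_1[where 'p='p], of "- k" 0]
  by (simp add: padic_int_iff padic_norm_unif_powi)

text \<open>The lattice with basis p^(y+c) e1 and p^y (t e1 + e2). Its vertex in the tree
  corresponds to the ball t + p^c Z_p, and \<open>y\<close> records the scale.\<close>

definition upper_mat :: "int \<Rightarrow> int \<Rightarrow> 'p::prime_card padic \<Rightarrow> 'p padic ^ 2 ^ 2" where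
  "upper_mat y c t = mat2 (unif powi (y + c)) (unif powi y * t) 0 (unif powi y)"

text \<open>For \<open>n\<close> nonnegative, a lattice at distance \<open>n\<close> from the
  standard one. The sign of the exponent makes \<open>upper_mat y c 0\<close> with \<open>c\<close>
  between \<open>- n\<close> and 0 the vertices of the geodesic. The scalar \<open>s\<close> need
  not be a power of p.\<close>

definition geo_mat :: "int \<Rightarrow> 'p::prime_card padic \<Rightarrow> 'p padic ^ 2 ^ 2" where
  "geo_mat n s = mat2 (s * unif powi (- n)) 0 0 s"

lemma upper_mat_GL2 [simp]: "upper_mat y c t \<in> carrier GL2"
  by (simp add: upper_mat_def mat2_in_GL2)

lemma geo_mat_GL2: "s \<noteq> 0 \<Longrightarrow> geo_mat n s \<in> carrier GL2"
  by (simp add: geo_mat_def mat2_in_GL2)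

lemma one_GL2_int [simp]: "mat 1 \<in> GL2_int"
  using K.one_closed by simp

lemma mat1_GL2 [simp]: "mat 1 \<in> carrier (GL2 :: ('p::prime_card padic ^ 2 ^ 2) monoid)"
  using GL.one_closed by simp

lemma upper_unipotent_GL2_int: "mat2 1 x 0 1 \<in> GL2_int \<longleftrightarrow> x \<in> padic_int"
  by (simp add: mat2_in_GL2_int)

lemma lower_unipotent_GL2_int: "mat2 1 0 x 1 \<in> GL2_int \<longleftrightarrow> x \<in> padic_int"
  by (simp add: mat2_in_GL2_int)

section \<open>The Iwasawa and Cartan decompositions\<close>

lemma iwasawa:
  assumes "A \<in> carrier (GL2 :: ('p::prime_card padic ^ 2 ^ 2) monoid)"
  obtains y c t k where "k \<in> GL2_int" "A = upper_mat y c t ** k"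
proof -
  obtain a b c d where A: "A = mat2 a b c d" by (rule mat2_cases)
  have tri: "\<exists>y c t k. k \<in> GL2_int \<and> mat2 a b 0 d = upper_mat y c t ** k"
    if ad: "a \<noteq> 0" "d \<noteq> 0" for a b d :: "'p padic"
  proof -
    obtain l u where u: "a = unif powi l * u" "padic_norm u = 1" by (rule padic_unit_decomp[OF ad(1)])
    obtain m v where v: "d = unif powi m * v" "padic_norm v = 1" by (rule padic_unit_decomp[OF ad(2)])
    have nz: "u \<noteq> 0" "v \<noteq> 0" using u v by auto
    have "mat2 u 0 0 v \<in> GL2_int" using u v by (simp add: mat2_in_GL2_int padic_norm_mult padic_int_iff)
    moreover have "mat2 a b 0 d = upper_mat m (l - m) (b / (v * unif powi m)) ** mat2 u 0 0 v"
      using nz by (simp add: upper_mat_def u(1) v(1))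
    ultimately show ?thesis by blast
  qed
  \<comment> \<open>Only integral column operations are available. If \<open>c\<close> has norm at
    most that of \<open>d\<close>, it is cleared by the second column; otherwise the columns are
    swapped first.\<close>
  have red: "\<exists>y c' t k. k \<in> GL2_int \<and> mat2 a b c d = upper_mat y c' t ** k"
    if cd: "padic_norm c \<le> padic_norm d" and det: "a * d - b * c \<noteq> 0" for a b c d :: "'p padic"
  proof -
    have d: "d \<noteq> 0" using cd det padic_norm_nonneg[of c] by (auto simp: padic_norm_eq_0)
    have pd: "padic_norm d > 0" using d padic_norm_nonneg[of d] by (simp add: less_le padic_norm_eq_0)
    let ?k = "mat2 1 0 (c / d) 1 :: 'p padic ^ 2 ^ 2"
    have k: "?k \<in> GL2_int"
      using cd pd by (simp add: lower_unipotent_GL2_int padic_int_iff padic_norm_divide)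
    have "a - b * c / d \<noteq> 0" using det d by (simp add: field_simps)
    then obtain y c' t k' where k': "k' \<in> GL2_int" "mat2 (a - b * c / d) b 0 d = upper_mat y c' t ** k'"
      using tri d by blast
    have "mat2 a b c d = mat2 (a - b * c / d) b 0 d ** ?k" using d by simp
    also have "\<dots> = upper_mat y c' t ** (k' ** ?k)" by (simp only: k'(2) matrix_mul_assoc)
    finally show ?thesis using K.m_closed[OF k'(1) k] by auto
  qed
  have det: "a * d - b * c \<noteq> 0" using assms by (simp add: A mat2_in_GL2)
  show ?thesis
  proof (cases "padic_norm c \<le> padic_norm d")
    case True
    then show ?thesis using red[OF True det] that A by blast
  next
    case False
    have "b * c - a * d \<noteq> 0" using det by (simp add: algebra_simps)
    then obtain y c' t k where k: "k \<in> GL2_int" "mat2 b a d c = upper_mat y c' t ** k"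
      using red[of d c b a] False by auto
    have "A = mat2 b a d c ** mat2 0 1 1 0" by (simp add: A)
    also have "\<dots> = upper_mat y c' t ** (k ** mat2 0 1 1 0)" by (simp only: k(2) matrix_mul_assoc)
    finally show ?thesis using that K.m_closed[OF k(1) swap_in_GL2_int] by simp
  qed
qed

text \<open>An entry of largest norm, brought to the upper left corner by swaps, clears its row and
  column with integral factors. The other diagonal entry then has no larger norm, which gives
  \<open>0 \<le> n\<close>.\<close>

lemma cartan:
  assumes "M \<in> carrier (GL2 :: ('p::prime_card padic ^ 2 ^ 2) monoid)"
  obtains k1 k2 n s where "k1 \<in> GL2_int" "k2 \<in> GL2_int" "0 \<le> n" "s \<noteq> 0" "M = k1 ** geo_mat n s ** k2"
proof -
  let ?P = "\<lambda>M :: 'p padic ^ 2 ^ 2. \<exists>k1 k2 n s. k1 \<in> GL2_int \<and> k2 \<in> GL2_int \<and> 0 \<le> n \<and> s \<noteq> 0 \<and> M = k1 ** geo_mat n s ** k2"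
  have main: "?P (mat2 a b c d)"
    if le: "padic_norm b \<le> padic_norm a" "padic_norm c \<le> padic_norm a" "padic_norm d \<le> padic_norm a"
      and det: "a * d - b * c \<noteq> 0" for a b c d :: "'p padic"
  proof -
    have a: "a \<noteq> 0" using le det padic_norm_nonneg[of b] padic_norm_nonneg[of c] by (auto simp: padic_norm_eq_0)
    have pa: "padic_norm a > 0" using a padic_norm_nonneg[of a] by (simp add: less_le padic_norm_eq_0)
    define D where "D = d - b / a * c"
    have D: "D \<noteq> 0" using det a by (simp add: D_def field_simps)
    have i: "b / a \<in> padic_int" "c / a \<in> padic_int" using le pa by (simp_all add: padic_int_iff padic_norm_divide)
    have "padic_norm (b / a) * padic_norm c \<le> 1 * padic_norm a"
      using i(1) le(2) unfolding padic_int_iff by (intro mult_mono) (simp_all add: padic_norm_nonneg)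
    then have "padic_norm (b / a * c) \<le> padic_norm a" by (simp only: padic_norm_mult mult_1)
    then have Da: "padic_norm D \<le> padic_norm a"
      using padic_norm_diff_le[of d "b / a * c"] le(3) by (simp add: D_def)
    obtain l u where u: "a = unif powi l * u" "padic_norm u = 1" using padic_unit_decomp[OF a] .
    obtain m v where v: "D = unif powi m * v" "padic_norm v = 1" using padic_unit_decomp[OF D] .
    have "0 \<le> m - l"
      using Da powi_le_cancel_iff[OF prime_card_gt_1[where 'p='p], of "- m" "- l"]
      by (simp add: u(1) v(1) padic_norm_mult u(2) v(2) padic_norm_unif_powi)
    moreover have "mat2 a b c d = mat2 1 0 (c / a) 1 ** mat2 a 0 0 D ** mat2 1 (b / a) 0 1"
      using a by (simp add: D_def field_simps)
    moreover have "mat2 a 0 0 D = geo_mat (m - l) (unif powi m) ** mat2 u 0 0 v"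
      by (simp add: geo_mat_def u(1) v(1) unif_powi_diff)
    ultimately have "mat2 a b c d = mat2 1 0 (c / a) 1 ** geo_mat (m - l) (unif powi m) ** (mat2 u 0 0 v ** mat2 1 (b / a) 0 1)"
      by (simp only: matrix_mul_assoc)
    moreover have "mat2 u 0 0 v ** mat2 1 (b / a) 0 1 \<in> GL2_int"
      using u v i K.m_closed[of "mat2 u 0 0 v" "mat2 1 (b / a) 0 1"]
      by (simp add: mat2_in_GL2_int padic_norm_mult padic_int_iff)
    moreover have "mat2 1 0 (c / a) 1 \<in> GL2_int" using i by (simp add: lower_unipotent_GL2_int)
    moreover have "unif powi m \<noteq> (0 :: 'p padic)" by simp
    ultimately show ?thesis using \<open>0 \<le> m - l\<close> by blast
  qed
  let ?w = "mat2 0 1 1 0 :: 'p padic ^ 2 ^ 2"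
  have left: "?P M" if P: "?P (?w ** M)" for M
  proof -
    from P obtain k1 k2 n s where k: "k1 \<in> GL2_int" "k2 \<in> GL2_int" "0 \<le> n" "s \<noteq> 0" "?w ** M = k1 ** geo_mat n s ** k2"
      by blast
    have "?w ** ?w = mat 1" by (simp add: mat2_one)
    then have "M = ?w ** (?w ** M)" by (simp add: matrix_mul_assoc)
    also have "\<dots> = (?w ** k1) ** geo_mat n s ** k2" by (simp only: k(5) matrix_mul_assoc)
    finally show ?thesis using k K.m_closed[OF swap_in_GL2_int k(1)] by auto
  qed
  have right: "?P M" if P: "?P (M ** ?w)" for M
  proof -
    from P obtain k1 k2 n s where k: "k1 \<in> GL2_int" "k2 \<in> GL2_int" "0 \<le> n" "s \<noteq> 0" "M ** ?w = k1 ** geo_mat n s ** k2"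
      by blast
    have "?w ** ?w = mat 1" by (simp add: mat2_one)
    then have "M = (M ** ?w) ** ?w" by (simp add: matrix_mul_assoc[symmetric])
    also have "\<dots> = k1 ** geo_mat n s ** (k2 ** ?w)" by (simp only: k(5) matrix_mul_assoc)
    finally show ?thesis using k K.m_closed[OF k(2) swap_in_GL2_int] by auto
  qed
  obtain a b c d where M: "M = mat2 a b c d" by (rule mat2_cases)
  have det: "a * d - b * c \<noteq> 0" using assms by (simp add: M mat2_in_GL2)
  define \<mu> where "\<mu> = max (max (padic_norm a) (padic_norm b)) (max (padic_norm c) (padic_norm d))"
  have le: "padic_norm a \<le> \<mu>" "padic_norm b \<le> \<mu>" "padic_norm c \<le> \<mu>" "padic_norm d \<le> \<mu>" by (simp_all add: \<mu>_def)
  consider "padic_norm a = \<mu>" | "padic_norm b = \<mu>" | "padic_norm c = \<mu>" | "padic_norm d = \<mu>"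
  proof -
    have "\<mu> \<in> {padic_norm a, padic_norm b, padic_norm c, padic_norm d}" by (simp add: \<mu>_def max_def)
    then show ?thesis using that by auto
  qed
  then have "?P M"
  proof cases
    case 1
    have "padic_norm b \<le> padic_norm a" "padic_norm c \<le> padic_norm a" "padic_norm d \<le> padic_norm a"
      unfolding 1 by (rule le)+
    from main[OF this det] show ?thesis unfolding M .
  next
    case 2
    have "padic_norm a \<le> padic_norm b" "padic_norm d \<le> padic_norm b" "padic_norm c \<le> padic_norm b"
      unfolding 2 by (rule le)+
    moreover have "b * c - a * d \<noteq> 0" using det by (simp add: algebra_simps)
    ultimately have "?P (mat2 b a d c)" by (rule main)
    also have "mat2 b a d c = M ** ?w" by (simp add: M)
    finally show ?thesis by (rule right)
  next
    case 3
    have "padic_norm d \<le> padic_norm c" "padic_norm a \<le> padic_norm c" "padic_norm b \<le> padic_norm c"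
      unfolding 3 by (rule le)+
    moreover have "c * b - d * a \<noteq> 0" using det by (simp add: algebra_simps)
    ultimately have "?P (mat2 c d a b)" by (rule main)
    also have "mat2 c d a b = ?w ** M" by (simp add: M)
    finally show ?thesis by (rule left)
  next
    case 4
    have "padic_norm c \<le> padic_norm d" "padic_norm b \<le> padic_norm d" "padic_norm a \<le> padic_norm d"
      unfolding 4 by (rule le)+
    moreover have "d * a - c * b \<noteq> 0" using det by (simp add: algebra_simps)
    ultimately have "?P (mat2 d c b a)" by (rule main)
    also have "mat2 d c b a = ?w ** M ** ?w" by (simp add: M)
    finally have "?P (?w ** M ** ?w)" .
    from left[OF right[OF this]] show ?thesis .
  qed
  then show ?thesis using that by blast
qed

text \<open>
  \<open>p\<^sup>n \<bar>det M\<bar>\<close> is the square of the norm of the largest entry of \<open>geo_mat n s\<close>, and multiplication by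
  \<open>k1\<close>, \<open>k2\<close> preserves the largest norm.
\<close>

lemma cartan_bound:
  assumes k: "k1 \<in> GL2_int" "k2 \<in> GL2_int" and M: "M = k1 ** geo_mat n s ** k2"
    and \<mu>: "\<And>i j. padic_norm (M $ i $ j) \<le> \<mu>"
  shows "real CARD('p) powi n * padic_norm (det M) \<le> (\<mu> :: real)\<^sup>2" and "padic_norm (det M) = (padic_norm (s :: 'p::prime_card padic))\<^sup>2 * real CARD('p) powi n"
proof -
  have det: "padic_norm (det k1) = 1" "padic_norm (det k2) = 1" using k by (simp_all add: GL2_int_iff)
  show D: "padic_norm (det M) = (padic_norm s)\<^sup>2 * real CARD('p) powi n"
    by (simp add: M det_mul padic_norm_mult det geo_mat_def padic_norm_unif_powi power2_eq_square)
  have mult: "padic_norm (x * y) \<le> \<mu>" if "x \<in> padic_int" "padic_norm y \<le> \<mu>" for x y :: "'p padic"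
    using that mult_mono[of "padic_norm x" 1 "padic_norm y" \<mu>] padic_norm_nonneg[of x] padic_norm_nonneg[of y]
    by (simp add: padic_norm_mult padic_int_iff)
  have add: "padic_norm (x + y) \<le> \<mu>" if "padic_norm x \<le> \<mu>" "padic_norm y \<le> \<mu>" for x y :: "'p padic"
    using that padic_norm_add_le[of x y] by simp
  have L: "padic_norm ((k ** N) $ i $ j) \<le> \<mu>" if "k \<in> GL2_int" "\<And>i j. padic_norm (N $ i $ j) \<le> \<mu>" for k N :: "'p padic ^ 2 ^ 2" and i j
    using that by (simp add: matrix_matrix_mult_def sum_2 GL2_int_iff add mult)
  have R: "padic_norm ((N ** k) $ i $ j) \<le> \<mu>" if "k \<in> GL2_int" "\<And>i j. padic_norm (N $ i $ j) \<le> \<mu>" for k N :: "'p padic ^ 2 ^ 2" and i j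
  proof -
    have "(N ** k) $ i $ j = k $ 1 $ j * N $ i $ 1 + k $ 2 $ j * N $ i $ 2"
      by (simp add: matrix_matrix_mult_def sum_2 mult.commute)
    also have "padic_norm \<dots> \<le> \<mu>" using that by (intro add mult) (simp_all add: GL2_int_iff)
    finally show ?thesis .
  qed
  have "inv\<^bsub>GL2\<^esub> k1 ** M ** inv\<^bsub>GL2\<^esub> k2 = (inv\<^bsub>GL2\<^esub> k1 ** k1) ** geo_mat n s ** (k2 ** inv\<^bsub>GL2\<^esub> k2)"
    by (simp only: M matrix_mul_assoc)
  also have "\<dots> = geo_mat n s" using k K.mem_carrier by (simp add: inv_GL2)
  finally have G: "geo_mat n s = inv\<^bsub>GL2\<^esub> k1 ** M ** inv\<^bsub>GL2\<^esub> k2" by simp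
  have "padic_norm (geo_mat n s $ 1 $ 1) \<le> \<mu>"
    unfolding G using k \<mu> by (intro R L K.m_inv_closed)
  then have "padic_norm s * real CARD('p) powi n \<le> \<mu>"
    by (simp add: geo_mat_def padic_norm_mult padic_norm_unif_powi)
  then have "(padic_norm s * real CARD('p) powi n)\<^sup>2 \<le> \<mu>\<^sup>2"
    by (intro power_mono) (auto simp: padic_norm_nonneg)
  then show "real CARD('p) powi n * padic_norm (det M) \<le> \<mu>\<^sup>2"
    by (simp add: D power2_eq_square mult_ac)
qed

section \<open>Reduction of the first lattice to the geodesic\<close>

context
  fixes n :: int and s :: "'p::prime_card padic"
  assumes n: "0 \<le> n" and s: "s \<noteq> 0"
begin

private abbreviation "G A \<equiv> lattice_symbol A (mat 1) (geo_mat n s)"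

text \<open>\<open>t\<close> matters only modulo p^c, as the centre of a ball.\<close>

lemma upper_mat_shift_mod:
  assumes "x \<in> padic_int"
  shows "G (upper_mat y c (t + unif powi c * x)) = G (upper_mat y c t)"
proof -
  have "upper_mat y c (t + unif powi c * x) = upper_mat y c t ** mat2 1 x 0 1"
    by (simp add: upper_mat_def unif_powi_add algebra_simps)
  then show ?thesis
    using lattice_symbol_K[of "upper_mat y c t" "mat 1" "geo_mat n s" "mat2 1 x 0 1" "mat 1" "mat 1"]
      assms geo_mat_GL2[OF s] by (simp add: upper_unipotent_GL2_int)
qed

text \<open>Integral upper unipotents fix both remaining lattices: conjugation by
  \<open>geo_mat n s\<close> multiplies the corner entry by p^n, and \<open>n\<close> is
  nonnegative.\<close>

lemma upper_mat_shift:
  assumes x: "x \<in> padic_int"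
  shows "G (upper_mat y c (t + x)) - G (upper_mat y c t) \<in> reducible"
proof (rule lattice_symbol_cong(1)[where h = "mat2 1 x 0 1" and ?k1.0 = "mat 1" and ?k2.0 = "mat2 1 x 0 1" and ?k3.0 = "mat2 1 (x * unif powi n) 0 1"])
  have "unif powi n \<in> (padic_int :: 'p padic set)" using n by (simp add: unif_powi_padic_int)
  then show "mat2 1 (x * unif powi n) 0 1 \<in> GL2_int" using x by (simp add: upper_unipotent_GL2_int)
qed (use x s in \<open>simp_all add: upper_mat_def geo_mat_GL2 upper_unipotent_GL2_int mat2_in_GL2 mat2_one geo_mat_def power_int_minus algebra_simps\<close>)

text \<open>The diagonal matrix with entries \<open>u\<close> and 1 commutes with
  \<open>geo_mat n s\<close>, so it fixes both lattices while it multiplies the centre of the ball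
  by \<open>u\<close>.\<close>

lemma upper_mat_unit:
  assumes u: "padic_norm u = 1"
  shows "G (upper_mat y c (u * t)) - G (upper_mat y c t) \<in> reducible"
proof -
  have "mat2 u 0 0 1 \<in> GL2_int" "u \<noteq> 0" using u by (auto simp: mat2_in_GL2_int padic_int_iff)
  then show ?thesis
    by (intro lattice_symbol_cong(1)[where h = "mat2 u 0 0 1" and ?k1.0 = "mat2 u 0 0 1" and ?k2.0 = "mat2 u 0 0 1" and ?k3.0 = "mat2 u 0 0 1"])
      (use s in \<open>simp_all add: upper_mat_def geo_mat_GL2 mat2_in_GL2 mat2_one geo_mat_def mult_ac\<close>)
qed

text \<open>Lower unipotents fix both lattices if their corner entry is divisible by p^n. From the
  far end of the geodesic onwards, where \<open>c \<le> - n\<close>, these suffice to identify all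
  outward neighbours.\<close>

lemma upper_mat_lower_neighbour:
  assumes c: "c \<le> - n"
  shows "G (upper_mat y c 0 ** mat2 1 0 (of_nat j) unif) - G (upper_mat (y + 1) (c - 1) 0) \<in> reducible"
proof (rule lattice_symbol_cong(1)[where h = "mat2 1 0 (of_nat j * unif powi (- c)) 1" and ?k1.0 = "mat 1"
      and ?k2.0 = "mat2 1 0 (of_nat j * unif powi (- c)) 1" and ?k3.0 = "mat2 1 0 (of_nat j * unif powi (- c - n)) 1"])
  have "unif powi (- c) \<in> (padic_int :: 'p padic set)" "unif powi (- c - n) \<in> (padic_int :: 'p padic set)"
    using c n unfolding unif_powi_padic_int by simp_all
  then show "mat2 1 0 (of_nat j * unif powi (- c)) 1 \<in> (GL2_int :: ('p padic ^ 2 ^ 2) set)"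
    "mat2 1 0 (of_nat j * unif powi (- c - n)) 1 \<in> (GL2_int :: ('p padic ^ 2 ^ 2) set)"
    by (simp_all add: lower_unipotent_GL2_int del: diff_minus_eq_add minus_diff_eq)
qed (use s in \<open>simp_all add: upper_mat_def geo_mat_GL2 mat2_in_GL2 mat2_one geo_mat_def unif_powi_simps field_simps upper_unipotent_GL2_int\<close>)

text \<open>For \<open>n = 0\<close> the two fixed lattices are homothetic, so all of
  \<open>GL2_int\<close> fixes both, and the swap reverses the apartment.\<close>

lemma upper_mat_swap:
  assumes "n = 0"
  shows "G (upper_mat (y + c) (- c) 0) - G (upper_mat y c 0) \<in> reducible"
  by (rule lattice_symbol_cong(1)[where h = "mat2 0 1 1 0" and ?k1.0 = "mat2 0 1 1 0" and ?k2.0 = "mat2 0 1 1 0" and ?k3.0 = "mat2 0 1 1 0"])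
    (use s assms in \<open>simp_all add: upper_mat_def geo_mat_GL2 mat2_in_GL2 mat2_one geo_mat_def swap_in_GL2_int\<close>)

text \<open>In terms of balls, the first line lists the \<open>p\<close> maximal balls inside t +
  p^c Z_p and the second gives the next larger ball.\<close>

lemma upper_mat_neighbours:
  "upper_mat y c t ** mat2 unif (of_nat j) 0 1 = upper_mat y (c + 1) (t + unif powi c * of_nat j)"
  "upper_mat y c t ** mat2 1 0 0 unif = upper_mat (y + 1) (c - 1) t"
  "upper_mat y c t ** mat2 unif 0 0 unif = upper_mat (y + 1) c t"
  "upper_mat y c t ** mat2 unif 0 0 1 = upper_mat y (c + 1) (t :: 'p padic)"
  by (simp_all add: upper_mat_def unif_powi_simps algebra_simps)

text \<open>A walk along the apartment beyond both ends of the geodesic. The relation at a vertex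
  expresses its outward neighbours by that vertex at two scales and the preceding vertex, so the
  inductions carry two consecutive values of \<open>c\<close> and all \<open>y\<close>.\<close>

lemma diagonal_reducible:
  assumes geo: "\<And>y c. - n \<le> c \<Longrightarrow> c \<le> 0 \<Longrightarrow> G (upper_mat y c 0) \<in> reducible"
  shows "G (upper_mat y c 0) \<in> reducible"
proof -
  have p0: "0 < CARD('p)" by simp
  have up1: "G (upper_mat y (c + 1) (0 + unif powi c * of_nat j)) - G (upper_mat y (c + 1) 0) \<in> reducible" if "0 \<le> c" for y c j
  proof (rule upper_mat_shift)
    have "unif powi c \<in> (padic_int :: 'p padic set)" using that by (simp add: unif_powi_padic_int)
    then show "unif powi c * of_nat j \<in> (padic_int :: 'p padic set)" by simp
  qed
  \<comment> \<open>The upward walk starts from c = 0 and c = -1. For \<open>n = 0\<close> the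
    geodesic is one vertex and c = -1 lies outside it; then all \<open>p + 1\<close> neighbours are
    congruent, and a single relation settles them.\<close>
  have minus1: "G (upper_mat y (- 1) 0) \<in> reducible" for y
  proof (cases "n = 0")
    case False
    then show ?thesis using n by (intro geo) auto
  next
    case True
    have sw: "G (upper_mat (y + 1) (- 1) 0) - G (upper_mat y 1 0) \<in> reducible" for y
      using upper_mat_swap[OF True, of y 1] by simp
    have "G (upper_mat y 1 0) \<in> reducible" for y
    proof (rule reducible_by_neighbours[of "upper_mat y 0 0" "mat 1" "geo_mat n s"], goal_cases)
      case (1 j)
      then show ?case using up1[of 0 y j] by (simp add: upper_mat_neighbours)
    next
      case 2
      then show ?case using sw[of y] by (simp add: upper_mat_neighbours)
    next
      case 3
      then show ?case using up1[of 0 y 0] p0 by (auto simp: upper_mat_neighbours intro!: exI[of _ 0])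
    qed (use n in \<open>simp_all add: upper_mat_neighbours geo\<close>)
    then show ?thesis using sw[of "y - 1"] reducible_cong by auto
  qed
  have up: "\<forall>y. G (upper_mat y (int m) 0) \<in> reducible \<and> G (upper_mat y (int m - 1) 0) \<in> reducible" for m
  proof (induction m)
    case 0
    then show ?case using minus1 geo n by simp
  next
    case (Suc m)
    have "G (upper_mat y (int m + 1) 0) \<in> reducible" for y
    proof (rule reducible_by_neighbours[of "upper_mat y (int m) 0" "mat 1" "geo_mat n s"], goal_cases)
      case (1 j)
      then show ?case using up1[of "int m" y j] by (simp only: upper_mat_neighbours) simp
    next
      case 3
      then show ?case using up1[of "int m" y 0] p0 by (auto simp: upper_mat_neighbours intro!: exI[of _ 0])
    qed (use Suc in \<open>simp_all add: upper_mat_neighbours\<close>)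
    then show ?case using Suc by (simp add: add.commute)
  qed
  have down: "\<forall>y. G (upper_mat y (- n - int m) 0) \<in> reducible \<and> G (upper_mat y (- n - int m + 1) 0) \<in> reducible" for m
  proof (induction m)
    case 0
    show ?case
    proof (cases "n = 0")
      case True
      \<comment> \<open>For \<open>n = 0\<close> the vertex c = 1 is off the geodesic, so this start
        of the downward walk comes from the upward one.\<close>
      then show ?thesis using up[of 1] by simp
    next
      case False
      then show ?thesis using n by (auto intro!: geo)
    qed
  next
    case (Suc m)
    have "G (upper_mat (y + 1) (- n - int m - 1) 0) \<in> reducible" for y
      by (rule reducible_by_lower_neighbours[of "upper_mat y (- n - int m) 0" "mat 1" "geo_mat n s"])
        (use Suc in \<open>simp_all add: upper_mat_neighbours geo_mat_GL2[OF s] upper_mat_lower_neighbour\<close>)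
    from this[of "_ - 1"] show ?case using Suc by (simp add: algebra_simps)
  qed
  show ?thesis
  proof (cases "c \<ge> 0")
    case True
    then show ?thesis using up[of "nat c"] by simp
  next
    case False
    then show ?thesis using geo[of c y] down[of "nat (- n - c)"] by (cases "c \<ge> - n") simp_all
  qed
qed

text \<open>Up to the stabiliser, a ball with integral centre or containing 0 is on the apartment.
  Any other centre can be scaled by a unit to p^-r with r > 0; its vertex lies on a path that leaves
  the apartment at c = -r.\<close>

lemma all_reducible_if_geodesic:
  assumes geo: "\<And>y c. - n \<le> c \<Longrightarrow> c \<le> 0 \<Longrightarrow> G (upper_mat y c 0) \<in> reducible"
    and A: "A \<in> carrier GL2"
  shows "G A \<in> reducible"
proof -
  note diag = diagonal_reducible[OF geo]
  have small: "G (upper_mat y c (unif powi (- r))) \<in> reducible" if "c \<le> - r" for y c r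
  proof -
    have "unif powi (- r - c) \<in> (padic_int :: 'p padic set)" using that unfolding unif_powi_padic_int by simp
    moreover have "unif powi c * unif powi (- r - c) = (unif powi (- r) :: 'p padic)"
      by (simp flip: unif_powi_add)
    ultimately show ?thesis using upper_mat_shift_mod[of "unif powi (- r - c)" y c 0] diag by simp
  qed
  have pos: "\<forall>y. G (upper_mat y (- r + int m) (unif powi (- r))) \<in> reducible \<and>
      G (upper_mat y (- r + int m + 1) (unif powi (- r))) \<in> reducible" if r: "0 < r" for m r
  proof (induction m)
    case 0
    \<comment> \<open>At the branching vertex the neighbour with \<open>j = 0\<close> stays on the
      apartment, and for the other \<open>j\<close> the unit factor \<open>j\<close> makes them
      congruent to the case \<open>j = 1\<close>.\<close>
    have "G (upper_mat y (- r + 1) (unif powi (- r))) \<in> reducible" for y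
    proof (rule reducible_by_neighbours[of "upper_mat y (- r) 0" "mat 1" "geo_mat n s"], goal_cases)
      case (1 j)
      show ?case
      proof (cases "j = 0")
        case True
        then show ?thesis using diag by (simp add: upper_mat_neighbours)
      next
        case False
        then have "\<not> CARD('p) dvd j" using 1 by (simp add: nat_dvd_not_less)
        then show ?thesis using upper_mat_unit[OF padic_norm_of_nat_eq_1, of j y "- r + 1" "unif powi (- r)"]
          by (simp add: upper_mat_neighbours mult.commute)
      qed
    next
      case 2
      then show ?case using diag by (simp add: upper_mat_neighbours)
    next
      case 3
      have "\<not> CARD('p) dvd 1" using prime_gt_1_nat[OF prime_card, where 'a1='p] by simp
      then show ?case using upper_mat_unit[OF padic_norm_of_nat_eq_1, of 1 y "- r + 1" "unif powi (- r)"]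
          prime_gt_1_nat[OF prime_card, where 'a1='p]
        by (intro exI[of _ 1]) (simp only: upper_mat_neighbours, simp)
    qed (use diag in \<open>simp_all add: upper_mat_neighbours\<close>)
    then show ?case using small[of "- r" r] by simp
  next
    case (Suc m)
    let ?c = "- r + int m + 1"
    \<comment> \<open>Beyond the branching vertex all \<open>p\<close> smaller balls have centres
      p^-r (1 + x) with x divisible by p, so 1 + x is a unit and they are congruent.\<close>
    have nb: "G (upper_mat y (?c + 1) (unif powi (- r) + unif powi ?c * of_nat j)) -
        G (upper_mat y (?c + 1) (unif powi (- r))) \<in> reducible" for y j
    proof -
      let ?x = "unif powi (int m + 1) * of_nat j :: 'p padic"
      have "unif powi (int m + 1) = unif * (unif powi int m :: 'p padic)" by (simp add: unif_powi_add)
      moreover have "unif powi int m * of_nat j \<in> (padic_int :: 'p padic set)"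
        using padic_int_ring(6)[of "unif powi int m" "of_nat j"] unif_powi_padic_int[of "int m", where 'p='p] by simp
      ultimately have "padic_norm ?x < 1"
        unfolding padic_norm_lt_1_iff using prime_card_gt_1[where 'p='p]
        by (simp add: padic_norm_mult mult.assoc padic_int_iff divide_right_mono)
      then have "padic_norm (1 + ?x) = 1" using padic_norm_add_eq(1)[of ?x 1] by simp
      moreover have "unif powi (- r) + unif powi ?c * of_nat j = (1 + ?x) * unif powi (- r)"
        by (simp add: unif_powi_simps field_simps)
      ultimately show ?thesis using upper_mat_unit[of "1 + ?x" y "?c + 1" "unif powi (- r)"] by simp
    qed
    have "G (upper_mat y (?c + 1) (unif powi (- r))) \<in> reducible" for y
    proof (rule reducible_by_neighbours[of "upper_mat y ?c (unif powi (- r))" "mat 1" "geo_mat n s"], goal_cases)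
      case (1 j)
      then show ?case using nb[of y j] by (simp only: upper_mat_neighbours) simp
    next
      case 3
      then show ?case using nb[of y 0] by (intro exI[of _ 0]) (simp add: upper_mat_neighbours)
    qed (use Suc in \<open>simp_all add: upper_mat_neighbours\<close>)
    then show ?case using Suc by (simp add: add_ac)
  qed
  have all: "G (upper_mat y c t) \<in> reducible" for y c t
  proof (cases "t \<in> padic_int")
    case True
    then show ?thesis using reducible_cong[OF upper_mat_shift[OF True, of y c 0]] diag[of y c] by simp
  next
    case False
    then have "t \<noteq> 0" by auto
    then obtain k u where t: "t = unif powi k * u" "padic_norm u = 1" by (rule padic_unit_decomp)
    have "unif powi k \<notin> (padic_int :: 'p padic set)" using False t padic_int_mult_unit(1)[OF t(2)] by simp
    then have k: "k < 0" by (simp add: unif_powi_padic_int)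
    have "G (upper_mat y c (unif powi k)) \<in> reducible"
    proof (cases "c \<le> k")
      case True
      then show ?thesis using small[of c "- k" y] by simp
    next
      case False
      then show ?thesis using pos[of "- k" "nat (c - k)"] k by simp
    qed
    then show ?thesis
      using reducible_cong[OF upper_mat_unit[OF t(2), of y c "unif powi k"]] by (simp add: t(1) mult.commute)
  qed
  obtain y c t k where k: "k \<in> GL2_int" "A = upper_mat y c t ** k" by (rule iwasawa[OF A])
  have "G A = G (upper_mat y c t)"
    using lattice_symbol_K[of "upper_mat y c t" "mat 1" "geo_mat n s" k "mat 1" "mat 1"] k geo_mat_GL2[OF s] by simp
  then show ?thesis using all by simp
qed

end


section \<open>Double cosets\<close>

definition double_coset :: "'p::prime_card padic ^ 2 ^ 2 \<Rightarrow> ('p padic ^ 2 ^ 2) set" where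
  "double_coset B = (\<lambda>(k, k'). k ** B ** k') ` (GL2_int \<times> GL2_int)"

lemma double_cosetI: "k \<in> GL2_int \<Longrightarrow> k' \<in> GL2_int \<Longrightarrow> k ** B ** k' \<in> double_coset B"
  by (auto simp: double_coset_def)

lemma double_cosetE:
  assumes "x \<in> double_coset B"
  obtains k k' where "k \<in> GL2_int" "k' \<in> GL2_int" "x = k ** B ** k'"
  using assms by (auto simp: double_coset_def)

lemma double_coset_self: "B \<in> double_coset B"
  using double_cosetI[of "mat 1" "mat 1" B] by simp

lemma compact_double_coset: "compact (double_coset B)"
  unfolding double_coset_def case_prod_unfold
proof (rule compact_continuous_image)
  show "continuous_on (GL2_int \<times> GL2_int) (\<lambda>p. fst p ** B ** snd p)"
    by (intro continuous_on_matrix_mult continuous_on_fst continuous_on_snd continuous_on_const continuous_on_id)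
qed (rule compact_Times[OF compact_GL2_int compact_GL2_int])

lemma double_coset_subset:
  assumes "B \<in> carrier GL2"
  shows "double_coset B \<subseteq> carrier GL2"
proof
  fix x assume "x \<in> double_coset B"
  then obtain k k' where "k \<in> GL2_int" "k' \<in> GL2_int" "x = k ** B ** k'" by (rule double_cosetE)
  then show "x \<in> carrier GL2" using assms by (simp add: K.mem_carrier)
qed

lemma double_coset_mult:
  assumes k: "k \<in> GL2_int"
  shows "k ** x \<in> double_coset B \<longleftrightarrow> x \<in> double_coset B" "x ** k \<in> double_coset B \<longleftrightarrow> x \<in> double_coset B"
proof -
  have l: "k ** x \<in> double_coset B" if "k \<in> GL2_int" "x \<in> double_coset B" for k x
  proof -
    from that(2) obtain k1 k2 where "k1 \<in> GL2_int" "k2 \<in> GL2_int" "x = k1 ** B ** k2" by (rule double_cosetE)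
    then show ?thesis using double_cosetI[of "k ** k1" k2 B] K.m_closed[OF that(1), of k1] by (simp add: matrix_mul_assoc)
  qed
  have r: "x ** k \<in> double_coset B" if "k \<in> GL2_int" "x \<in> double_coset B" for k x
  proof -
    from that(2) obtain k1 k2 where "k1 \<in> GL2_int" "k2 \<in> GL2_int" "x = k1 ** B ** k2" by (rule double_cosetE)
    then show ?thesis using double_cosetI[of k1 "k2 ** k" B] K.m_closed[OF _ that(1), of k2] by (simp add: matrix_mul_assoc)
  qed
  note kc = K.mem_carrier[OF k]
  have e1: "inv\<^bsub>GL2\<^esub> k ** (k ** x) = x" by (simp only: matrix_mul_assoc inv_GL2[OF kc] matrix_mul_lid)
  have e2: "(x ** k) ** inv\<^bsub>GL2\<^esub> k = x"
    by (simp only: matrix_mul_assoc[symmetric] inv_GL2[OF kc] matrix_mul_rid)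
  show "k ** x \<in> double_coset B \<longleftrightarrow> x \<in> double_coset B"
    by (rule iffI[OF l[OF K.m_inv_closed[OF k], of "k ** x", unfolded e1] l[OF k]])
  show "x ** k \<in> double_coset B \<longleftrightarrow> x \<in> double_coset B"
    by (rule iffI[OF r[OF K.m_inv_closed[OF k], of "x ** k", unfolded e2] r[OF k]])
qed

lemma double_coset_bi_inv:
  assumes "B \<in> carrier GL2" "C \<in> carrier GL2"
  shows "indicator (double_coset B \<times> double_coset C) \<in> bi_inv"
proof -
  let ?S = "double_coset B \<times> double_coset C"
  have "?S \<subseteq> carrier GG" using double_coset_subset[OF assms(1)] double_coset_subset[OF assms(2)] unfolding carrier_GG by blast
  moreover have "compact ?S" by (intro compact_Times compact_double_coset)
  ultimately have "compactly_supported_on (carrier GG) (indicator ?S)"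
    unfolding compactly_supported_on_def by (intro exI[of _ ?S]) simp
  moreover have "g \<otimes>\<^bsub>GG\<^esub> k \<in> ?S \<longleftrightarrow> g \<in> ?S" "k \<otimes>\<^bsub>GG\<^esub> g \<in> ?S \<longleftrightarrow> g \<in> ?S" if "k \<in> GG_int" for g k
    using that by (simp_all add: mult_GG mem_Times_iff GG_int_def double_coset_mult)
  ultimately show ?thesis by (simp add: bi_inv_def smooth_right_inv_eq indicator_def)
qed

text \<open>The bi-invariant indicator of the product of double cosets gives a reducible sum of
  symbols for pairs (k B, k' C) with k, k' integral. Moving such a pair by the inverse of k fixes
  the first lattice and restores \<open>B\<close>, so only \<open>C\<close> varies.\<close>

lemma reducible_by_double_coset:
  fixes B C :: "'p::prime_card padic ^ 2 ^ 2"
  assumes GL: "B \<in> carrier GL2" "C \<in> carrier GL2"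
    and alt: "\<And>k. k \<in> GL2_int \<Longrightarrow> lattice_symbol (mat 1) B (k ** C) \<in> reducible \<or>
      lattice_symbol (mat 1) B (k ** C) - lattice_symbol (mat 1) B C \<in> reducible"
  shows "lattice_symbol (mat 1) B C \<in> reducible"
proof -
  let ?S = "double_coset B \<times> double_coset C"
  let ?\<eta> = "indicator ?S :: 'p GG \<Rightarrow> complex"
  have \<eta>: "?\<eta> \<in> bi_inv" by (rule double_coset_bi_inv[OF GL])
  then have "?\<eta> \<in> smooth_right_inv" by (simp add: bi_inv_def)
  then obtain X where X: "finite X" "X \<subseteq> carrier GG" "?\<eta> = (\<Sum>x\<in>X. cscale (?\<eta> x) (indicator (gcoset x)))"
    by (rule smooth_right_inv_decomp)
  let ?f = "\<lambda>x. lattice_symbol (mat 1) (fst x) (snd x)"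
  have "(\<Sum>x\<in>X \<inter> ?S. ?f x) = tensor (indicator std_lattice) ?\<eta>"
  proof
    fix z :: "('p padic ^ 2) \<times> 'p GG"
    obtain v y where z: "z = (v, y)" by (cases z)
    have "?\<eta> y = (\<Sum>x\<in>X. ?\<eta> x * indicator (gcoset x) y)"
      by (subst X(3)) (simp add: sum_fun_apply cscale_def)
    also have "\<dots> = (\<Sum>x\<in>X \<inter> ?S. indicator (gcoset x) y)"
      by (rule sum.mono_neutral_cong_right) (use X(1) in \<open>auto simp: indicator_def\<close>)
    finally show "(\<Sum>x\<in>X \<inter> ?S. ?f x) z = tensor (indicator std_lattice) ?\<eta> z"
      by (simp add: z sum_fun_apply lattice_symbol_def tensor_def sum_distrib_left)
  qed
  then have "(\<Sum>x\<in>X \<inter> ?S. ?f x) \<in> reducible" using tensor_bi_inv_reducible[OF \<eta>] by simp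
  then show ?thesis
  proof (rule reducible_of_sum[rotated])
    show "finite (X \<inter> ?S)" using X(1) by simp
    show "?f x \<in> reducible \<or> ?f x - lattice_symbol (mat 1) B C \<in> reducible" if "x \<in> X \<inter> ?S" for x
    proof -
      have "fst x \<in> double_coset B" "snd x \<in> double_coset C" using that by (auto simp: mem_Times_iff)
      then obtain k k1 k' k2 where k: "k \<in> GL2_int" "k1 \<in> GL2_int" "fst x = k ** B ** k1"
        and k': "k' \<in> GL2_int" "k2 \<in> GL2_int" "snd x = k' ** C ** k2"
        by (elim double_cosetE)
      let ?k = "inv\<^bsub>GL2\<^esub> k"
      have kc: "k \<in> carrier GL2" "?k \<in> carrier GL2" "k1 \<in> carrier GL2" "k' \<in> carrier GL2" "k2 \<in> carrier GL2"
        using k k' K.mem_carrier by auto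
      have "?k ** k ** B = B" by (simp add: inv_GL2[OF kc(1)])
      then have d: "?f x - lattice_symbol (mat 1) B (?k ** k' ** C) \<in> reducible"
        using k k' kc GL K.m_inv_closed[OF k(1)]
        by (intro lattice_symbol_cong(2)[where h = ?k and ?k1.0 = ?k and ?k2.0 = k1 and ?k3.0 = k2])
          (simp_all add: matrix_mul_assoc)
      have "?k ** k' \<in> GL2_int" using K.m_closed[OF K.m_inv_closed[OF k(1)] k'(1)] by simp
      from alt[OF this] show ?thesis
      proof
        assume "lattice_symbol (mat 1) B (?k ** k' ** C) \<in> reducible"
        then show ?thesis using reducible_cong[OF d] by blast
      next
        assume "lattice_symbol (mat 1) B (?k ** k' ** C) - lattice_symbol (mat 1) B C \<in> reducible"
        from reducible_add[OF d this] show ?thesis by simp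
      qed
    qed
    \<comment> \<open>The coset of \<open>(B, C)\<close> itself occurs in the decomposition, so at
      least one term is congruent to the wanted symbol.\<close>
    have "?\<eta> (B, C) = 1" by (simp add: double_coset_self)
    then have "(\<Sum>x\<in>X. ?\<eta> x * indicator (gcoset x) (B, C)) = 1"
      using fun_cong[OF X(3), of "(B, C)"] by (simp add: sum_fun_apply cscale_def)
    then have "\<exists>x\<in>X. ?\<eta> x * indicator (gcoset x) (B, C) \<noteq> 0"
      using sum.neutral[of X "\<lambda>x. ?\<eta> x * indicator (gcoset x) (B, C)"] by force
    then obtain x where x: "x \<in> X" "?\<eta> x * indicator (gcoset x) (B, C) \<noteq> 0" by blast
    then have xS: "x \<in> ?S" "(B, C) \<in> gcoset x" by (simp_all add: indicator_def split: if_splits)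
    have "gcoset (B, C) = gcoset x" using x(1) X(2) xS(2) by (intro gcoset_eq) auto
    then have "?f x = lattice_symbol (mat 1) B C" by (simp add: lattice_symbol_def)
    then show "\<exists>x\<in>X \<inter> ?S. ?f x - lattice_symbol (mat 1) B C \<in> reducible"
      using x(1) xS(1) by (intro bexI[of _ x]) (simp_all add: reducible_0)
  qed
qed

section \<open>Induction on the distance\<close>

lemma geodesic_vertex_reducible:
  fixes z z' :: "'p::prime_card padic"
  assumes i: "0 \<le> i" and j: "0 \<le> j" and z: "z \<noteq> 0" "z' \<noteq> 0"
    and IH: "\<And>m s A. 0 \<le> m \<Longrightarrow> m < i + j \<Longrightarrow> s \<noteq> 0 \<Longrightarrow> A \<in> carrier GL2 \<Longrightarrow>
      lattice_symbol A (mat 1) (geo_mat m s) \<in> (reducible :: (('p padic ^ 2) \<times> 'p GG \<Rightarrow> complex) set)"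
  shows "lattice_symbol (mat 1) (mat2 (z * unif powi i) 0 0 z) (geo_mat j z') \<in> reducible"
proof -
  define B where "B = mat2 (z * unif powi i) 0 0 z"
  define C where "C = geo_mat j z'"
  have GL: "B \<in> carrier GL2" "C \<in> carrier GL2" using z by (simp_all add: B_def C_def geo_mat_GL2 mat2_in_GL2)
  have "lattice_symbol (mat 1) B C \<in> reducible"
  proof (rule reducible_by_double_coset[OF GL])
    fix k :: "'p padic ^ 2 ^ 2" assume k: "k \<in> GL2_int"
    have kc: "k \<in> carrier GL2" using k by simp
    obtain a b c d where kabcd: "k = mat2 a b c d" by (rule mat2_cases)
    have int: "a \<in> padic_int" "b \<in> padic_int" "c \<in> padic_int" "d \<in> padic_int" "padic_norm (a * d - b * c) = 1"
      using k by (simp_all add: kabcd mat2_in_GL2_int)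
    have qi: "unif powi i \<in> (padic_int :: 'p padic set)" "unif powi j \<in> (padic_int :: 'p padic set)"
      using i j by (simp_all add: unif_powi_padic_int)
    \<comment> \<open>If \<open>i\<close> or \<open>j\<close> is 0, then \<open>B\<close> or
      \<open>C\<close> is scalar. Otherwise \<open>a\<close> modulo p decides whether the paths from
      the origin to \<open>B\<close> and to \<open>k ** C\<close> start along the same edge.\<close>
    consider "i = 0" | "j = 0" | "padic_norm a = 1" | "0 < i" "0 < j" "padic_norm a < 1"
      using int(1) i j unfolding padic_int_iff by linarith
    then show "lattice_symbol (mat 1) B (k ** C) \<in> reducible \<or>
      lattice_symbol (mat 1) B (k ** C) - lattice_symbol (mat 1) B C \<in> reducible"
    proof cases
      case 1
      have "lattice_symbol (mat 1) B (k ** C) - lattice_symbol (mat 1) B C \<in> reducible"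
        by (rule lattice_symbol_cong(1)[where h = k and ?k1.0 = k and ?k2.0 = k and ?k3.0 = "mat 1"])
          (use GL k kc in \<open>simp_all add: kabcd B_def 1 mult.commute\<close>)
      then show ?thesis by blast
    next
      case 2
      have "k ** C = C ** k" by (simp add: kabcd C_def geo_mat_def 2 mult.commute)
      then have "lattice_symbol (mat 1) B (k ** C) = lattice_symbol (mat 1) B C"
        using lattice_symbol_K[of "mat 1" B C "mat 1" "mat 1" k] GL k by simp
      then show ?thesis by (simp add: reducible_0)
    next
      case 3
      have a: "a \<noteq> 0" using 3 by auto
      have ca: "c / a \<in> padic_int" using int(3) 3 by (simp add: padic_int_iff padic_norm_divide)
      \<comment> \<open>\<open>?h\<close> is the lower triangular factor of \<open>k\<close> and
        fixes the origin and \<open>B\<close>. The remaining upper triangular factor fixes the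
        lattice of \<open>C\<close>; conjugated by \<open>C\<close> it is the integral matrix
        \<open>?k\<close>.\<close>
      let ?h = "mat2 1 0 (c / a) 1"
      let ?k = "mat2 a (b * unif powi j) 0 (d - b * c / a)"
      have "d - b * c / a = (a * d - b * c) / a" using a by (simp add: field_simps)
      then have nd: "padic_norm (d - b * c / a) = 1" using int(5) 3 by (simp add: padic_norm_divide)
      have "b * unif powi j \<in> padic_int" using int qi by (intro padic_int_ring)
      then have k': "?k \<in> GL2_int" using 3 nd by (simp add: mat2_in_GL2_int padic_norm_mult padic_int_iff)
      have h: "?h \<in> GL2_int" "mat2 1 0 (c / a * unif powi i) 1 \<in> GL2_int"
        using ca qi by (simp_all add: lower_unipotent_GL2_int del: times_divide_eq_left)
      have "k ** C = ?h ** (C ** ?k)"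
        using a by (simp add: kabcd C_def geo_mat_def power_int_minus field_simps)
      have "lattice_symbol (mat 1) B (k ** C) - lattice_symbol (mat 1) B (C ** ?k) \<in> reducible"
        by (rule lattice_symbol_cong(1)[where h = ?h and ?k1.0 = ?h and ?k2.0 = "mat2 1 0 (c / a * unif powi i) 1" and ?k3.0 = "mat 1"])
          (use GL k kc k' h z in \<open>simp_all add: \<open>k ** C = ?h ** (C ** ?k)\<close> K.mem_carrier B_def mult_ac\<close>)
      moreover have "lattice_symbol (mat 1) B (C ** ?k) = lattice_symbol (mat 1) B C"
        using lattice_symbol_K[of "mat 1" B C "mat 1" "mat 1" ?k] GL k' by simp
      ultimately show ?thesis by simp
    next
      case 4
      define N where "N = inv\<^bsub>GL2\<^esub> B ** (k ** C)"
      have N: "N \<in> carrier GL2" using GL kc by (simp add: N_def)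
      then obtain k1 k2 m s where cd: "k1 \<in> GL2_int" "k2 \<in> GL2_int" "0 \<le> m" "s \<noteq> 0" "N = k1 ** geo_mat m s ** k2"
        by (rule cartan)
      have "inv\<^bsub>GL2\<^esub> B = mat2 (1 / (z * unif powi i)) 0 0 (1 / z)"
      proof (rule GL.inv_equality)
        show "mat2 (1 / (z * unif powi i)) 0 0 (1 / z) \<otimes>\<^bsub>GL2\<^esub> B = \<one>\<^bsub>GL2\<^esub>"
          using z by (simp add: B_def mat2_one)
      qed (use z GL in \<open>simp_all add: mat2_in_GL2\<close>)
      then have Ne: "N = mat2 (z' / z * unif powi (- i - j) * a) (z' / z * unif powi (- i) * b)
          (z' / z * unif powi (- j) * c) (z' / z * d)"
        using z by (simp add: N_def kabcd C_def geo_mat_def unif_powi_simps field_simps)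
      define \<rho> where "\<rho> = padic_norm (z' / z)"
      have \<rho>: "\<rho> > 0" using z padic_norm_nonneg[of "z' / z"] by (simp add: \<rho>_def less_le padic_norm_eq_0)
      have p1: "1 < real CARD('p)" by (rule prime_card_gt_1)
      \<comment> \<open>The upper left entry of \<open>N\<close> could have norm \<rho> p^(i+j), but
        |a| is at most 1/p; the other entries obey the bound since \<open>i\<close> and
        \<open>j\<close> are positive. As the determinant has norm \<rho>^2 p^(i+j),
        \<open>cartan_bound\<close> yields m at most i + j - 2.\<close>
      define \<mu> where "\<mu> = \<rho> * real CARD('p) powi (i + j - 1)"
      have bd: "padic_norm (z' / z * unif powi (- e) * x) \<le> \<mu>" if "padic_norm x \<le> real CARD('p) powi (i + j - 1 - e)" for e x
      proof -
        have "padic_norm (unif powi (- e) * x) \<le> real CARD('p) powi e * real CARD('p) powi (i + j - 1 - e)"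
          using that p1 by (simp add: padic_norm_mult padic_norm_unif_powi)
        also have "\<dots> = real CARD('p) powi (e + (i + j - 1 - e))" using p1 by (intro power_int_add[symmetric]) simp
        also have "e + (i + j - 1 - e) = i + j - 1" by simp
        finally have "\<rho> * padic_norm (unif powi (- e) * x) \<le> \<mu>"
          unfolding \<mu>_def by (rule mult_left_mono) (use \<rho> in simp)
        then show ?thesis by (simp only: mult.assoc padic_norm_mult[of "z' / z"] \<rho>_def)
      qed
      have le1: "1 \<le> real CARD('p) powi e" if "0 \<le> e" for e using that p1 by simp
      have "padic_norm a \<le> real CARD('p) powi (i + j - 1 - (i + j))"
        using 4(3) by (simp add: padic_norm_lt_1_iff power_int_minus inverse_eq_divide)
      from bd[OF this] have e11: "padic_norm (N $ 1 $ 1) \<le> \<mu>" by (simp add: Ne)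
      have "padic_norm b \<le> real CARD('p) powi (i + j - 1 - i)"
        by (rule order_trans[OF _ le1]) (use int(2) 4 in \<open>simp_all add: padic_int_iff\<close>)
      from bd[OF this] have e12: "padic_norm (N $ 1 $ 2) \<le> \<mu>" by (simp add: Ne)
      have "padic_norm c \<le> real CARD('p) powi (i + j - 1 - j)"
        by (rule order_trans[OF _ le1]) (use int(3) 4 in \<open>simp_all add: padic_int_iff\<close>)
      from bd[OF this] have e21: "padic_norm (N $ 2 $ 1) \<le> \<mu>" by (simp add: Ne)
      have "padic_norm d \<le> real CARD('p) powi (i + j - 1 - 0)"
        by (rule order_trans[OF _ le1]) (use int(4) 4 in \<open>simp_all add: padic_int_iff\<close>)
      from bd[OF this] have e22: "padic_norm (N $ 2 $ 2) \<le> \<mu>" by (simp add: Ne)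
      have e: "padic_norm (N $ r $ t) \<le> \<mu>" for r t
        using e11 e12 e21 e22 exhaust_2[of r] exhaust_2[of t] by auto
      have "unif powi (- i - j) = unif powi (- i) * (unif powi (- j) :: 'p padic)"
        using unif_powi_add[of "- i" "- j", where 'p='p] by simp
      then have "det N = (z' / z) * (z' / z) * unif powi (- i - j) * (a * d - b * c)"
        by (simp only: Ne det_mat2 algebra_simps)
      then have "padic_norm (det N) = \<rho> * \<rho> * padic_norm (unif powi (- i - j) :: 'p padic) * padic_norm (a * d - b * c)"
        by (simp only: padic_norm_mult[of _ "a * d - b * c"] padic_norm_mult[of _ "unif powi _"] padic_norm_mult[of "z' / z"] \<rho>_def)
      then have "padic_norm (det N) = \<rho>\<^sup>2 * real CARD('p) powi (i + j)"
        by (simp add: int(5) power2_eq_square padic_norm_unif_powi add.commute)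
      then have le: "real CARD('p) powi m * (\<rho>\<^sup>2 * real CARD('p) powi (i + j)) \<le> (\<rho> * real CARD('p) powi (i + j - 1))\<^sup>2"
        using cartan_bound(1)[OF cd(1,2,5) e] by (simp add: \<mu>_def)
      have cmp: "m + e \<le> f + f"
        if "real CARD('p) powi m * (\<rho>\<^sup>2 * real CARD('p) powi e) \<le> (\<rho> * real CARD('p) powi f)\<^sup>2" for m e f
      proof -
        have nz: "real CARD('p) \<noteq> 0" using p1 by simp
        have "\<rho>\<^sup>2 * real CARD('p) powi (m + e) \<le> \<rho>\<^sup>2 * real CARD('p) powi (f + f)"
          using that by (simp only: power_int_add[OF disjI1[OF nz]] power2_eq_square mult_ac)
        then have "real CARD('p) powi (m + e) \<le> real CARD('p) powi (f + f)"
          using \<rho> by (simp only: mult_le_cancel_left_pos zero_less_power)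
        then show ?thesis by (simp only: powi_le_cancel_iff[OF p1])
      qed
      from cmp[OF le] have mlt: "m < i + j" by simp
      let ?h = "inv\<^bsub>GL2\<^esub> k1 ** inv\<^bsub>GL2\<^esub> B"
      have k1c: "k1 \<in> carrier GL2" using cd by simp
      have "?h ** (k ** C) = inv\<^bsub>GL2\<^esub> k1 ** N" by (simp add: N_def matrix_mul_assoc)
      also have "\<dots> = (inv\<^bsub>GL2\<^esub> k1 ** k1) ** geo_mat m s ** k2" by (simp only: cd(5) matrix_mul_assoc)
      finally have hC: "?h ** (k ** C) = geo_mat m s ** k2" by (simp add: inv_GL2[OF k1c])
      have hB: "?h ** B = mat 1 ** inv\<^bsub>GL2\<^esub> k1"
        by (simp add: matrix_mul_assoc[symmetric] inv_GL2[OF GL(1)])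
      have "lattice_symbol ?h (mat 1) (geo_mat m s) \<in> reducible \<longleftrightarrow> lattice_symbol (mat 1) B (k ** C) \<in> reducible"
        by (rule lattice_symbol_cong(3)[where h = ?h and ?k1.0 = "mat 1" and ?k2.0 = "inv\<^bsub>GL2\<^esub> k1" and ?k3.0 = k2])
          (use GL kc k1c cd hB hC geo_mat_GL2[OF cd(4)] K.m_inv_closed[OF cd(1)] in simp_all)
      moreover have "?h \<in> carrier GL2" using GL k1c by simp
      ultimately show ?thesis using IH[OF cd(3) mlt cd(4)] by blast
    qed
  qed
  then show ?thesis by (simp add: B_def C_def)
qed

lemma geo_symbol_reducible:
  fixes s :: "'p::prime_card padic"
  assumes "s \<noteq> 0" "A \<in> carrier GL2"
  shows "lattice_symbol A (mat 1) (geo_mat (int n) s) \<in> reducible"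
  using assms
proof (induction n arbitrary: s A rule: less_induct)
  case (less n)
  show ?case
  proof (rule all_reducible_if_geodesic[OF _ less.prems(1) _ less.prems(2)])
    fix y c :: int assume c: "- int n \<le> c" "c \<le> 0"
    have IH: "lattice_symbol A (mat 1) (geo_mat m s) \<in> reducible"
      if "0 \<le> m" "m < - c + (int n + c)" "s \<noteq> 0" "A \<in> carrier GL2" for m s and A :: "'p padic ^ 2 ^ 2"
      using less.IH[of "nat m" s A] that by simp
    have s: "s \<noteq> 0" by (rule less.prems)
    \<comment> \<open>Moving the vertex to the origin splits the distance \<open>n\<close> into
      \<open>- c\<close> towards the first end and \<open>n + c\<close> towards the second; the
      scale \<open>y\<close> only changes scalar factors.\<close>
    let ?z = "unif powi (- y) :: 'p padic"
    have "lattice_symbol (mat 1) (mat2 (?z * unif powi (- c)) 0 0 ?z) (geo_mat (int n + c) (s * ?z)) \<in> reducible"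
      using c s by (intro geodesic_vertex_reducible IH) simp_all
    moreover have "lattice_symbol (mat 1) (mat2 (?z * unif powi (- c)) 0 0 ?z) (geo_mat (int n + c) (s * ?z)) \<in> reducible
        \<longleftrightarrow> lattice_symbol (upper_mat y c 0) (mat 1) (geo_mat (int n) s) \<in> reducible"
      by (rule lattice_symbol_cong(3)[where h = "mat2 (unif powi (- y - c)) 0 0 (unif powi (- y))" and ?k1.0 = "mat 1" and ?k2.0 = "mat 1" and ?k3.0 = "mat 1"])
        (use s in \<open>simp_all add: geo_mat_GL2 mat2_in_GL2 upper_mat_def geo_mat_def mat2_one unif_powi_simps field_simps upper_unipotent_GL2_int\<close>)
    ultimately show "lattice_symbol (upper_mat y c 0) (mat 1) (geo_mat (int n) s) \<in> reducible" by blast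
  qed simp
qed

text \<open>The Cartan decomposition of the inverse of \<open>B\<close> times \<open>C\<close> puts
  the pair into the normal form of a standard lattice and a \<open>geo_mat\<close>.\<close>

lemma lattice_symbol_reducible:
  fixes A B C :: "'p::prime_card padic ^ 2 ^ 2"
  assumes GL: "A \<in> carrier GL2" "B \<in> carrier GL2" "C \<in> carrier GL2"
  shows "lattice_symbol A B C \<in> reducible"
proof -
  have "inv\<^bsub>GL2\<^esub> B ** C \<in> carrier GL2" using GL by simp
  then obtain k1 k2 n s where cd: "k1 \<in> GL2_int" "k2 \<in> GL2_int" "0 \<le> n" "s \<noteq> 0" "inv\<^bsub>GL2\<^esub> B ** C = k1 ** geo_mat n s ** k2"
    by (rule cartan)
  let ?h = "inv\<^bsub>GL2\<^esub> k1 ** inv\<^bsub>GL2\<^esub> B"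
  have k1c: "k1 \<in> carrier GL2" using cd by simp
  have "?h ** C = inv\<^bsub>GL2\<^esub> k1 ** (inv\<^bsub>GL2\<^esub> B ** C)" by (simp add: matrix_mul_assoc)
  also have "\<dots> = (inv\<^bsub>GL2\<^esub> k1 ** k1) ** geo_mat n s ** k2" by (simp only: cd(5) matrix_mul_assoc)
  finally have hC: "?h ** C = geo_mat n s ** k2" by (simp add: inv_GL2[OF k1c])
  have hB: "?h ** B = mat 1 ** inv\<^bsub>GL2\<^esub> k1"
    by (simp add: matrix_mul_assoc[symmetric] inv_GL2[OF GL(1)] inv_GL2[OF GL(2)])
  have "lattice_symbol (?h ** A) (mat 1) (geo_mat n s) \<in> reducible \<longleftrightarrow> lattice_symbol A B C \<in> reducible"
    by (rule lattice_symbol_cong(3)[where h = ?h and ?k1.0 = "mat 1" and ?k2.0 = "inv\<^bsub>GL2\<^esub> k1" and ?k3.0 = k2])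
      (use GL k1c cd hB hC geo_mat_GL2[OF cd(4)] K.m_inv_closed[OF cd(1)] in simp_all)
  moreover have "?h ** A \<in> carrier GL2" using GL k1c by simp
  ultimately show ?thesis using geo_symbol_reducible[OF cd(4), of "?h ** A" "nat n"] cd(3) by simp
qed

section \<open>Schwartz functions and the conclusion\<close>

text \<open>The coset v + p^m Z_p^2. Natural exponents suffice, because locally constant functions
  only require small balls.\<close>

definition vball :: "nat \<Rightarrow> 'p::prime_card padic ^ 2 \<Rightarrow> ('p padic ^ 2) set" where
  "vball m v = {w. \<forall>i. padic_norm (w $ i - v $ i) \<le> (1 / real CARD('p)) ^ m}"

lemma vball_self: "v \<in> vball m v"
  by (simp add: vball_def)

lemma vball_eq:
  assumes "w \<in> vball m v"
  shows "vball m w = vball m v"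
proof -
  have *: "padic_norm (x - b) \<le> c" if "padic_norm (x - a) \<le> c" "padic_norm (a - b) \<le> c" for x a b :: "'a padic" and c
    using padic_norm_add_le[of "x - a" "a - b"] that by simp
  have "padic_norm (w $ i - v $ i) \<le> (1 / real CARD('a)) ^ m" for i using assms by (simp add: vball_def)
  moreover from this have "padic_norm (v $ i - w $ i) \<le> (1 / real CARD('a)) ^ m" for i
    by (simp add: padic_norm_diff_commute)
  ultimately show ?thesis unfolding vball_def by (blast intro: *)
qed

lemma vball_mono:
  assumes "l \<le> m"
  shows "vball m v \<subseteq> vball l (v :: 'p::prime_card padic ^ 2)"
proof -
  have "(1 / real CARD('p)) ^ m \<le> (1 / real CARD('p)) ^ l"
    using prime_card_gt_1[where 'p='p] assms by (intro power_decreasing) auto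
  then show ?thesis unfolding vball_def by (auto intro: order_trans)
qed

lemma open_vball: "open (vball m (v :: 'p::prime_card padic ^ 2))"
proof -
  have e: "open ((\<lambda>w. w $ i - v $ i) -` {x. padic_norm x \<le> (1 / real CARD('p)) ^ m} :: ('p padic ^ 2) set)" for i
    using prime_card_gt_1[where 'p='p]
    by (intro open_vimage[OF open_padic_norm_le] continuous_on_diff continuous_on_component continuous_on_id continuous_on_const) simp
  have "vball m v = (\<Inter>i. (\<lambda>w. w $ i - v $ i) -` {x. padic_norm x \<le> (1 / real CARD('p)) ^ m})"
    by (auto simp: vball_def)
  also have "open \<dots>" by (intro open_INT e ballI) auto
  finally show ?thesis .
qed

lemma vball_in_open:
  fixes U :: "('p::prime_card padic ^ 2) set"
  assumes "open U" "v \<in> U"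
  obtains m where "vball m v \<subseteq> U"
proof -
  obtain e where e: "e > 0" "\<And>w. dist w v < e \<Longrightarrow> w \<in> U" using assms unfolding open_dist by blast
  obtain m where m: "(1 / real CARD('p)) ^ m < e / 2"
    using real_arch_pow_inv[of "e / 2" "1 / real CARD('p)"] e prime_card_gt_1[where 'p='p] by auto
  have "dist w v < e" if "w \<in> vball m v" for w
  proof -
    have "dist w v \<le> (\<Sum>i\<in>UNIV. dist (w $ i) (v $ i))"
      unfolding dist_vec_def by (rule L2_set_le_sum) simp
    also have "\<dots> \<le> (\<Sum>i\<in>(UNIV::2 set). (1 / real CARD('p)) ^ m)"
      using that by (intro sum_mono) (simp add: dist_padic vball_def)
    also have "\<dots> < e" using m by simp
    finally show ?thesis .
  qed
  then show ?thesis using e that by blast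
qed

lemma schwartz_decomp:
  fixes \<phi> :: "'p::prime_card padic ^ 2 \<Rightarrow> complex"
  assumes "\<phi> \<in> schwartz_space"
  obtains m X where "finite X" "\<phi> = (\<Sum>x\<in>X. cscale (\<phi> x) (indicator (vball m x)))"
proof -
  obtain C where C: "compact C" "\<And>x. x \<notin> C \<Longrightarrow> \<phi> x = 0"
    using assms unfolding schwartz_space_def compactly_supported_on_def by blast
  have "\<exists>m. \<forall>w\<in>vball m v. \<phi> w = \<phi> v" for v
  proof -
    have "\<exists>U. open U \<and> v \<in> U \<and> (\<forall>y\<in>U. \<phi> y = \<phi> v)"
      using assms by (simp add: schwartz_space_def locally_constant_on_def)
    then obtain U where U: "open U" "v \<in> U" "\<forall>y\<in>U. \<phi> y = \<phi> v" by blast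
    obtain m where "vball m v \<subseteq> U" by (rule vball_in_open[OF U(1,2)])
    then show ?thesis using U(3) by blast
  qed
  then obtain l where l: "\<And>v w. w \<in> vball (l v) v \<Longrightarrow> \<phi> w = \<phi> v" by metis
  have "C \<subseteq> (\<Union>x\<in>C. vball (l x) x)" using vball_self by fast
  then obtain D where D: "D \<subseteq> C" "finite D" "C \<subseteq> (\<Union>x\<in>D. vball (l x) x)"
    by (rule compactE_image[OF C(1) open_vball])
  \<comment> \<open>One radius for the whole support; the inserted 0 makes \<open>Max\<close>
    meaningful when \<open>D\<close> is empty.\<close>
  define m where "m = Max (insert 0 (l ` D))"
  show ?thesis
  proof (rule finite_partition_decomp[OF C, where E = "vball m"])
    fix X assume "finite X" "\<phi> = (\<Sum>x\<in>X. cscale (\<phi> x) (indicator (vball m x)))"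
    then show thesis by (rule that)
  next
    fix x y assume x: "x \<in> C" and y: "y \<in> vball m x"
    show "vball m y = vball m x" by (rule vball_eq[OF y])
    obtain d where d: "d \<in> D" "x \<in> vball (l d) d" using D x by blast
    have "l d \<le> m" using D(2) d(1) by (simp add: m_def)
    then have "y \<in> vball (l d) x" using y vball_mono by blast
    then have "y \<in> vball (l d) d" using vball_eq[OF d(2)] by simp
    then show "\<phi> y = \<phi> x" using l d(2) by metis
  qed (simp_all add: open_vball vball_self)
qed

text \<open>\<open>U\<close> represents the units modulo p^m. The congruence x a = 1 modulo p^m has
  exactly one solution in \<open>U\<close> if x is a unit (the residue of 1/x), and none otherwise.
  Units being Z_p without p Z_p, the sum is a difference of two lattice indicators.\<close>

lemma vball_one_translate_sum:
  fixes x y :: "'p::prime_card padic"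
  assumes m: "0 < m"
  defines "U \<equiv> {a. a < CARD('p) ^ m \<and> \<not> CARD('p) dvd a}"
  shows "(\<Sum>a\<in>U. indicator (vball m (vector [1, 0])) (vector [x, y] v* mat2 (of_nat a) 0 0 (of_nat a))) =
    (indicator std_lattice (vector [x, y] v* mat2 1 0 0 (unif powi (- int m)))
     - indicator std_lattice (vector [x, y] v* mat2 (unif powi (- 1)) 0 0 (unif powi (- int m))) :: complex)"
proof -
  have p1: "1 < real CARD('p)" by (rule prime_card_gt_1)
  let ?e = "(1 / real CARD('p)) ^ m"
  have e1: "?e < 1" using p1 m by (simp add: power_less_one_iff)
  have fin: "finite U" by (rule finite_subset[of _ "{..<CARD('p) ^ m}"]) (auto simp: U_def)
  have unit: "padic_norm (of_nat a :: 'p padic) = 1" if "a \<in> U" for a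
    using that by (intro padic_norm_of_nat_eq_1) (simp add: U_def)
  have L: "indicator (vball m (vector [1, 0])) (vector [x, y] v* mat2 (of_nat a) 0 0 (of_nat a)) =
      (if padic_norm (x * of_nat a - 1) \<le> ?e \<and> padic_norm y \<le> ?e then 1 else 0 :: complex)" if "a \<in> U" for a
    using unit[OF that] by (simp add: vector_mat2 vball_def forall_2 indicator_def padic_norm_mult)
  have yp: "y * unif powi (- int m) \<in> padic_int \<longleftrightarrow> padic_norm y \<le> ?e"
    using p1 by (simp add: padic_int_iff padic_norm_mult padic_norm_unif_powi power_one_over field_simps)
  have xp: "x * unif powi (- 1) \<in> padic_int \<longleftrightarrow> padic_norm x < 1"
    using p1 by (simp add: padic_int_iff padic_norm_mult padic_norm_unif_powi padic_norm_lt_1_iff field_simps del: power_int_minus1_right)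
  have R: "(indicator std_lattice (vector [x, y] v* mat2 1 0 0 (unif powi (- int m)))
     - indicator std_lattice (vector [x, y] v* mat2 (unif powi (- 1)) 0 0 (unif powi (- int m))) :: complex)
     = (if padic_norm x = 1 \<and> padic_norm y \<le> ?e then 1 else 0)"
  proof -
    have "x \<in> padic_int \<longleftrightarrow> padic_norm x < 1 \<or> padic_norm x = 1" unfolding padic_int_iff by linarith
    then show ?thesis
      unfolding vector_mat2 indicator_def vector_in_std_lattice mult_zero_right add_0_left add_0_right mult_1_right yp xp by auto
  qed
  show ?thesis
  proof (cases "padic_norm x = 1 \<and> padic_norm y \<le> ?e")
    case False
    have "\<not> (padic_norm (x * of_nat a - 1) \<le> ?e \<and> padic_norm y \<le> ?e)" if a: "a \<in> U" for a
    proof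
      assume *: "padic_norm (x * of_nat a - 1) \<le> ?e \<and> padic_norm y \<le> ?e"
      then have "padic_norm ((x * of_nat a - 1) + 1) = 1" using e1 by (intro trans[OF padic_norm_add_eq(2)]) auto
      then show False using False * unit[OF a] by (simp add: padic_norm_mult)
    qed
    then show ?thesis unfolding R using L False by (simp add: sum.neutral)
  next
    case True
    then have x0: "x \<noteq> 0" by auto
    have "padic_norm (inverse x) \<le> 1" using True by (simp add: padic_norm_inverse)
    then obtain a where a: "a < CARD('p) ^ m" "padic_norm (inverse x - of_nat a) \<le> ?e" using padic_approx by blast
    have "\<not> CARD('p) dvd a"
    proof
      assume "CARD('p) dvd a"
      then obtain b where "a = CARD('p) * b" by (auto simp: dvd_def)
      then have "padic_norm (of_nat a :: 'p padic) = 1 / real CARD('p) * padic_norm (of_nat b :: 'p padic)"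
        by (simp add: padic_norm_mult)
      also have "\<dots> < 1" using p1 padic_norm_of_nat_le_1[of b, where 'p='p] by (simp add: field_simps)
      finally have "padic_norm (inverse x - of_nat a) = 1"
        using True by (subst padic_norm_add_eq) (simp_all add: padic_norm_inverse)
      then show False using a(2) e1 by simp
    qed
    then have aU: "a \<in> U" using a by (simp add: U_def)
    have key: "padic_norm (x * of_nat b - 1) \<le> ?e \<longleftrightarrow> b = a" if b: "b \<in> U" for b
    proof -
      have "x * of_nat b - 1 = - x * (inverse x - of_nat b)" using x0 by (simp add: algebra_simps)
      then have 1: "padic_norm (x * of_nat b - 1) = padic_norm (inverse x - of_nat b)"
        using True by (simp only: padic_norm_mult padic_norm_minus mult_1)
      show ?thesis
      proof
        assume "padic_norm (x * of_nat b - 1) \<le> ?e"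
        then have d: "padic_norm (of_nat a - of_nat b :: 'p padic) \<le> ?e"
          using padic_norm_diff_le[of "inverse x - of_nat b" "inverse x - of_nat a"] a(2) 1 by simp
        have eq: "c = d" if "d \<le> c" "c < CARD('p) ^ m" "padic_norm (of_nat c - of_nat d :: 'p padic) \<le> ?e" for c d
        proof -
          have "CARD('p) ^ m dvd c - d" using that by (intro power_dvd_of_padic_norm) (simp add: of_nat_diff)
          then show ?thesis using that nat_dvd_not_less[of "c - d" "CARD('p) ^ m"] by (cases "c = d") auto
        qed
        show "b = a"
        proof (cases "b \<le> a")
          case True
          then show ?thesis using eq[OF True a(1) d] by simp
        next
          case False
          then show ?thesis using eq[of a b] d b by (simp add: U_def padic_norm_diff_commute)
        qed
      qed (use a 1 in simp)
    qed
    have "(\<Sum>a\<in>U. indicator (vball m (vector [1, 0])) (vector [x, y] v* mat2 (of_nat a) 0 0 (of_nat a)))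
        = (\<Sum>b\<in>U. if b = a then 1 else 0 :: complex)"
      using True by (intro sum.cong refl) (simp add: L key)
    then show ?thesis unfolding R using True aU fin by simp
  qed
qed

text \<open>Unit scalars are central and integral, so they fix the coset of \<open>(B, C)\<close>
  and act on the Schwartz factor only. Hence all summands of the preceding identity are congruent,
  and their number is positive since 1 is a unit.\<close>

lemma unit_vball_reducible:
  fixes B C :: "'p::prime_card padic ^ 2 ^ 2"
  assumes GL: "B \<in> carrier GL2" "C \<in> carrier GL2" and m: "0 < m"
    and T: "tensor (indicator (vball m (vector [1, 0]))) (indicator (gcoset (B, C))) \<in> schwartz_tensor"
  shows "tensor (indicator (vball m (vector [1, 0]))) (indicator (gcoset (B, C))) \<in> reducible"
proof -
  let ?T = "tensor (indicator (vball m (vector [1, 0]))) (indicator (gcoset (B, C)))"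
  define U where "U = {a. a < CARD('p) ^ m \<and> \<not> CARD('p) dvd a}"
  have fin: "finite U" by (rule finite_subset[of _ "{..<CARD('p) ^ m}"]) (auto simp: U_def)
  let ?s = "\<lambda>a. mat2 (of_nat a) 0 0 (of_nat a) :: 'p padic ^ 2 ^ 2"
  let ?f = "\<lambda>a. tensor (\<lambda>x. indicator (vball m (vector [1, 0])) (x v* ?s a)) (indicator (gcoset (B, C)))"
  have d: "?f a - ?T \<in> reducible" if "a \<in> U" for a
  proof -
    have u: "padic_norm (of_nat a :: 'p padic) = 1" using that by (intro padic_norm_of_nat_eq_1) (simp add: U_def)
    then have sK: "?s a \<in> GL2_int" by (simp add: mat2_in_GL2_int padic_norm_mult)
    have comm: "?s a ** N = N ** ?s a" for N
      by (rule mat2_cases[of N]) (simp add: mult.commute)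
    have "diag_act (?s a) ?T = ?f a"
      using GL sK by (simp add: diag_act_tensor_gcoset comm gcoset_K)
    then show ?thesis using diag_act_diff_reducible(1)[OF _ T, of "?s a"] sK by simp
  qed
  have "(\<Sum>a\<in>U. ?f a) = lattice_symbol (mat2 1 0 0 (unif powi (- int m))) B C
      - lattice_symbol (mat2 (unif powi (- 1)) 0 0 (unif powi (- int m))) B C"
  proof
    fix z :: "('p padic ^ 2) \<times> 'p GG"
    obtain v g where z: "z = (v, g)" by (cases z)
    obtain x y where v: "v = vector [x, y]" by (rule vector2_cases)
    show "(\<Sum>a\<in>U. ?f a) z = (lattice_symbol (mat2 1 0 0 (unif powi (- int m))) B C
      - lattice_symbol (mat2 (unif powi (- 1)) 0 0 (unif powi (- int m))) B C) z"
      using arg_cong[OF vball_one_translate_sum[OF m, of x y], of "\<lambda>w. w * indicator (gcoset (B, C)) g"]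
      by (simp add: z v sum_fun_apply tensor_def lattice_symbol_def sum_distrib_right left_diff_distrib U_def
          del: power_int_minus1_right)
  qed
  also have "\<dots> \<in> reducible"
    using GL by (intro reducible_diff lattice_symbol_reducible) (simp_all add: mat2_in_GL2)
  finally have "(\<Sum>a\<in>U. ?f a) \<in> reducible" .
  moreover have "1 \<in> U"
    using prime_gt_1_nat[OF prime_card, where 'a1='p] one_less_power[of "CARD('p)" m] m by (simp add: U_def)
  ultimately show ?thesis using d fin by (intro reducible_of_sum[of U ?f ?T]) auto
qed

lemma vball_tensor_schwartz:
  fixes B C :: "'p::prime_card padic ^ 2 ^ 2"
  assumes GL: "B \<in> carrier GL2" "C \<in> carrier GL2"
  shows "tensor (indicator (vball m v)) (indicator (gcoset (B, C))) \<in> schwartz_tensor"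
proof -
  have "compact (vball m v)"
    unfolding compact_eq_bounded_closed
  proof
    have "dist v w \<le> 2" if "w \<in> vball m v" for w
    proof -
      have "dist v w \<le> (\<Sum>i\<in>UNIV. dist (v $ i) (w $ i))"
        unfolding dist_vec_def by (rule L2_set_le_sum) simp
      also have "\<dots> \<le> (\<Sum>i\<in>(UNIV::2 set). 1)"
      proof (rule sum_mono)
        fix i :: 2
        have "padic_norm (w $ i - v $ i) \<le> (1 / real CARD('p)) ^ m" using that by (simp add: vball_def)
        also have "\<dots> \<le> 1" using prime_card_gt_1[where 'p='p] by (simp add: power_le_one)
        finally show "dist (v $ i) (w $ i) \<le> 1" by (simp add: dist_padic padic_norm_diff_commute)
      qed
      finally show ?thesis by simp
    qed
    then show "bounded (vball m v)" unfolding bounded_any_center[of _ v] by blast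
    have "- vball m v = (\<Union>w\<in>- vball m v. vball m w)"
    proof
      show "- vball m v \<subseteq> (\<Union>w\<in>- vball m v. vball m w)" using vball_self by fast
      have False if "w \<notin> vball m v" "x \<in> vball m w" "x \<in> vball m v" for w x
        using that vball_eq[OF that(2)] vball_eq[OF that(3)] vball_self[of w m] by simp
      then show "(\<Union>w\<in>- vball m v. vball m w) \<subseteq> - vball m v" by fast
    qed
    moreover have "open (\<Union>w\<in>- vball m v. vball m w)" by (intro open_UN ballI open_vball)
    ultimately have "open (- vball m v)" by simp
    then show "closed (vball m v)" by (simp add: closed_def)
  qed
  then have "indicator (vball m v) \<in> schwartz_space" by (intro indicator_in_schwartz_space open_vball)
  moreover have "indicator (gcoset (B, C)) \<in> smooth_right_inv"
    using GL by (intro indicator_gcoset_smooth) (simp add: carrier_GG)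
  ultimately show ?thesis unfolding schwartz_tensor_def tensor_space_def by (blast intro: fun_vs.span_base)
qed

text \<open>A ball containing 0 is a lattice. Any other ball is moved to one around (1, 0) with
  positive exponent, at the cost of changing \<open>B\<close> and \<open>C\<close>.\<close>

lemma vball_tensor_reducible:
  fixes B C :: "'p::prime_card padic ^ 2 ^ 2"
  assumes GL: "B \<in> carrier GL2" "C \<in> carrier GL2"
  shows "tensor (indicator (vball m v)) (indicator (gcoset (B, C))) \<in> reducible"
proof -
  obtain x y where v: "v = vector [x, y]" by (rule vector2_cases)
  have p1: "1 < real CARD('p)" by (rule prime_card_gt_1)
  show ?thesis
  proof (cases "0 \<in> vball m v")
    case True
    have "w \<in> vball m v \<longleftrightarrow> w v* mat2 (unif powi (- int m)) 0 0 (unif powi (- int m)) \<in> std_lattice" for w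
    proof -
      obtain a b where w: "w = vector [a, b]" by (rule vector2_cases)
      have s: "a * unif powi (- int m) \<in> padic_int \<longleftrightarrow> padic_norm a \<le> (1 / real CARD('p)) ^ m" for a :: "'p padic"
        using p1 by (simp add: padic_int_iff padic_norm_mult padic_norm_unif_powi power_one_over field_simps)
      have "w \<in> vball m v \<longleftrightarrow> w \<in> vball m 0" using vball_eq[OF True] by simp
      then show ?thesis by (simp add: w vector_mat2 s) (simp add: vball_def forall_2)
    qed
    then have "indicator (vball m v) =
        (\<lambda>w. indicator std_lattice (w v* mat2 (unif powi (- int m)) 0 0 (unif powi (- int m))) :: complex)"
      by (simp add: fun_eq_iff indicator_def)
    then have "tensor (indicator (vball m v)) (indicator (gcoset (B, C))) =
        lattice_symbol (mat2 (unif powi (- int m)) 0 0 (unif powi (- int m))) B C"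
      by (simp add: lattice_symbol_def)
    then show ?thesis using GL by (simp add: lattice_symbol_reducible mat2_in_GL2)
  next
    case False
    \<comment> \<open>\<open>v\<close> is p^k times a primitive vector, and a primitive vector is
      the first row of some matrix in \<open>GL2_int\<close>; |v| is p^-k.\<close>
    have ex: "\<exists>k \<kappa>. \<kappa> \<in> GL2_int \<and> v = vector [1, 0] v* (mat2 (unif powi k) 0 0 (unif powi k) ** \<kappa>) \<and>
        real CARD('p) powi (- k) = max (padic_norm x) (padic_norm y)"
    proof (cases "padic_norm y \<le> padic_norm x")
      case True
      have "x \<noteq> 0"
      proof
        assume "x = 0"
        then have "y = 0" using True padic_norm_nonneg[of y] by (simp add: padic_norm_eq_0)
        then show False using False \<open>x = 0\<close> by (simp add: v vball_def forall_2)
      qed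
      then obtain k u where u: "x = unif powi k * u" "padic_norm u = 1" by (rule padic_unit_decomp)
      have nx: "padic_norm x = real CARD('p) powi (- k)" using u by (simp add: padic_norm_mult padic_norm_unif_powi)
      have "padic_norm (y / unif powi k) \<le> 1"
        using True nx p1 by (simp add: padic_norm_divide padic_norm_unif_powi)
      then have "mat2 u (y / unif powi k) 0 1 \<in> GL2_int" using u by (simp add: mat2_in_GL2_int padic_int_iff)
      moreover have "v = vector [1, 0] v* (mat2 (unif powi k) 0 0 (unif powi k) ** mat2 u (y / unif powi k) 0 1)"
        by (simp add: v vector_mat2 u(1))
      ultimately show ?thesis using nx True by (intro exI[of _ k] exI conjI) (auto simp: max_def)
    next
      case F: False
      then have "y \<noteq> 0" using padic_norm_nonneg[of x] by auto
      then obtain k u where u: "y = unif powi k * u" "padic_norm u = 1" by (rule padic_unit_decomp)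
      have ny: "padic_norm y = real CARD('p) powi (- k)" using u by (simp add: padic_norm_mult padic_norm_unif_powi)
      have "padic_norm (x / unif powi k) \<le> 1"
        using F ny p1 by (simp add: padic_norm_divide padic_norm_unif_powi)
      then have "mat2 (x / unif powi k) u 1 0 \<in> GL2_int" using u by (simp add: mat2_in_GL2_int padic_int_iff padic_norm_minus)
      moreover have "v = vector [1, 0] v* (mat2 (unif powi k) 0 0 (unif powi k) ** mat2 (x / unif powi k) u 1 0)"
        by (simp add: v vector_mat2 u(1))
      ultimately show ?thesis using ny F by (intro exI[of _ k] exI conjI) (auto simp: max_def)
    qed
    then obtain k \<kappa> where \<kappa>: "\<kappa> \<in> GL2_int" "v = vector [1, 0] v* (mat2 (unif powi k) 0 0 (unif powi k) ** \<kappa>)"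
      and k: "real CARD('p) powi (- k) = max (padic_norm x) (padic_norm y)" by blast
    \<comment> \<open>Since 0 lies outside the ball, |v| exceeds the radius. Hence the rescaled
      exponent \<open>r\<close> is positive, as the averaging over units requires.\<close>
    have "(1 / real CARD('p)) ^ m < real CARD('p) powi (- k)"
      using False unfolding k by (auto simp: v vball_def forall_2 padic_norm_minus)
    moreover have "(1 / real CARD('p)) ^ m = real CARD('p) powi (- int m)"
      by (simp add: power_int_minus power_one_over inverse_eq_divide)
    ultimately have km: "k < int m" using powi_less_cancel_iff[OF p1] by simp
    define r where "r = nat (int m - k)"
    have r: "0 < r" "int r = int m - k" using km by (simp_all add: r_def)
    define N where "N = mat2 (unif powi k) 0 0 (unif powi k) ** \<kappa>"
    have NGL: "N \<in> carrier GL2" using \<kappa>(1) by (simp add: N_def mat2_in_GL2)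
    have mem: "w v* N \<in> vball m v \<longleftrightarrow> w \<in> vball r (vector [1, 0])" for w
    proof -
      define d where "d = w - vector [1, 0]"
      obtain a b where d: "d = vector [a, b]" by (rule vector2_cases)
      have s: "z * unif powi (- int n) \<in> padic_int \<longleftrightarrow> padic_norm z \<le> (1 / real CARD('p)) ^ n" for z :: "'p padic" and n
        using p1 by (simp add: padic_int_iff padic_norm_mult padic_norm_unif_powi power_one_over field_simps)
      have vb: "w \<in> vball n u \<longleftrightarrow> (w - u) v* mat2 (unif powi (- int n)) 0 0 (unif powi (- int n)) \<in> std_lattice"
        for n and w u :: "'p padic ^ 2"
      proof -
        obtain a b where ab: "w - u = vector [a, b]" by (rule vector2_cases)
        have "w $ 1 - u $ 1 = a" "w $ 2 - u $ 2 = b"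
          using arg_cong[OF ab, of "\<lambda>v. v $ 1"] arg_cong[OF ab, of "\<lambda>v. v $ 2"] by simp_all
        then show ?thesis by (simp add: vball_def forall_2 ab vector_mat2 s)
      qed
      let ?s = "\<lambda>k. mat2 (unif powi k) 0 0 (unif powi k) :: 'p padic ^ 2 ^ 2"
      have comm: "\<kappa> ** ?s n = ?s n ** \<kappa>" for n
        by (rule mat2_cases[of \<kappa>]) (simp add: mult.commute)
      have "w v* N - v = d v* N"
        by (simp add: \<kappa>(2) N_def d_def vector_matrix_mult_diff_distrib)
      then have "w v* N \<in> vball m v \<longleftrightarrow> d v* N v* ?s (- int m) \<in> std_lattice" by (simp add: vb)
      also have "d v* N v* ?s (- int m) = d v* (?s k ** ?s (- int m)) v* \<kappa>"
        by (simp only: N_def vector_matrix_mul_assoc matrix_mul_assoc[symmetric] comm)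
      also have "?s k ** ?s (- int m) = ?s (- int r)"
        by (simp add: r(2) unif_powi_simps divide_inverse)
      also have "d v* ?s (- int r) v* \<kappa> \<in> std_lattice \<longleftrightarrow> d v* ?s (- int r) \<in> std_lattice"
        by (rule std_lattice_mult_K[OF \<kappa>(1)])
      also have "\<dots> \<longleftrightarrow> w \<in> vball r (vector [1, 0])" by (simp add: vb d_def)
      finally show ?thesis .
    qed
    let ?T = "tensor (indicator (vball m v)) (indicator (gcoset (B, C))) :: ('p padic ^ 2) \<times> 'p GG \<Rightarrow> complex"
    have "diag_act N ?T = tensor (indicator (vball r (vector [1, 0]))) (indicator (gcoset (N ** B, N ** C)))"
    proof -
      have "(\<lambda>w. indicator (vball m v) (w v* N) :: complex) = indicator (vball r (vector [1, 0]))"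
        using mem by (simp add: fun_eq_iff indicator_def)
      then show ?thesis by (simp only: diag_act_tensor_gcoset[OF NGL GL])
    qed
    also have "\<dots> \<in> reducible"
      using GL NGL r(1) by (intro unit_vball_reducible vball_tensor_schwartz) simp_all
    finally show ?thesis
      using reducible_cong[OF diag_act_diff_reducible(1)[OF NGL vball_tensor_schwartz[OF GL]]] by blast
  qed
qed

lemma schwartz_tensor_reducible: "schwartz_tensor \<subseteq> (reducible :: (('p::prime_card padic ^ 2) \<times> 'p GG \<Rightarrow> complex) set)"
  unfolding schwartz_tensor_def tensor_space_def
proof (rule fun_vs.span_minimal[OF _ subspace_reducible], clarify)
  fix \<phi> :: "'p padic ^ 2 \<Rightarrow> complex" and \<xi> :: "'p GG \<Rightarrow> complex"
  assume "\<phi> \<in> schwartz_space" "\<xi> \<in> smooth_right_inv"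
  obtain m X where X: "finite X" "\<phi> = (\<Sum>x\<in>X. cscale (\<phi> x) (indicator (vball m x)))"
    using schwartz_decomp[OF \<open>\<phi> \<in> schwartz_space\<close>] by blast
  obtain Y where Y: "finite Y" "Y \<subseteq> carrier GG" "\<xi> = (\<Sum>y\<in>Y. cscale (\<xi> y) (indicator (gcoset y)))"
    using smooth_right_inv_decomp[OF \<open>\<xi> \<in> smooth_right_inv\<close>] by blast
  have "tensor \<phi> \<xi> = (\<Sum>x\<in>X. \<Sum>y\<in>Y. cscale (\<phi> x * \<xi> y) (tensor (indicator (vball m x)) (indicator (gcoset y))))"
  proof
    fix z :: "('p padic ^ 2) \<times> 'p GG"
    obtain v g where z: "z = (v, g)" by (cases z)
    have "tensor \<phi> \<xi> z = (\<Sum>x\<in>X. \<phi> x * indicator (vball m x) v) * (\<Sum>y\<in>Y. \<xi> y * indicator (gcoset y) g)"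
      using fun_cong[OF X(2), of v] fun_cong[OF Y(3), of g] by (simp add: z tensor_def sum_fun_apply cscale_def)
    then show "tensor \<phi> \<xi> z = (\<Sum>x\<in>X. \<Sum>y\<in>Y. cscale (\<phi> x * \<xi> y) (tensor (indicator (vball m x)) (indicator (gcoset y)))) z"
      by (simp add: z sum_fun_apply cscale_def tensor_def sum_product mult_ac)
  qed
  also have "\<dots> \<in> reducible"
  proof (intro reducible_sum reducible_scale)
    fix x y assume "y \<in> Y"
    then have "fst y \<in> carrier GL2" "snd y \<in> carrier GL2" using Y(2) by (auto simp: carrier_GG)
    then show "tensor (indicator (vball m x)) (indicator (gcoset y)) \<in> reducible"
      using vball_tensor_reducible[of "fst y" "snd y" m x] by simp
  qed
  finally show "tensor \<phi> \<xi> \<in> reducible" .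
qed

theorem theorem3p2:
  fixes M :: "('p::prime_card) GG measure"
  assumes "haar_measure GG M" and "emeasure M GG_int = 1"
  shows "cyclic_with_generator (hecke_algebra M) (coinv_module M)
           (coinv_class (tensor (indicator {v. \<forall>i. v $ i \<in> padic_int}) (indicator GG_int)))"
  using cyclic_if_bi_inv_representatives[OF assms] schwartz_tensor_reducible
  unfolding std_lattice_def reducible_def by blast

end
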